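(* Let $d$ be an odd prime, let $p$ be an odd prime with $p\neq d$, and let $q=p^r$ ($r\in\mathbb{Z}^+$) be such that $q\not\equiv 1 \pmod{d}$. Let $\lambda\in\mathbb{F}_q$ and let $X_\lambda^d$ be the Dwork hypersurface $$X_{\lambda}^d:\; x_1^d+x_2^d+\cdots+x_d^d=d\lambda\, x_1x_2\cdots x_d$$ in projective space $\mathbb{P}^{d-1}$. Then the number of $\mathbb{F}_q$-rational points on $X_\lambda^d$ is $$\#X_{\lambda}^d(\mathbb{F}_q)=\frac{q^{d-1}-1}{q-1}-{}_{d-1}G_{d-1}\left[\begin{array}{cccc}\frac{1}{d}, & \frac{2}{d}, & \ldots, & \frac{d-1}{d} \\ 0, & 0, & \ldots, & 0\end{array}\Big|\,\lambda^d\right]_q.$$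
   Context: Notation: for $x\in\mathbb{Q}$, $\lfloor x\rfloor$ is the greatest integer $\le x$ and $\langle x\rangle=x-\lfloor x\rfloor$. $\mathbb{Z}_p$ is the ring of $p$-adic integers, $\mathbb{Z}_q$ the ring of integers of the unramified extension of $\mathbb{Q}_p$ with residue field $\mathbb{F}_q$. $\omega:\mathbb{F}_q^\times\to\mathbb{Z}_q^\times$ is the Teichmüller character ($\omega(a)$ is the $(q-1)$-th root of unity congruent to $a$ mod $p$), $\overline{\omega}=\omega^{-1}$, and characters are extended by $\chi(0)=0$. $\Gamma_p$ is Morita's $p$-adic gamma function: $\Gamma_p(n)=(-1)^n\prod_{0<j<n,\,p\nmid j} j$ for $n\in\mathbb{Z}^+$, extended continuously to $\mathbb{Z}_p$ (with $\Gamma_p(0)=1$). McCarthy's function: for $t\in\mathbb{F}_q$, $n\in\mathbb{Z}^+$, and $a_i,b_i\in\mathbb{Q}\cap\mathbb{Z}_p$ ($1\le i\le n$), $${}_nG_n\left[\begin{array}{ccc}a_1,&\ldots,&a_n\\ b_1,&\ldots,&b_n\end{array}\Big|\,t\right]_q:=\frac{-1}{q-1}\sum_{j=0}^{q-2}(-1)^{jn}\,\overline{\omega}^j(t)\prod_{i=1}^n\prod_{k=0}^{r-1}(-p)^{-\lfloor\langle a_ip^k\rangle-\frac{jp^k}{q-1}\rfloor-\lfloor\langle -b_ip^k\rangle+\frac{jp^k}{q-1}\rfloor}\frac{\Gamma_p(\langle (a_i-\frac{j}{q-1})p^k\rangle)}{\Gamma_p(\langle a_ip^k\rangle)}\frac{\Gamma_p(\langle(-b_i+\frac{j}{q-1})p^k\rangle)}{\Gamma_p(\langle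 -b_ip^k\rangle)}.$$ *)

theory Defs
  imports Complex_Main "HOL-Computational_Algebra.Primes"
begin

section \<open>A model of Q_q: complete discretely valued field of char 0, valuation v with v(p)=1,
  residue field 'f (the unramified extension of Q_p with residue field F_q, unique up to iso)\<close>

definition padic_int :: "('k::field \<Rightarrow> int) \<Rightarrow> 'k set" where
  "padic_int v = {x. x = 0 \<or> v x \<ge> 0}"

definition padic_lim :: "('k::field \<Rightarrow> int) \<Rightarrow> (nat \<Rightarrow> 'k) \<Rightarrow> 'k \<Rightarrow> bool" where
  "padic_lim v s L \<longleftrightarrow> (\<forall>M. \<exists>N. \<forall>n\<ge>N. s n = L \<or> v (s n - L) \<ge> M)"

definition padic_cauchy :: "('k::field \<Rightarrow> int) \<Rightarrow> (nat \<Rightarrow> 'k) \<Rightarrow> bool" where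
  "padic_cauchy v s \<longleftrightarrow> (\<forall>M. \<exists>N. \<forall>m\<ge>N. \<forall>n\<ge>N. s m = s n \<or> v (s m - s n) \<ge> M)"

definition unram_ext :: "nat \<Rightarrow> ('k::field_char_0 \<Rightarrow> int) \<Rightarrow> ('k \<Rightarrow> 'f::field) \<Rightarrow> bool" where
  "unram_ext p v res \<longleftrightarrow>
     (\<forall>x y. x \<noteq> 0 \<longrightarrow> y \<noteq> 0 \<longrightarrow> v (x * y) = v x + v y) \<and>
     (\<forall>x y. x \<noteq> 0 \<longrightarrow> y \<noteq> 0 \<longrightarrow> x + y \<noteq> 0 \<longrightarrow> v (x + y) \<ge> min (v x) (v y)) \<and>
     v (of_nat p) = 1 \<and>
     (\<forall>s. padic_cauchy v s \<longrightarrow> (\<exists>L. padic_lim v s L)) \<and>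
     (\<forall>x\<in>padic_int v. \<forall>y\<in>padic_int v. res (x + y) = res x + res y \<and> res (x * y) = res x * res y) \<and>
     res 1 = 1 \<and>
     res ` padic_int v = UNIV \<and>
     (\<forall>x\<in>padic_int v. res x = 0 \<longleftrightarrow> (x = 0 \<or> v x \<ge> 1))"

definition teich :: "('k::field_char_0 \<Rightarrow> int) \<Rightarrow> ('k \<Rightarrow> 'f::{finite,field}) \<Rightarrow> 'f \<Rightarrow> 'k" where
  "teich v res a = (if a = 0 then 0 else
      (THE z. z \<in> padic_int v \<and> z ^ (card (UNIV :: 'f set) - 1) = 1 \<and> res z = a))"

definition omega_bar_pow :: "('k::field_char_0 \<Rightarrow> int) \<Rightarrow> ('k \<Rightarrow> 'f::{finite,field}) \<Rightarrow> nat \<Rightarrow> 'f \<Rightarrow> 'k" where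
  "omega_bar_pow v res j t = (if t = 0 then 0 else inverse (teich v res t) ^ j)"

definition gamma_nat :: "nat \<Rightarrow> nat \<Rightarrow> int" where
  "gamma_nat p n = (-1) ^ n * (\<Prod>j\<in>{j. 0 < j \<and> j < n \<and> \<not> p dvd j}. int j)"

definition padic_gamma :: "nat \<Rightarrow> ('k::field_char_0 \<Rightarrow> int) \<Rightarrow> rat \<Rightarrow> 'k" where
  "padic_gamma p v x = (THE L. \<forall>s::nat \<Rightarrow> nat. (\<forall>k. 0 < s k) \<longrightarrow>
       padic_lim v (\<lambda>k. of_nat (s k)) (of_rat x) \<longrightarrow>
       padic_lim v (\<lambda>k. of_int (gamma_nat p (s k))) L)"

definition mcG :: "nat \<Rightarrow> nat \<Rightarrow> ('k::field_char_0 \<Rightarrow> int) \<Rightarrow> ('k \<Rightarrow> 'f::{finite,field}) \<Rightarrow>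
    nat \<Rightarrow> (nat \<Rightarrow> rat) \<Rightarrow> (nat \<Rightarrow> rat) \<Rightarrow> 'f \<Rightarrow> 'k" where
  "mcG p r v res n a b t =
    (let q = p ^ r in
     (-1) / (of_nat q - 1) *
     (\<Sum>j\<in>{0..q-2}. (-1) ^ (j * n) * omega_bar_pow v res j t *
        (\<Prod>i\<in>{1..n}. \<Prod>k\<in>{0..r-1}.
           let jq = of_nat j * of_nat p ^ k / (of_nat q - 1) :: rat in
           (- of_nat p) powi
              (- \<lfloor>frac (a i * of_nat p ^ k) - jq\<rfloor> - \<lfloor>frac (- b i * of_nat p ^ k) + jq\<rfloor>) *
           (padic_gamma p v (frac ((a i - of_nat j / (of_nat q - 1)) * of_nat p ^ k))
              / padic_gamma p v (frac (a i * of_nat p ^ k))) *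
           (padic_gamma p v (frac ((- b i + of_nat j / (of_nat q - 1)) * of_nat p ^ k))
              / padic_gamma p v (frac (- b i * of_nat p ^ k))))))"

definition proj_points :: "nat \<Rightarrow> ((nat \<Rightarrow> 'f::field) \<Rightarrow> bool) \<Rightarrow> (nat \<Rightarrow> 'f) set set" where
  "proj_points d P =
    (let A = {x. (\<forall>i\<ge>d. x i = 0) \<and> (\<exists>i<d. x i \<noteq> 0) \<and> P x} in
     A // {(x, y). x \<in> A \<and> y \<in> A \<and> (\<exists>c. c \<noteq> 0 \<and> y = (\<lambda>i. c * x i))})"

definition dwork_points :: "nat \<Rightarrow> 'f::field \<Rightarrow> (nat \<Rightarrow> 'f) set set" where
  "dwork_points d lam = proj_points d (\<lambda>x. (\<Sum>i<d. x i ^ d) = of_nat d * lam * (\<Prod>i<d. x i))"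

end

theory Submission
  imports Defs "HOL-Number_Theory.Number_Theory" "HOL-Computational_Algebra.Formal_Power_Series"
    "HOL-Computational_Algebra.Polynomial" "HOL-Library.FuncSet"
begin

text \<open>Write \<open>q = p^r\<close>. Since \<open>x \<mapsto> x^d\<close> permutes the residue field, a point of the torus lies on the
hypersurface iff its coordinatewise \<open>d\<close>-th power \<open>y\<close> satisfies \<open>(\<Sum> y_i)^d = (d \<lambda>)^d \<Prod> y_i\<close>.
Expanding this condition in the characters \<open>\<omega>^j\<close> gives Jacobi sums with \<open>d\<close> equal characters, and
points off the torus do not see \<open>\<lambda>\<close>.

A Jacobi sum is a quotient of Gauss sums, and these are computed by Dwork's method. With
\<open>\<pi>^(p-1) = -p\<close>, the series \<open>exp (\<pi> (x - x^q))\<close> converges beyond the unit disc; evaluated at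
Teichmueller points it is an additive character, so the Gauss sum of \<open>\<omega>^(-a)\<close> is
\<open>(q - 1) \<Sum> b_n\<close> over the coefficients with \<open>n \<equiv> a (mod q - 1)\<close>. This is the trace of a Frobenius
matrix \<open>A\<close> which commutes, up to the factor \<open>q\<close>, with a derivation whose cokernel is a line; hence
\<open>(1 - q) Tr A\<close> is the scalar by which \<open>A\<close> acts on that line. For an integral twist this scalar is a
quotient of factorials, and letting the integers tend to \<open>-a/(q-1)\<close> yields the Gross-Koblitz
formula. The factors \<open>i/d\<close> are finally absorbed by the multiplication formula for the gamma function.

The field has no element \<open>\<pi>\<close>. All series are therefore written in \<open>u = \<pi> x\<close>, which makes their
coefficients rational, and evaluation at \<open>x = 1\<close> is only done on exponents in one residue class
modulo \<open>q - 1\<close>, where \<open>u^(q-1)\<close> becomes \<open>w = \<pi>^(q-1)\<close>.\<close>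

section \<open>Valuations and limits\<close>

text \<open>Since \<open>d\<close> is prime and does not divide \<open>q - 1\<close>, it is coprime
  to \<open>q - 1\<close>: no index \<open>0 < j < q - 1\<close> becomes trivial after
  multiplication by \<open>d\<close>, so only Gauss sums of nontrivial characters occur. The trace
  of \<open>A\<close> exists because the Dwork series has a rate of decay \<open>c\<close> with
  \<open>c q > 1\<close>. The value \<open>c = (p-1)^2 / (p q)\<close> comes from the first term of
  the Artin-Hasse logarithm that Dwork's series lacks, and \<open>c q > 1\<close> amounts to
  \<open>(p-1)^2 > p\<close>. Rationality of coefficients matters beyond bookkeeping: Dwork's
  integrality lemma needs \<open>x^p\<close> congruent to \<open>x\<close> modulo \<open>p\<close>,
  which fails for general residues when \<open>r > 1\<close>. The scalar on the cokernel is
  accessible once an integer \<open>X\<close> replaces \<open>-\<kappa>\<close>, where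
  \<open>\<kappa> = a/(q-1)\<close>: the linear form then takes falling factorials as values, and a
  coefficient comparison with \<open>exp u\<close> gives \<open>w^X X! / (q X + a)!\<close>. Along
  suitable \<open>X\<close> tending to \<open>-\<kappa>\<close> these are ratios of factorials of
  consecutive members of one sequence, and what is left of a factorial without its multiples of
  \<open>p\<close> is a value of Morita's gamma function.\<close>

locale unram =
  fixes p r :: nat and v :: "'k::field_char_0 \<Rightarrow> int" and res :: "'k \<Rightarrow> 'f::{finite,field}"
  assumes prime_p: "prime p" and odd_p: "odd p" and r_pos: "r > 0"
    and card_F: "card (UNIV :: 'f set) = p ^ r" and unram: "unram_ext p v res"
begin

definition pid :: "int \<Rightarrow> 'k set" where "pid M = {x. x = 0 \<or> v x \<ge> M}"

abbreviation q :: nat where "q \<equiv> p ^ r"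

lemma v_mult: "x \<noteq> 0 \<Longrightarrow> y \<noteq> 0 \<Longrightarrow> v (x * y) = v x + v y"
  using unram unfolding unram_ext_def by blast

lemma v_add: "x \<noteq> 0 \<Longrightarrow> y \<noteq> 0 \<Longrightarrow> x + y \<noteq> 0 \<Longrightarrow> v (x + y) \<ge> min (v x) (v y)"
  using unram unfolding unram_ext_def by blast

lemma v_p: "v (of_nat p) = 1"
  using unram unfolding unram_ext_def by blast

lemma complete: "padic_cauchy v s \<Longrightarrow> \<exists>L. padic_lim v s L"
  using unram unfolding unram_ext_def by blast

lemma pid_0_eq: "padic_int v = pid 0"
  by (simp add: padic_int_def pid_def)

lemma res_add: "x \<in> pid 0 \<Longrightarrow> y \<in> pid 0 \<Longrightarrow> res (x + y) = res x + res y"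
  and res_mult: "x \<in> pid 0 \<Longrightarrow> y \<in> pid 0 \<Longrightarrow> res (x * y) = res x * res y"
  and res_1: "res 1 = 1"
  and res_surj: "res ` pid 0 = UNIV"
  using unram unfolding unram_ext_def pid_0_eq by blast+

lemma res_eq_0_iff: "x \<in> pid 0 \<Longrightarrow> res x = 0 \<longleftrightarrow> x \<in> pid 1"
  using unram unfolding unram_ext_def pid_0_eq by (auto simp: pid_def)

lemma p_gt_2: "p > 2"
  using prime_p odd_p prime_ge_2_nat[of p] by (cases "p = 2") auto

lemma q_ge_3: "q \<ge> 3"
proof -
  have "p ^ 1 \<le> p ^ r" using r_pos p_gt_2 by (intro power_increasing) auto
  then show ?thesis using p_gt_2 by simp
qed

lemma odd_q: "odd q" using odd_p by simp

lemma of_nat_q1: "of_nat (q - 1) = (of_nat q - 1 :: 'a::ring_1)"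
  using q_ge_3 by (subst of_nat_diff) auto

lemma v_1 [simp]: "v 1 = 0"
  using v_mult[of 1 1] by simp

lemma v_minus_1: "v (- 1) = 0"
  using v_mult[of "-1" "-1"] by simp

lemma v_minus [simp]: "v (- x) = v x"
proof (cases "x = 0")
  case False
  then show ?thesis using v_mult[of "-1" x] v_minus_1 by simp
qed simp

lemma v_power: "x \<noteq> 0 \<Longrightarrow> v (x ^ n) = int n * v x"
  by (induction n) (auto simp: v_mult algebra_simps)

lemma v_inverse: "x \<noteq> 0 \<Longrightarrow> v (inverse x) = - v x"
  using v_mult[of x "inverse x"] by simp

lemma v_divide: "x \<noteq> 0 \<Longrightarrow> y \<noteq> 0 \<Longrightarrow> v (x / y) = v x - v y"
  by (simp add: divide_inverse v_mult v_inverse)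

lemma pid_0 [simp]: "0 \<in> pid M" by (simp add: pid_def)

lemma pid_minus: "x \<in> pid M \<Longrightarrow> - x \<in> pid M" by (auto simp: pid_def)

lemma pid_add: "x \<in> pid M \<Longrightarrow> y \<in> pid M \<Longrightarrow> x + y \<in> pid M"
  using v_add[of x y] by (cases "x = 0"; cases "y = 0"; cases "x + y = 0") (auto simp: pid_def)

lemma pid_diff: "x \<in> pid M \<Longrightarrow> y \<in> pid M \<Longrightarrow> x - y \<in> pid M"
  using pid_add[of x M "- y"] pid_minus[of y M] by simp

lemma pid_mult: "x \<in> pid M \<Longrightarrow> y \<in> pid N \<Longrightarrow> x * y \<in> pid (M + N)"
  using v_mult[of x y] by (cases "x = 0"; cases "y = 0") (auto simp: pid_def)

lemma pid_mult_int: "x \<in> pid 0 \<Longrightarrow> y \<in> pid M \<Longrightarrow> x * y \<in> pid M"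
  using pid_mult[of x 0 y M] by simp

lemma pid_sum: "(\<And>i. i \<in> A \<Longrightarrow> f i \<in> pid M) \<Longrightarrow> (\<Sum>i\<in>A. f i) \<in> pid M"
  by (induction A rule: infinite_finite_induct) (auto intro: pid_add)

lemma pid_mono: "x \<in> pid M \<Longrightarrow> N \<le> M \<Longrightarrow> x \<in> pid N"
  by (auto simp: pid_def)

lemma pid_1 [simp]: "1 \<in> pid 0" by (simp add: pid_def)

lemma pid_prod: "(\<And>i. i \<in> A \<Longrightarrow> f i \<in> pid 0) \<Longrightarrow> (\<Prod>i\<in>A. f i) \<in> pid 0"
  by (induction A rule: infinite_finite_induct) (auto intro: pid_mult_int)

lemma pid_power: "x \<in> pid 0 \<Longrightarrow> x ^ n \<in> pid 0"
  by (induction n) (auto intro: pid_mult_int)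

lemma pid_of_nat [simp]: "of_nat n \<in> pid 0"
  by (induction n) (auto intro: pid_add)

lemma pid_of_int [simp]: "of_int n \<in> pid 0"
  by (cases n) (auto simp del: of_nat_Suc intro!: pid_minus)

lemma pid_p_power: "of_nat p ^ n \<in> pid (int n)"
  using prime_p by (auto simp: pid_def v_power v_p)

lemma pid_all_eq_0: "(\<And>M. x \<in> pid M) \<Longrightarrow> x = 0"
proof (rule ccontr)
  assume "\<And>M. x \<in> pid M" "x \<noteq> 0"
  then have "v x \<ge> v x + 1" by (auto simp: pid_def)
  then show False by simp
qed

lemma pid_of_int_dvd: "int p ^ n dvd m \<Longrightarrow> of_int m \<in> pid (int n)"
  by (auto elim!: dvdE simp: mult.commute intro!: pid_mult_int pid_p_power)

lemma one_notin_pid: "M > 0 \<Longrightarrow> 1 \<notin> pid M" by (simp add: pid_def)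

lemma of_int_notin_pid_1: "\<not> int p dvd m \<Longrightarrow> of_int m \<notin> pid 1"
proof
  assume nd: "\<not> int p dvd m" and m: "of_int m \<in> pid 1"
  then have "coprime (int p) m" using prime_p by (simp add: prime_imp_coprime)
  then obtain a b where "a * int p + b * m = 1" by (metis bezout_int coprime_imp_gcd_eq_1)
  then have "(of_int (a * int p + b * m) :: 'k) = of_int 1" by simp
  then have "(1::'k) = of_int a * of_nat p + of_int b * of_int m" by simp
  also have "\<dots> \<in> pid 1" using m pid_p_power[of 1] by (auto intro!: pid_add pid_mult_int)
  finally show False using one_notin_pid by simp
qed

lemma v_of_int_eq_0: "\<not> int p dvd m \<Longrightarrow> v (of_int m) = 0"
  using of_int_notin_pid_1[of m] pid_of_int[of m] by (auto simp: pid_def simp del: pid_of_int)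

lemma v_of_nat_eq_0: "\<not> p dvd m \<Longrightarrow> v (of_nat m) = 0"
  using v_of_int_eq_0[of "int m"] by simp

text \<open>On the integers \<open>v\<close> is the ordinary p-adic valuation; integer congruences
  modulo powers of \<open>p\<close> pass to the field and back through this equivalence.\<close>

lemma of_int_in_pid_iff: "of_int m \<in> pid (int n) \<longleftrightarrow> int p ^ n dvd m"
proof
  show "int p ^ n dvd m \<Longrightarrow> of_int m \<in> pid (int n)" by (rule pid_of_int_dvd)
next
  show "of_int m \<in> pid (int n) \<Longrightarrow> int p ^ n dvd m"
  proof (induction n arbitrary: m)
    case (Suc n)
    have "of_int m \<in> pid 1" using Suc.prems pid_mono by fastforce
    then have "int p dvd m" using of_int_notin_pid_1 by blast
    then obtain m' where m': "m = int p * m'" by blast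
    have "of_int m' \<in> pid (int n)"
    proof (cases "m' = 0")
      case False
      then show ?thesis using Suc.prems m' prime_p by (auto simp: pid_def v_mult v_p)
    qed simp
    then show ?case using Suc.IH m' by auto
  qed simp
qed

definition unit :: "'k \<Rightarrow> bool" where "unit x \<longleftrightarrow> x \<noteq> 0 \<and> v x = 0"

lemma unit_mult: "unit x \<Longrightarrow> unit y \<Longrightarrow> unit (x * y)"
  by (simp add: unit_def v_mult)

lemma unit_pid: "unit x \<Longrightarrow> x \<in> pid 0" by (simp add: unit_def pid_def)

lemma unit_inverse: "unit x \<Longrightarrow> unit (inverse x)" by (simp add: unit_def v_inverse)

lemma unit_1 [simp]: "unit 1" by (simp add: unit_def)

lemma unit_cong: "unit x \<Longrightarrow> x - y \<in> pid 1 \<Longrightarrow> unit y"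
proof -
  assume x: "unit x" and xy: "x - y \<in> pid 1"
  have "y \<in> pid 0" using pid_diff[OF unit_pid[OF x] pid_mono[OF xy]] by simp
  moreover have "y \<notin> pid 1"
  proof
    assume "y \<in> pid 1"
    from pid_add[OF xy this] show False using x by (simp add: unit_def pid_def)
  qed
  ultimately show "unit y" by (auto simp: unit_def pid_def)
qed

lemma unit_of_nat: "\<not> p dvd m \<Longrightarrow> unit (of_nat m)"
  using v_of_nat_eq_0[of m] by (cases "m = 0") (auto simp: unit_def)

lemma unit_of_int: "\<not> int p dvd m \<Longrightarrow> unit (of_int m)"
  using v_of_int_eq_0[of m] by (cases "m = 0") (auto simp: unit_def)

section \<open>Limits for the valuation\<close>

abbreviation plim :: "(nat \<Rightarrow> 'k) \<Rightarrow> 'k \<Rightarrow> bool" where "plim \<equiv> padic_lim v"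

lemma plim_iff: "plim s L \<longleftrightarrow> (\<forall>M. \<forall>\<^sub>F n in sequentially. s n - L \<in> pid M)"
  by (auto simp: padic_lim_def pid_def eventually_sequentially)

lemma plimD: "plim s L \<Longrightarrow> \<forall>\<^sub>F n in sequentially. s n - L \<in> pid M"
  by (simp add: plim_iff)

lemma plim_unique: "plim s L \<Longrightarrow> plim s L' \<Longrightarrow> L = L'"
proof -
  assume a: "plim s L" "plim s L'"
  have "L - L' \<in> pid M" for M
  proof -
    have "\<forall>\<^sub>F n in sequentially. L - L' \<in> pid M"
      using plimD[OF a(1), of M] plimD[OF a(2), of M]
    proof eventually_elim
      case (elim n)
      from pid_diff[OF elim(2) elim(1)] show ?case by simp
    qed
    then show ?thesis by simp
  qed
  then show ?thesis using pid_all_eq_0[of "L - L'"] by auto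
qed

lemma plim_const [simp]: "plim (\<lambda>_. c) c" by (simp add: plim_iff)

lemma plim_add: "plim s L \<Longrightarrow> plim t K \<Longrightarrow> plim (\<lambda>n. s n + t n) (L + K)"
  unfolding plim_iff
proof
  fix M assume a: "\<forall>M. \<forall>\<^sub>F n in sequentially. s n - L \<in> pid M" "\<forall>M. \<forall>\<^sub>F n in sequentially. t n - K \<in> pid M"
  show "\<forall>\<^sub>F n in sequentially. s n + t n - (L + K) \<in> pid M"
    using a[rule_format, of M]
  proof eventually_elim
    case (elim n)
    from pid_add[OF elim] show ?case by (simp add: algebra_simps)
  qed
qed

lemma plim_bdd: "plim s L \<Longrightarrow> \<exists>M. \<forall>\<^sub>F n in sequentially. s n \<in> pid M"
proof -
  assume a: "plim s L"
  define M where "M = min 0 (v L)"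
  have L: "L \<in> pid M" by (simp add: pid_def M_def)
  from plimD[OF a, of M] have "\<forall>\<^sub>F n in sequentially. s n \<in> pid M"
  proof eventually_elim
    case (elim n)
    from pid_add[OF elim L] show ?case by simp
  qed
  then show ?thesis ..
qed

lemma plim_mult: "plim s L \<Longrightarrow> plim t K \<Longrightarrow> plim (\<lambda>n. s n * t n) (L * K)"
proof -
  assume s: "plim s L" and t: "plim t K"
  obtain N1 where N1: "\<forall>\<^sub>F n in sequentially. s n \<in> pid N1" using plim_bdd[OF s] by blast
  define N2 where "N2 = min 0 (v K)"
  have N2: "K \<in> pid N2" by (simp add: pid_def N2_def)
  show ?thesis unfolding plim_iff
  proof
    fix M
    show "\<forall>\<^sub>F n in sequentially. s n * t n - L * K \<in> pid M"
      using N1 plimD[OF s, of "M - N2"] plimD[OF t, of "M - N1"]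
    proof eventually_elim
      case (elim n)
      have "s n * (t n - K) + (s n - L) * K \<in> pid M"
        using pid_mult[OF elim(1,3)] pid_mult[OF elim(2) N2] by (intro pid_add) auto
      then show ?case by (simp add: algebra_simps)
    qed
  qed
qed

lemma plim_cmult: "plim s L \<Longrightarrow> plim (\<lambda>n. c * s n) (c * L)"
  by (rule plim_mult) auto

lemma plim_uminus: "plim s L \<Longrightarrow> plim (\<lambda>n. - s n) (- L)"
  using plim_cmult[of s L "-1"] by simp

lemma plim_diff: "plim s L \<Longrightarrow> plim t K \<Longrightarrow> plim (\<lambda>n. s n - t n) (L - K)"
  using plim_add[of s L "\<lambda>n. - t n" "-K"] plim_uminus by simp

lemma plim_prod: "(\<And>i. i \<in> A \<Longrightarrow> plim (s i) (L i)) \<Longrightarrow> plim (\<lambda>n. \<Prod>i\<in>A. s i n) (\<Prod>i\<in>A. L i)"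
  by (induction A rule: infinite_finite_induct) (auto intro: plim_mult)

lemma plim_power: "plim s L \<Longrightarrow> plim (\<lambda>n. s n ^ k) (L ^ k)"
  by (induction k) (auto intro: plim_mult)

lemma plim_0_iff: "plim (\<lambda>n. s n - L) 0 \<longleftrightarrow> plim s L"
  by (simp add: plim_iff)

lemma plim_cong: "plim s L \<Longrightarrow> \<forall>\<^sub>F n in sequentially. s n = t n \<Longrightarrow> plim t L"
  unfolding plim_iff
proof
  fix M assume a: "\<forall>M. \<forall>\<^sub>F n in sequentially. s n - L \<in> pid M" "\<forall>\<^sub>F n in sequentially. s n = t n"
  show "\<forall>\<^sub>F n in sequentially. t n - L \<in> pid M"
    using a(1)[rule_format, of M] a(2) by eventually_elim simp
qed

lemma plim_subseq: "plim s L \<Longrightarrow> filterlim g sequentially sequentially \<Longrightarrow> plim (\<lambda>n. s (g n)) L"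
  unfolding plim_iff by (auto intro: eventually_compose_filterlim)

lemma plim_pid: "plim s L \<Longrightarrow> \<forall>\<^sub>F n in sequentially. s n \<in> pid M \<Longrightarrow> L \<in> pid M"
proof -
  assume a: "plim s L" "\<forall>\<^sub>F n in sequentially. s n \<in> pid M"
  have "\<forall>\<^sub>F n in sequentially. L \<in> pid M" using plimD[OF a(1), of M] a(2)
    by eventually_elim (use pid_diff in fastforce)
  then show ?thesis by simp
qed

lemma plim_of_pid:
  assumes "\<And>n. s n \<in> pid (g n)" "filterlim g at_top sequentially"
  shows "plim s 0"
  unfolding plim_iff
proof
  fix M
  have "\<forall>\<^sub>F n in sequentially. g n \<ge> M" using assms(2) by (simp add: filterlim_at_top)
  then show "\<forall>\<^sub>F n in sequentially. s n - 0 \<in> pid M"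
    by eventually_elim (use assms(1) pid_mono in auto)
qed

lemma plim_unit:
  assumes s: "plim s L" and u: "\<And>n. unit (s n)"
  shows "unit L"
proof -
  obtain n where "s n - L \<in> pid 1" using plimD[OF s, of 1] by (auto simp: eventually_sequentially)
  then show ?thesis using u unit_cong by blast
qed

text \<open>In an ultrametric field small consecutive differences already make a sequence Cauchy: a
  telescoping sum is no larger than its largest term.\<close>

lemma plim_Cauchy:
  assumes "\<And>M. \<forall>\<^sub>F n in sequentially. s (Suc n) - s n \<in> pid M"
  shows "\<exists>L. plim s L"
proof (rule complete)
  show "padic_cauchy v s"
    unfolding padic_cauchy_def
  proof
    fix M
    obtain N where N: "\<And>n. n \<ge> N \<Longrightarrow> s (Suc n) - s n \<in> pid M" using assms[of M] by (auto simp: eventually_sequentially)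
    have *: "s n - s N \<in> pid M" if "n \<ge> N" for n
      using that
    proof (induction n rule: dec_induct)
      case (step n)
      have "(s (Suc n) - s n) + (s n - s N) \<in> pid M"
        using step N[of n] by (intro pid_add) auto
      then show ?case by simp
    qed simp
    have "s m - s n \<in> pid M" if "m \<ge> N" "n \<ge> N" for m n
      using pid_diff[OF *[OF that(1)] *[OF that(2)]] by simp
    then show "\<exists>N. \<forall>m\<ge>N. \<forall>n\<ge>N. s m = s n \<or> v (s m - s n) \<ge> M"
      by (auto simp: pid_def intro!: exI[of _ N])
  qed
qed

end

section \<open>Growth of the Dwork exponential\<close>

unbundle fps_syntax

section \<open>Exponentials of formal power series\<close>

definition fexp :: "'a::field_char_0 fps \<Rightarrow> 'a fps" where "fexp f = fps_exp 1 oo f"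

lemma fexp_nth_0 [simp]: "fexp f $ 0 = 1" by (simp add: fexp_def)

lemma fexp_0 [simp]: "fexp 0 = 1" by (simp add: fexp_def fps_eq_iff)

lemma fexp_nth: "fexp f $ n = (\<Sum>i=0..n. (f ^ i) $ n / fact i)"
  by (simp add: fexp_def fps_compose_nth)

lemma fexp_deriv: "f $ 0 = 0 \<Longrightarrow> fps_deriv (fexp f) = fps_deriv f * fexp f"
  by (simp add: fexp_def fps_compose_deriv mult.commute)

text \<open>The product has derivative zero and constant term 1. The same device gives the addition
  law below without binomial sums.\<close>

lemma fexp_mult_neg:
  assumes "f $ 0 = 0" shows "fexp f * fexp (- f) = 1"
proof -
  have "fps_deriv (fexp f * fexp (- f)) = 0"
    using assms by (simp add: fexp_deriv algebra_simps)
  then show ?thesis unfolding fps_deriv_eq_0_iff by (metis fexp_nth_0 fps_const_1_eq_1 fps_mult_nth_0 mult_1)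
qed

lemma fexp_add:
  assumes "f $ 0 = 0" "g $ 0 = 0" shows "fexp (f + g) = fexp f * fexp g"
proof -
  have "fps_deriv (fexp (f + g) * fexp (- f) * fexp (- g)) = 0"
    using assms by (simp add: fexp_deriv algebra_simps)
  then have "fexp (f + g) * fexp (- f) * fexp (- g) = 1"
    unfolding fps_deriv_eq_0_iff by (metis fexp_nth_0 fps_const_1_eq_1 fps_mult_nth_0 mult_1)
  moreover have "fexp (f + g) * fexp (- f) * fexp (- g) * (fexp f * fexp g)
     = fexp (f + g) * (fexp f * fexp (- f)) * (fexp g * fexp (- g))" by (simp only: ac_simps)
  ultimately show ?thesis unfolding fexp_mult_neg[OF assms(1)] fexp_mult_neg[OF assms(2)] by simp
qed

lemma fexp_sum:
  "(\<And>i. i \<in> A \<Longrightarrow> f i $ 0 = 0) \<Longrightarrow> fexp (\<Sum>i\<in>A. f i) = (\<Prod>i\<in>A. fexp (f i))"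
  by (induction A rule: infinite_finite_induct) (auto simp: fexp_add fps_sum_nth)

lemma fexp_power: "f $ 0 = 0 \<Longrightarrow> fexp f ^ n = fexp (of_nat n * f)"
  using fexp_sum[of "{..<n}" "\<lambda>_. f"] by simp

lemma fexp_compose:
  assumes "f $ 0 = 0" "g $ 0 = 0" shows "fexp f oo g = fexp (f oo g)"
  unfolding fexp_def by (rule fps_compose_assoc[symmetric, OF assms(2,1)])

lemma monom_power: "(fps_const a * fps_X ^ m :: 'a::comm_ring_1 fps) ^ i = fps_const (a ^ i) * fps_X ^ (m * i)"
  by (simp add: power_mult_distrib fps_const_power power_mult)

lemma compose_monom_nth:
  assumes "m > 0"
  shows "(f oo (fps_const a * fps_X ^ m)) $ n = (if m dvd n then f $ (n div m) * a ^ (n div m) else (0::'a::field_char_0))"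
proof -
  have "(f oo (fps_const a * fps_X ^ m)) $ n = (\<Sum>i=0..n. if n = m * i then f $ i * a ^ i else 0)"
    by (simp add: fps_compose_nth monom_power if_distrib cong: if_cong)
  also have "\<dots> = (if m dvd n then f $ (n div m) * a ^ (n div m) else 0)"
  proof (cases "m dvd n")
    case True
    then have "(\<Sum>i=0..n. if n = m * i then f $ i * a ^ i else 0) = (\<Sum>i=0..n. if i = n div m then f $ i * a ^ i else 0)"
      using assms by (intro sum.cong refl) auto
    then show ?thesis using True by simp
  next
    case False
    then show ?thesis by (auto intro!: sum.neutral)
  qed
  finally show ?thesis .
qed

lemma fexp_const_X_nth: "fexp (fps_const a * fps_X) $ n = a ^ n / (fact n :: 'a::field_char_0)"
  unfolding fexp_def using compose_monom_nth[of 1 "fps_exp 1" a n] by simp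

lemma fexp_const_Xm_nth:
  "m > 0 \<Longrightarrow> fexp (fps_const a * fps_X ^ m) $ n = (if m dvd n then a ^ (n div m) / (fact (n div m) :: 'a::field_char_0) else 0)"
  unfolding fexp_def by (simp add: compose_monom_nth)

context unram begin

text \<open>Among \<open>1..n\<close> the multiples of \<open>p\<close> contribute
  \<open>p^(n div p) (n div p)!\<close>; the other factors form the product in
  \<open>gamma_nat p (Suc n)\<close>, whose sign is undone. This is how gamma values enter the
  computation of Gauss sums.\<close>

lemma fact_split:
  "(fact n :: int) = int p ^ (n div p) * fact (n div p) * ((-1) ^ Suc n * gamma_nat p (Suc n))"
proof -
  have "(fact n :: int) = int p ^ (n div p) * fact (n div p) * (\<Prod>j\<in>{j. 0 < j \<and> j < Suc n \<and> \<not> p dvd j}. int j)"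
  proof (induction n)
    case 0
    have E: "{j. 0 < j \<and> j < Suc 0 \<and> \<not> p dvd j} = {}" by auto
    show ?case unfolding E by simp
  next
    case (Suc n)
    have fin: "finite {j. 0 < j \<and> j < Suc n \<and> \<not> p dvd j}" by simp
    show ?case
    proof (cases "p dvd Suc n")
      case True
      have 1: "{j. 0 < j \<and> j < Suc (Suc n) \<and> \<not> p dvd j} = {j. 0 < j \<and> j < Suc n \<and> \<not> p dvd j}"
        using True by (auto simp: less_Suc_eq)
      have 2: "Suc n div p = Suc (n div p)" using True by (simp add: div_Suc dvd_eq_mod_eq_0)
      have "int (Suc n) = int p * int (Suc n div p)" using True by (simp flip: of_nat_mult)
      then have "int (Suc n) = int p * int (Suc (n div p))" using 2 by simp
      then have "(fact (Suc n) :: int) = int p * int (Suc (n div p)) * fact n" by (simp add: fact_Suc)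
      then show ?thesis unfolding 1 2 using Suc.IH by (simp add: algebra_simps)
    next
      case False
      have 1: "{j. 0 < j \<and> j < Suc (Suc n) \<and> \<not> p dvd j} = insert (Suc n) {j. 0 < j \<and> j < Suc n \<and> \<not> p dvd j}"
        using False by (auto simp: less_Suc_eq)
      have 2: "Suc n div p = n div p" using False by (simp add: div_Suc dvd_eq_mod_eq_0)
      show ?thesis unfolding 1 2 using Suc.IH fin by (simp add: fact_Suc algebra_simps)
    qed
  qed
  then show ?thesis by (simp add: gamma_nat_def flip: power_mult_distrib mult.assoc)
qed

lemma gamma_nat_not_dvd: "\<not> int p dvd gamma_nat p n"
proof
  assume "int p dvd gamma_nat p n"
  then have "int p dvd (\<Prod>j\<in>{j. 0 < j \<and> j < n \<and> \<not> p dvd j}. int j)"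
    unfolding gamma_nat_def using dvd_mult_unit_iff'[of "(-1)^n" "int p"] by (simp add: is_unit_power_iff)
  then obtain j where "\<not> p dvd j" "int p dvd int j"
    using prime_p by (auto simp: prime_dvd_prod_iff)
  then show False by simp
qed

lemma unit_gamma_nat: "unit (of_int (gamma_nat p n))"
  by (rule unit_of_int[OF gamma_nat_not_dvd])

lemma v_fact_rec: "v (fact n) = int (n div p) + v (fact (n div p))"
proof -
  have "(fact n :: 'k) = of_int (fact n)" by simp
  also have "\<dots> = of_nat p ^ (n div p) * fact (n div p) * ((-1) ^ Suc n * of_int (gamma_nat p (Suc n)))"
    by (subst fact_split) simp
  finally have *: "(fact n :: 'k) = \<dots>" .
  have "v ((-1) ^ Suc n) = 0" by (simp add: v_power)
  then show ?thesis unfolding * using unit_gamma_nat[of "Suc n"] prime_p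
    by (subst v_mult v_power; auto simp: unit_def v_mult v_power v_p)+
qed

text \<open>Legendre: \<open>(p-1) v(n!)\<close> is \<open>n\<close> minus the base-\<open>p\<close>
  digit sum of \<open>n\<close>, and that sum is at least 1.\<close>

lemma v_fact_le: "n > 0 \<Longrightarrow> (int p - 1) * v (fact n) \<le> int n - 1"
proof (induction n rule: less_induct)
  case (less n)
  show ?case
  proof (cases "n div p = 0")
    case True
    then show ?thesis using less.prems v_fact_rec[of n] by simp
  next
    case False
    then have "n div p < n" using p_gt_2 less.prems by (intro div_less_dividend) auto
    then have IH: "(int p - 1) * v (fact (n div p)) \<le> int (n div p) - 1"
      using less.IH False by simp
    have le: "int (p * (n div p)) \<le> int n" unfolding of_nat_le_iff by simp
    have "(int p - 1) * v (fact n) = (int p - 1) * int (n div p) + (int p - 1) * v (fact (n div p))"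
      unfolding v_fact_rec[of n] by (simp add: algebra_simps)
    also have "\<dots> \<le> int (p * (n div p)) - 1" using IH by (simp add: algebra_simps)
    finally show ?thesis using le by linarith
  qed
qed

text \<open>The quantity bounded below is \<open>p - 1\<close> times the valuation of \<open>x \<pi>^n\<close>.\<close>

definition wid :: "nat \<Rightarrow> real \<Rightarrow> 'k set" where
  "wid n t = {x. x = 0 \<or> t \<le> (real p - 1) * of_int (v x) + real n}"

lemma wid_iff_pid: "x \<in> wid n t \<longleftrightarrow> x \<in> pid \<lceil>(t - real n) / (real p - 1)\<rceil>"
  using p_gt_2 by (auto simp: wid_def pid_def ceiling_le_iff field_simps)

lemma wid_0 [simp]: "0 \<in> wid n t" by (simp add: wid_def)

lemma wid_add: "x \<in> wid n t \<Longrightarrow> y \<in> wid n t \<Longrightarrow> x + y \<in> wid n t"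
  unfolding wid_iff_pid by (rule pid_add)

lemma wid_minus: "x \<in> wid n t \<Longrightarrow> - x \<in> wid n t"
  unfolding wid_iff_pid by (rule pid_minus)

lemma wid_sum: "(\<And>i. i \<in> A \<Longrightarrow> f i \<in> wid n t) \<Longrightarrow> (\<Sum>i\<in>A. f i) \<in> wid n t"
  unfolding wid_iff_pid by (rule pid_sum)

lemma wid_mult: "x \<in> wid n t \<Longrightarrow> y \<in> wid m s \<Longrightarrow> x * y \<in> wid (n + m) (t + s)"
  by (cases "x = 0"; cases "y = 0") (auto simp: wid_def v_mult algebra_simps)

lemma wid_mono: "x \<in> wid n t \<Longrightarrow> s \<le> t \<Longrightarrow> x \<in> wid n s" by (auto simp: wid_def)

lemma wid_0_1 [simp]: "1 \<in> wid 0 0" by (simp add: wid_def)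

lemma pid_wid: "x \<in> pid 0 \<Longrightarrow> x \<in> wid n (real n)"
  using p_gt_2 by (auto simp: wid_def pid_def)

lemma pid_wid': "x \<in> pid M \<Longrightarrow> x \<in> wid n ((real p - 1) * M + real n)"
  using p_gt_2 by (auto simp: wid_def pid_def mult_left_mono)

lemma inverse_fact_wid: "i > 0 \<Longrightarrow> inverse (fact i) \<in> wid 0 (- (real i - 1))"
proof -
  assume "i > 0"
  from v_fact_le[OF this] have "real_of_int ((int p - 1) * v (fact i)) \<le> real_of_int (int i - 1)" by linarith
  then show ?thesis by (simp add: wid_def v_inverse algebra_simps)
qed

text \<open>With \<open>u = \<pi> x\<close>, the coefficient of \<open>x^n\<close> has valuation at
  least \<open>c n / (p-1)\<close>; for \<open>c > 0\<close> such a series converges on a disc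
  strictly larger than the unit disc.\<close>

definition W :: "real \<Rightarrow> 'k fps set" where "W c = {f. \<forall>n. f $ n \<in> wid n (c * n)}"

lemma W_mult: "f \<in> W c \<Longrightarrow> g \<in> W c \<Longrightarrow> f * g \<in> W c"
proof -
  assume f: "f \<in> W c" and g: "g \<in> W c"
  show ?thesis unfolding W_def
  proof (safe, unfold fps_mult_nth, rule wid_sum)
    fix n i :: nat assume i: "i \<in> {0..n}"
    have "f $ i * g $ (n - i) \<in> wid (i + (n - i)) (c * i + c * (n - i))"
      using f g by (intro wid_mult) (auto simp: W_def)
    then show "f $ i * g $ (n - i) \<in> wid n (c * n)" using i by (simp flip: distrib_left of_nat_add)
  qed
qed

lemma W_1: "1 \<in> W c"
  unfolding W_def
proof (intro CollectI allI)
  fix n :: nat show "1 $ n \<in> wid n (c * n)" by (cases "n = 0") auto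
qed

lemma W_prod: "(\<And>i. i \<in> A \<Longrightarrow> f i \<in> W c) \<Longrightarrow> (\<Prod>i\<in>A. f i) \<in> W c"
  by (induction A rule: infinite_finite_induct) (auto intro: W_mult W_1)

lemma W_mono: "f \<in> W c \<Longrightarrow> b \<le> c \<Longrightarrow> f \<in> W b"
  unfolding W_def
proof (intro CollectI allI)
  fix n assume "f \<in> {f. \<forall>n. f $ n \<in> wid n (c * real n)}" "b \<le> c"
  then show "f $ n \<in> wid n (b * real n)" using wid_mono[of "f $ n" n "c * n" "b * n"] by (simp add: mult_right_mono)
qed

text \<open>The surplus 1 pays for the denominators: \<open>g^i\<close> collects a surplus
  \<open>i\<close>, while dividing by \<open>i!\<close> costs at most \<open>i - 1\<close>.\<close>

lemma fexp_W:
  fixes c :: real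
  assumes g0: "g $ 0 = 0" and g: "\<And>n. n > 0 \<Longrightarrow> g $ n \<in> wid n (c * n + 1)"
  shows "fexp g \<in> W c"
proof -
  have gp: "(g ^ i) $ n \<in> wid n (c * n + i)" for n i
  proof (induction i arbitrary: n)
    case 0 then show ?case by (cases "n = 0") auto
  next
    case (Suc i)
    show ?case unfolding power_Suc fps_mult_nth
    proof (rule wid_sum)
      fix j assume j: "j \<in> {0..n}"
      show "g $ j * (g ^ i) $ (n - j) \<in> wid n (c * n + Suc i)"
      proof (cases "j = 0")
        case False
        have "g $ j * (g ^ i) $ (n - j) \<in> wid (j + (n - j)) (c * j + 1 + (c * real (n - j) + i))"
          using False g Suc by (intro wid_mult) auto
        then show ?thesis using j by (simp add: algebra_simps of_nat_diff)
      qed (use g0 in auto)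
    qed
  qed
  show ?thesis unfolding W_def
  proof (intro CollectI allI, unfold fexp_nth, rule wid_sum)
    fix n i :: nat
    show "(g ^ i) $ n / fact i \<in> wid n (c * n)"
    proof (cases "i = 0")
      case False
      then have "(g ^ i) $ n * inverse (fact i) \<in> wid (n + 0) (c * n + i + - (real i - 1))"
        using gp by (intro wid_mult inverse_fact_wid) auto
      then show ?thesis by (auto simp: divide_inverse intro: wid_mono)
    next
      case True
      then show ?thesis by (cases "n = 0") auto
    qed
  qed
qed

text \<open>The condition on \<open>m\<close> and \<open>l\<close> says that
  \<open>a \<pi>^l\<close> has the valuation of \<open>\<pi>\<close>, so in \<open>x\<close> the
  substitution is \<open>x -> x^l\<close> up to a unit. Coefficients keep their size but move from
  exponent \<open>k\<close> to \<open>l k\<close>, which divides the rate by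
  \<open>l\<close>.\<close>

lemma W_compose:
  assumes f: "f \<in> W c" and i: "c \<ge> 0" "v a = - m" "a \<noteq> 0" "(int p - 1) * m = int l - 1" "l > 0"
  shows "f oo (fps_const a * fps_X ^ l) \<in> W (c / l)"
  unfolding W_def
proof safe
  fix n
  show "(f oo (fps_const a * fps_X ^ l)) $ n \<in> wid n (c / l * n)"
  proof (cases "l dvd n \<and> f $ (n div l) \<noteq> 0")
    case True
    then obtain k where n: "n = l * k" by blast
    have "f $ k \<in> wid k (c * k)" using f by (auto simp: W_def)
    then have "c * k \<le> (real p - 1) * v (f $ k) + k" using True n i by (auto simp: wid_def)
    moreover have "(real p - 1) * of_int m = real l - 1"
      using arg_cong[OF i(4), of real_of_int] by simp
    then have "real k * ((real p - 1) * of_int m) = k * (real l - 1)" by simp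
    ultimately show ?thesis using True n i
      by (simp add: compose_monom_nth wid_def v_mult v_power algebra_simps)
  qed (use i in \<open>auto simp: compose_monom_nth\<close>)
qed

end

section \<open>Dwork's integrality lemma and the Artin-Hasse exponential\<close>

lemma Rats_sum:
  "(\<And>i. i \<in> A \<Longrightarrow> f i \<in> \<rat>) \<Longrightarrow> (\<Sum>i\<in>A. f i :: 'a::field_char_0) \<in> \<rat>"
  by (induction A rule: infinite_finite_induct) auto

lemma fps_Rats_mult:
  fixes f g :: "'a::field_char_0 fps"
  assumes "\<And>n. f $ n \<in> \<rat>" "\<And>n. g $ n \<in> \<rat>"
  shows "(f * g) $ n \<in> \<rat>"
  unfolding fps_mult_nth using assms by (intro Rats_sum Rats_mult) auto

lemma fexp_Rats:
  fixes f :: "'a::field_char_0 fps"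
  assumes "\<And>n. f $ n \<in> \<rat>"
  shows "fexp f $ n \<in> \<rat>"
proof -
  have "(f ^ i) $ n \<in> \<rat>" for i n
  proof (induction i arbitrary: n)
    case 0 then show ?case by (cases "n = 0") auto
  next
    case (Suc i) then show ?case unfolding power_Suc using assms by (intro fps_Rats_mult) auto
  qed
  moreover have "(fact i :: 'a) \<in> \<rat>" for i by (metis Rats_of_nat of_nat_fact)
  ultimately show ?thesis unfolding fexp_nth by (intro Rats_sum Rats_divide) auto
qed

context unram begin

lemma of_rat_pid_0:
  assumes "of_rat x \<in> pid 0"
  obtains a b where "of_rat x = (of_int a / of_int b :: 'k)" "b > 0" "\<not> int p dvd b"
proof -
  obtain a b where ab: "quotient_of x = (a, b)" by (cases "quotient_of x")
  have b: "b > 0" "coprime a b" and xab: "x = of_int a / of_int b"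
    using quotient_of_denom_pos[OF ab] quotient_of_coprime[OF ab] quotient_of_div[OF ab] by auto
  have x: "of_rat x = (of_int a / of_int b :: 'k)" unfolding xab by (simp add: of_rat_divide)
  have "\<not> int p dvd b"
  proof
    assume pb: "int p dvd b"
    then have pa: "\<not> int p dvd a" using b prime_p by (meson coprime_common_divisor not_prime_unit prime_nat_int_transfer)
    have "of_int a = of_rat x * (of_int b :: 'k)" using x b by simp
    also have "\<dots> \<in> pid 1" using pb assms pid_of_int_dvd[of 1 b] by (intro pid_mult_int) auto
    finally show False using of_int_notin_pid_1[OF pa] by simp
  qed
  then show ?thesis using that x b(1) by blast
qed

text \<open>Fermat's little theorem for numerator and denominator, the latter being prime to
  \<open>p\<close>. For irrational elements the residue only satisfies \<open>x^q = x\<close>, so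
  this is where rational coefficients are exploited.\<close>

lemma Rats_frobenius:
  assumes "x \<in> \<rat>" "x \<in> pid 0"
  shows "x ^ p - x \<in> pid 1"
proof -
  obtain y where y: "x = of_rat y" using assms(1) by (auto simp: Rats_def)
  obtain a b where xab: "x = of_int a / of_int b" and b: "b > 0" and pb: "\<not> int p dvd b"
    using assms(2) unfolding y by (rule of_rat_pid_0)
  have fermat: "int p dvd c ^ p - c" for c :: int
  proof (cases "int p dvd c")
    case True
    then have "int p dvd c ^ p" using p_gt_2 dvd_power[of p c] by (meson dvd_trans zero_less_numeral less_trans)
    then show ?thesis using True by simp
  next
    case False
    define m where "m = nat (c mod int p)"
    have m: "int m = c mod int p" using p_gt_2 by (simp add: m_def)
    then have "\<not> p dvd m" using False by (metis dvd_mod_iff dvd_refl int_dvd_int_iff)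
    then have "[int (m ^ (p - 1)) = int 1] (mod int p)" unfolding cong_int_iff
      using prime_p by (intro fermat_theorem) auto
    moreover have "[c = int m] (mod int p)" by (simp add: m cong_def)
    then have "[c ^ (p - 1) = int m ^ (p - 1)] (mod int p)" by (rule cong_pow)
    ultimately have "[c ^ (p - 1) = 1] (mod int p)" using cong_trans by fastforce
    then have "[c ^ (p - 1) * c = 1 * c] (mod int p)" by (rule cong_scalar_right)
    moreover have "c ^ (p - 1) * c = c ^ p" using p_gt_2 by (simp flip: power_Suc2)
    ultimately show ?thesis by (simp add: cong_iff_dvd_diff)
  qed
  have "x ^ p - x = inverse (of_int b ^ Suc p) * of_int (a ^ p * b - a * b ^ p)"
    using b by (simp add: xab field_simps)
  also have "\<dots> \<in> pid 1"
  proof (intro pid_mult_int unit_pid unit_inverse)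
    have "a ^ p * b - a * b ^ p = (a ^ p - a) * b - a * (b ^ p - b)" by (simp add: algebra_simps)
    then have "int p ^ 1 dvd a ^ p * b - a * b ^ p" using fermat by simp
    from pid_of_int_dvd[OF this] show "of_int (a ^ p * b - a * b ^ p) \<in> pid 1" by simp
    have "unit (of_int b ^ n)" for n using unit_of_int[OF pb] by (induction n) (auto intro: unit_mult)
    then show "unit (of_int b ^ Suc p)" .
  qed
  finally show ?thesis .
qed

definition fpid :: "int \<Rightarrow> 'k fps set" where "fpid M = {f. \<forall>n. f $ n \<in> pid M}"

lemma fpid_add: "f \<in> fpid M \<Longrightarrow> g \<in> fpid M \<Longrightarrow> f + g \<in> fpid M"
  by (auto simp: fpid_def intro: pid_add)

lemma fpid_mult: "f \<in> fpid M \<Longrightarrow> g \<in> fpid N \<Longrightarrow> f * g \<in> fpid (M + N)"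
  by (auto simp: fpid_def fps_mult_nth intro: pid_sum pid_mult)

lemma fpid_power: "f \<in> fpid 0 \<Longrightarrow> f ^ n \<in> fpid 0"
proof (induction n)
  case 0
  have "(1 :: 'k fps) $ n \<in> pid 0" for n by (cases "n = 0") auto
  then show ?case by (auto simp: fpid_def)
next
  case (Suc n)
  then show ?case using fpid_mult[of f 0 "f ^ n" 0] by simp
qed

lemma fpid_sum: "(\<And>i. i \<in> A \<Longrightarrow> f i \<in> fpid M) \<Longrightarrow> sum f A \<in> fpid M"
  by (auto simp: fpid_def fps_sum_nth intro: pid_sum)

lemma fpid_frobenius_add:
  assumes "f \<in> fpid 0" "g \<in> fpid 0"
  shows "(f + g) ^ p - (f ^ p + g ^ p) \<in> fpid 1"
proof -
  have "(f + g) ^ p = (\<Sum>k\<le>p. of_nat (p choose k) * f ^ k * g ^ (p - k))"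
    by (rule binomial_ring)
  also have "{..p} = insert 0 (insert p {1..<p})" using p_gt_2 by auto
  also have "(\<Sum>k\<in>\<dots>. of_nat (p choose k) * f ^ k * g ^ (p - k)) =
     g ^ p + (f ^ p + (\<Sum>k=1..<p. of_nat (p choose k) * f ^ k * g ^ (p - k)))"
    using p_gt_2 by simp
  finally have "(f + g) ^ p - (f ^ p + g ^ p) = (\<Sum>k=1..<p. of_nat (p choose k) * (f ^ k * g ^ (p - k)))"
    by (simp add: mult.assoc)
  also have "\<dots> \<in> fpid 1"
  proof (rule fpid_sum)
    fix k assume k: "k \<in> {1..<p}"
    then have "p dvd p choose k" using prime_p by (intro dvd_choose_prime) auto
    then have "int p ^ 1 dvd int (p choose k)" by simp
    from pid_of_int_dvd[OF this] have "(of_nat (p choose k) :: 'k fps) \<in> fpid 1"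
      by (auto simp: fpid_def fps_of_nat[symmetric] simp del: fps_of_nat)
    from fpid_mult[OF this fpid_mult[OF fpid_power[OF assms(1), of k] fpid_power[OF assms(2), of "p - k"]]]
    show "of_nat (p choose k) * (f ^ k * g ^ (p - k)) \<in> fpid 1" by simp
  qed
  finally show ?thesis .
qed

lemma fpid_frobenius_sum:
  assumes "finite A" "\<And>i. i \<in> A \<Longrightarrow> f i \<in> fpid 0"
  shows "(\<Sum>i\<in>A. f i) ^ p - (\<Sum>i\<in>A. f i ^ p) \<in> fpid 1"
  using assms
proof (induction A rule: finite_induct)
  case empty then show ?case using p_gt_2 by (simp add: fpid_def power_0_left)
next
  case (insert i A)
  have "((f i + sum f A) ^ p - (f i ^ p + sum f A ^ p)) + (sum f A ^ p - (\<Sum>i\<in>A. f i ^ p)) \<in> fpid 1"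
    using insert by (intro fpid_add fpid_frobenius_add fpid_sum insert.IH) auto
  then show ?case using insert by (simp add: algebra_simps)
qed

text \<open>Induction on \<open>n\<close>. The coefficient of \<open>X^n\<close> in
  \<open>f^p\<close> is \<open>p f_n\<close> plus that in \<open>g^p\<close>, where \<open>g\<close>
  truncates \<open>f\<close> below \<open>n\<close>. Modulo \<open>p\<close> the latter agrees with
  the coefficient in \<open>f(X^p)\<close> by Frobenius, and so does the coefficient in
  \<open>f^p\<close> by the functional equation; hence \<open>p f_n\<close> is divisible by
  \<open>p\<close>.\<close>

lemma dwork_lemma:
  assumes f0: "f $ 0 = 1" and frat: "\<And>n. f $ n \<in> \<rat>"
    and eq: "f ^ p = (f oo fps_X ^ p) * h" and h0: "h $ 0 = 1" and h: "\<And>n. n > 0 \<Longrightarrow> h $ n \<in> pid 1"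
  shows "f $ n \<in> pid 0"
proof (induction n rule: less_induct)
  case (less n)
  show ?case
  proof (cases "n = 0")
    case True then show ?thesis using f0 by simp
  next
    case False
    define g where "g = (\<Sum>i<n. fps_const (f $ i) * fps_X ^ i)"
    have gnth: "g $ i = (if i < n then f $ i else 0)" for i
      by (simp add: g_def fps_sum_nth if_distrib cong: if_cong)
    have fnth: "(f oo fps_X ^ p) $ i = (if p dvd i then f $ (i div p) else 0)" for i
      using compose_monom_nth[of p f 1 i] p_gt_2 by simp
    define t where "t = Abs_fps (\<lambda>i. f $ (i + n))"
    have fgt: "f = g + fps_X ^ n * t"
      by (auto simp: fps_eq_iff gnth t_def fps_X_power_mult_nth)
    have "f ^ p = (\<Sum>k\<le>p. of_nat (p choose k) * (fps_X ^ n * t) ^ k * g ^ (p - k))"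
      unfolding fgt add.commute[of g] by (rule binomial_ring)
    also have "{..p} = insert 0 (insert 1 {2..p})" using p_gt_2 by auto
    also have "(\<Sum>k\<in>\<dots>. of_nat (p choose k) * (fps_X ^ n * t) ^ k * g ^ (p - k)) =
       g ^ p + (of_nat p * (fps_X ^ n * t) * g ^ (p - 1) + (\<Sum>k=2..p. of_nat (p choose k) * (fps_X ^ n * t) ^ k * g ^ (p - k)))"
      by simp
    finally have "(f ^ p) $ n = (g ^ p) $ n + ((of_nat p * (fps_X ^ n * t) * g ^ (p - 1)) $ n + (\<Sum>k=2..p. (of_nat (p choose k) * (fps_X ^ n * t) ^ k * g ^ (p - k)) $ n))"
      by (simp add: fps_sum_nth)
    also have "(of_nat p * (fps_X ^ n * t) * g ^ (p - 1)) = fps_X ^ n * (of_nat p * t * g ^ (p - 1))"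
      by (simp add: algebra_simps)
    also have "\<dots> $ n = of_nat p * f $ n"
      using f0 False by (simp add: fps_X_power_mult_nth fps_power_zeroth gnth t_def flip: fps_of_nat)
    also have "(\<Sum>k=2..p. (of_nat (p choose k) * (fps_X ^ n * t) ^ k * g ^ (p - k)) $ n) = 0"
    proof (intro sum.neutral ballI)
      fix k assume "k \<in> {2..p}"
      then have "n * 2 \<le> n * k" by (intro mult_le_mono) auto
      then have nk: "n < n * k" using False by linarith
      have "of_nat (p choose k) * (fps_X ^ n * t) ^ k * g ^ (p - k) = fps_X ^ (n * k) * (of_nat (p choose k) * t ^ k * g ^ (p - k))"
        by (simp add: power_mult_distrib power_mult[symmetric] algebra_simps)
      also have "\<dots> $ n = 0" using nk by (simp add: fps_X_power_mult_nth)
      finally show "(of_nat (p choose k) * (fps_X ^ n * t) ^ k * g ^ (p - k)) $ n = 0" .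
    qed
    finally have 1: "of_nat p * f $ n = (f ^ p) $ n - (g ^ p) $ n" by simp
    have "(f ^ p) $ n = (\<Sum>i=0..n. h $ i * (f oo fps_X ^ p) $ (n - i))"
      unfolding eq by (subst mult.commute) (simp add: fps_mult_nth)
    also have "\<dots> = (f oo fps_X ^ p) $ n + (\<Sum>i=1..n. h $ i * (f oo fps_X ^ p) $ (n - i))"
      by (subst sum.atLeast_Suc_atMost) (auto simp: h0)
    finally have 2: "(f ^ p) $ n - (f oo fps_X ^ p) $ n = (\<Sum>i=1..n. h $ i * (f oo fps_X ^ p) $ (n - i))" by simp
    \<comment> \<open>Even for \<open>i = n\<close> the index \<open>i div p\<close> is below
      \<open>n\<close>, so the induction hypothesis covers all coefficients of \<open>f(X^p)\<close>
      up to \<open>n\<close>.\<close>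
    have f_small: "f $ (i div p) \<in> pid 0" if "i \<le> n" for i
    proof -
      have "i div p \<le> n div p" using that by (rule div_le_mono)
      also have "\<dots> < n" using False p_gt_2 by (intro div_less_dividend) auto
      finally show ?thesis by (rule less.IH)
    qed
    have 3: "(\<Sum>i=1..n. h $ i * (f oo fps_X ^ p) $ (n - i)) \<in> pid 1"
    proof (rule pid_sum)
      fix i assume "i \<in> {1..n}"
      then have "(f oo fps_X ^ p) $ (n - i) * h $ i \<in> pid 1"
        using h f_small unfolding fnth by (intro pid_mult_int) auto
      then show "h $ i * (f oo fps_X ^ p) $ (n - i) \<in> pid 1" by (simp add: mult.commute)
    qed
    have "g ^ p - (\<Sum>i<n. (fps_const (f $ i) * fps_X ^ i) ^ p) \<in> fpid 1"
      unfolding g_def using less.IH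
      by (intro fpid_frobenius_sum) (auto simp: fpid_def)
    then have 4: "(g ^ p) $ n - (\<Sum>i<n. (fps_const (f $ i) * fps_X ^ i) ^ p) $ n \<in> pid 1"
      by (auto simp: fpid_def)
    have "(\<Sum>i<n. (fps_const (f $ i) * fps_X ^ i) ^ p) $ n = (\<Sum>i<n. if n = i * p then (f $ i) ^ p else 0)"
      by (simp add: fps_sum_nth monom_power if_distrib cong: if_cong)
    also have "\<dots> = (if p dvd n then (f $ (n div p)) ^ p else 0)"
    proof (cases "p dvd n")
      case True
      then obtain m where m: "n = m * p" by (metis dvd_div_mult_self)
      then have "m < n" using p_gt_2 False by simp
      have "(\<Sum>i<n. if n = i * p then (f $ i) ^ p else 0) = (\<Sum>i<n. if i = m then (f $ i) ^ p else 0)"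
        using m p_gt_2 by (intro sum.cong) auto
      then show ?thesis using m p_gt_2 \<open>m < n\<close> by simp
    qed (auto intro!: sum.neutral)
    finally have 5: "(\<Sum>i<n. (fps_const (f $ i) * fps_X ^ i) ^ p) $ n - (f oo fps_X ^ p) $ n \<in> pid 1"
      unfolding fnth using Rats_frobenius[OF frat f_small, of n] by simp
    have "of_nat p * f $ n \<in> pid 1"
      using pid_diff[OF 3[folded 2] pid_add[OF 4 5]] unfolding 1 by (simp add: algebra_simps)
    then show ?thesis using prime_p by (cases "f $ n = 0") (auto simp: pid_def v_mult v_p)
  qed
qed

definition artin_hasse_log :: "'k fps" where
  "artin_hasse_log = Abs_fps (\<lambda>n. if \<exists>k. n = p ^ k then 1 / of_nat n else 0)"

text \<open>Replacing \<open>X\<close> by \<open>X^p\<close> shifts the series by one term.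
  Exponentiated, this is the functional equation \<open>E^p = E(X^p) exp (p X)\<close> to which
  Dwork's lemma applies.\<close>

lemma artin_hasse_log_compose:
  "artin_hasse_log oo fps_X ^ p = of_nat p * artin_hasse_log - of_nat p * fps_X"
proof (rule fps_ext)
  fix n
  have *: "(artin_hasse_log oo fps_X ^ p) $ n = (if p dvd n then artin_hasse_log $ (n div p) else 0)"
    using compose_monom_nth[of p artin_hasse_log 1 n] p_gt_2 by simp
  have rhs: "(of_nat p * artin_hasse_log - of_nat p * fps_X) $ n = of_nat p * (artin_hasse_log $ n - (if n = 1 then 1 else 0))"
    by (simp add: algebra_simps flip: fps_of_nat)
  show "(artin_hasse_log oo fps_X ^ p) $ n = (of_nat p * artin_hasse_log - of_nat p * fps_X) $ n"
  proof (cases "p dvd n")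
    case True
    then obtain m where m: "n = p * m" by blast
    have "(\<exists>k. p * m = p ^ k) \<longleftrightarrow> (\<exists>k. m = p ^ k)"
    proof
      assume "\<exists>k. p * m = p ^ k"
      then obtain k where k: "p * m = p ^ k" by blast
      then obtain k' where "k = Suc k'" using p_gt_2 by (cases k) auto
      then show "\<exists>k. m = p ^ k" using k p_gt_2 by auto
    qed (metis power_Suc)
    moreover have "n \<noteq> 1" using m p_gt_2 by auto
    ultimately show ?thesis unfolding * rhs using m p_gt_2 by (auto simp: artin_hasse_log_def)
  next
    case False
    then have "(\<exists>k. n = p ^ k) \<longleftrightarrow> n = 1" by (metis dvd_power neq0_conv power_0)
    then show ?thesis unfolding * rhs using False by (simp add: artin_hasse_log_def)
  qed
qed

lemma artin_hasse_integral: "fexp artin_hasse_log $ n \<in> pid 0"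
proof (rule dwork_lemma)
  have L0: "artin_hasse_log $ 0 = 0" using p_gt_2 by (auto simp: artin_hasse_log_def)
  show "fexp artin_hasse_log $ 0 = 1" by simp
  show "fexp artin_hasse_log $ n \<in> \<rat>" for n
    by (rule fexp_Rats) (simp add: artin_hasse_log_def)
  show "fexp artin_hasse_log ^ p = (fexp artin_hasse_log oo fps_X ^ p) * fexp (fps_const (of_nat p) * fps_X)"
    using p_gt_2 L0
    by (simp add: fexp_power fexp_compose fexp_add[symmetric] artin_hasse_log_compose fps_of_nat)
  \<comment> \<open>The coefficient is \<open>p^n / n!\<close>, and
    \<open>v (n!) \<le> n - 1\<close>.\<close>
  show "fexp (fps_const (of_nat p) * fps_X :: 'k fps) $ n \<in> pid 1" if "n > 0" for n
  proof -
    have "(int p - 1) * v (fact n) \<le> int n - 1" using v_fact_le[OF that] .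
    moreover have "int n - 1 \<le> (int p - 1) * (int n - 1)" using that p_gt_2 by (intro mult_le_cancel_right1[THEN iffD2]) auto
    ultimately have "(int p - 1) * v (fact n) \<le> (int p - 1) * (int n - 1)" by linarith
    then have "v (fact n) \<le> int n - 1" using p_gt_2 by simp
    then show ?thesis using prime_p by (auto simp: fexp_const_X_nth pid_def v_divide v_power v_p)
  qed
qed simp

text \<open>The best rate permitted by \<open>u^(p^2) / p^2\<close>, the first term of the
  Artin-Hasse logarithm missing from \<open>u + u^p / p\<close>: its weight is
  \<open>p^2 - 2 (p-1)\<close>, and \<open>fexp_W\<close> asks for \<open>c p^2 + 1\<close>, so
  \<open>c p^2 = (p-1)^2\<close>.\<close>

definition dwork_rate :: real where "dwork_rate = (real p - 1) ^ 2 / real p ^ 2"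

text \<open>Equality holds at \<open>k = 2\<close> by the choice of \<open>dwork_rate\<close>. At
  each further step the right-hand side is multiplied by \<open>p \<ge> 3\<close>, the left-hand
  side by at most 3.\<close>

lemma artin_hasse_tail:
  "k \<ge> 2 \<Longrightarrow> real k * (real p - 1) + 1 \<le> real p ^ k - dwork_rate * real p ^ k"
proof -
  assume k: "k \<ge> 2"
  have "real k * (real p - 1) + 1 \<le> real p ^ (k - 2) * (2 * real p - 1)"
    using k
  proof (induction k rule: dec_induct)
    case (step k)
    have "real (Suc k) * (real p - 1) + 1 \<le> 3 * (real k * (real p - 1) + 1)"
    proof -
      have "real k * (real p - 1) \<ge> 1 * (real p - 1)" using step p_gt_2 by (intro mult_right_mono) auto
      then show ?thesis using step p_gt_2 by (simp add: algebra_simps)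
    qed
    also have "\<dots> \<le> p * (real k * (real p - 1) + 1)" using p_gt_2 by (intro mult_right_mono) auto
    also have "\<dots> \<le> p * (real p ^ (k - 2) * (2 * real p - 1))" using step.IH by (intro mult_left_mono) auto
    also have "\<dots> = real p ^ (Suc k - 2) * (2 * real p - 1)"
      using Suc_diff_le[OF step(1)] by simp
    finally show ?case .
  qed simp
  also have "\<dots> = real p ^ k - dwork_rate * real p ^ k"
  proof -
    have "real p ^ k = real p ^ (k - 2) * real p ^ 2" using k le_Suc_ex[OF k] by (auto simp: power_add power2_eq_square)
    then show ?thesis using p_gt_2 by (simp add: dwork_rate_def field_simps power2_eq_square)
  qed
  finally show ?thesis .
qed

text \<open>At \<open>u = \<pi> x\<close> this is Dwork's series
  \<open>exp (\<pi> (x - x^p))\<close>, because \<open>\<pi>^p / p = -\<pi>\<close>. It is the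
  integral Artin-Hasse series times the exponential of the negated tail \<open>R\<close>, whose
  weights carry the surplus 1.\<close>

lemma dwork_W: "fexp (fps_X + fps_const (1 / of_nat p) * fps_X ^ p) \<in> W dwork_rate"
proof -
  define R where "R = artin_hasse_log - (fps_X + fps_const (1 / of_nat p) * fps_X ^ p)"
  have L0: "artin_hasse_log $ 0 = 0" using p_gt_2 by (auto simp: artin_hasse_log_def)
  have R: "R $ n = (if \<exists>k\<ge>2. n = p ^ k then 1 / of_nat n else 0)" for n
  proof (cases "\<exists>k. n = p ^ k")
    case True
    then obtain k where k: "n = p ^ k" by blast
    have inj: "p ^ k = p ^ j \<longleftrightarrow> k = j" for j using p_gt_2 by (simp add: power_inject_exp)
    have "n = p \<longleftrightarrow> k = 1" "n = 1 \<longleftrightarrow> k = 0" using inj[of 1] inj[of 0] k by auto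
    then show ?thesis using True k inj p_gt_2 unfolding R_def artin_hasse_log_def
      by (cases "k = 0"; cases "k = 1") (auto simp: fps_eq_iff)
  next
    case False
    then have "n \<noteq> 1" "n \<noteq> p" by (metis power_0, metis power_one_right)
    then show ?thesis using False by (auto simp: R_def artin_hasse_log_def)
  qed
  have "fps_X + fps_const (1 / of_nat p) * fps_X ^ p = artin_hasse_log + (- R)" by (simp add: R_def)
  moreover have "fexp (artin_hasse_log + (- R)) = fexp artin_hasse_log * fexp (- R)"
    using L0 R[of 0] p_gt_2 by (intro fexp_add) auto
  moreover have "fexp artin_hasse_log \<in> W dwork_rate"
  proof -
    have "fexp artin_hasse_log $ n \<in> wid n (dwork_rate * n)" for n
    proof (rule wid_mono[OF pid_wid[OF artin_hasse_integral]])
      have "dwork_rate \<le> 1" using p_gt_2 by (simp add: dwork_rate_def divide_le_eq power_mono)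
      then show "dwork_rate * n \<le> n" using mult_right_mono[of dwork_rate 1 "real n"] by simp
    qed
    then show ?thesis by (auto simp: W_def)
  qed
  moreover have "fexp (- R) \<in> W dwork_rate"
  proof (rule fexp_W)
    show "(- R) $ 0 = 0" using R[of 0] p_gt_2 by auto
    fix n :: nat assume "n > 0"
    show "(- R) $ n \<in> wid n (dwork_rate * n + 1)"
    proof (cases "\<exists>k\<ge>2. n = p ^ k")
      case True
      then obtain k where k: "k \<ge> 2" "n = p ^ k" by blast
      have "1 / of_nat n = inverse (of_nat p ^ k :: 'k)" by (simp add: k field_simps)
      then have "v (1 / of_nat n) = - int k" using p_gt_2 by (simp add: v_inverse v_power v_p)
      then have "1 / of_nat n \<in> wid n (dwork_rate * n + 1)"
        using artin_hasse_tail[OF k(1)] k by (simp add: wid_def algebra_simps)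
      then show ?thesis using True R[of n] by (auto intro: wid_minus)
    next
      case False
      then have "R $ n = 0" unfolding R[of n] by (rule if_not_P)
      then show ?thesis by simp
    qed
  qed
  ultimately show ?thesis using W_mult by simp
qed

section \<open>Evaluation at the uniformizer\<close>

text \<open>The number \<open>(p^i - 1) / (p - 1)\<close>, so that
  \<open>\<pi>^(p^i - 1) = (-p)^(repunit i)\<close>.\<close>

definition repunit :: "nat \<Rightarrow> nat" where "repunit i = (\<Sum>j<i. p ^ j)"

lemma repunit_0 [simp]: "repunit 0 = 0" by (simp add: repunit_def)

lemma repunit_Suc: "repunit (Suc i) = p * repunit i + 1"
  unfolding repunit_def by (subst sum.lessThan_Suc_shift) (simp add: sum_distrib_left)

lemma repunit_eq_int: "(int p - 1) * int (repunit i) = int (p ^ i) - 1"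
  by (induction i) (auto simp: repunit_Suc algebra_simps)

lemma repunit_eq_real: "(real p - 1) * real (repunit i) = real (p ^ i) - 1"
  using arg_cong[OF repunit_eq_int[of i], of real_of_int] by simp

definition w :: 'k where "w = (- of_nat p) ^ repunit r"

lemma w_nz [simp]: "w \<noteq> 0" using p_gt_2 by (simp add: w_def)

lemma v_w: "v w = int (repunit r)" using p_gt_2 by (simp add: w_def v_power v_p)

definition dwork_exp :: "'k fps" where "dwork_exp = fexp (fps_X - fps_const (1 / w) * fps_X ^ q)"

definition rate :: real where "rate = dwork_rate / real p ^ (r - 1)"

text \<open>Telescoping: \<open>x - x^q\<close> is the sum of \<open>x^(p^i) - x^(p^(i+1))\<close>
  over \<open>i < r\<close>, so the series is a product of \<open>r\<close> copies of Dwork's series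
  for \<open>p\<close>, the \<open>i\<close>-th one in the variable \<open>x^(p^i)\<close>. The last
  factor has the smallest rate, and that is \<open>rate\<close>.\<close>

lemma dwork_exp_W: "dwork_exp \<in> W rate"
proof -
  \<comment> \<open>\<open>c i\<close> stands for \<open>\<pi>^(p^i - 1)\<close> and
    \<open>u i\<close> for \<open>\<pi> x^(p^i)\<close>.\<close>
  define c :: "nat \<Rightarrow> 'k" where "c i = (- of_nat p) ^ repunit i" for i
  define u :: "nat \<Rightarrow> 'k fps" where "u i = fps_const (1 / c i) * fps_X ^ (p ^ i)" for i
  have c_nz: "c i \<noteq> 0" for i using p_gt_2 by (simp add: c_def)
  have c_Suc: "c (Suc i) = - (of_nat p * c i ^ p)" for i
    by (simp add: c_def repunit_Suc mult.commute flip: power_mult)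
  have u0: "u i $ 0 = 0" for i using p_gt_2 by (simp add: u_def)
  have u_Suc: "u (Suc i) = - (fps_const (1 / of_nat p) * u i ^ p)" for i
    unfolding u_def monom_power using c_nz by (simp add: c_Suc fps_eq_iff power_divide mult.commute)
  have "(\<Sum>i<n. u i - u (Suc i)) = u 0 - u n" for n
    by (induction n) auto
  then have "dwork_exp = fexp (\<Sum>i<r. u i - u (Suc i))"
    by (simp add: dwork_exp_def u_def c_def w_def)
  also have "\<dots> = (\<Prod>i<r. fexp (u i - u (Suc i)))"
    by (rule fexp_sum) (simp add: u0)
  also have "\<dots> \<in> W rate"
  proof (rule W_prod)
    fix i assume i: "i \<in> {..<r}"
    have "fexp (u i - u (Suc i)) = fexp (fps_X + fps_const (1 / of_nat p) * fps_X ^ p) oo u i"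
      using u0[of i] p_gt_2 by (simp add: fexp_compose fps_compose_add_distrib fps_compose_mult_distrib fps_compose_power[symmetric] u_Suc)
    also have "\<dots> \<in> W (dwork_rate / real (p ^ i))"
      unfolding u_def
    proof (rule W_compose[OF dwork_W])
      show "v (1 / c i) = - int (repunit i)" using c_nz p_gt_2
        by (simp add: v_divide c_def v_power v_p)
      show "(int p - 1) * int (repunit i) = int (p ^ i) - 1" by (rule repunit_eq_int)
    qed (use c_nz p_gt_2 in \<open>auto simp: dwork_rate_def\<close>)
    finally show "fexp (u i - u (Suc i)) \<in> W rate"
    proof (rule W_mono)
      have "p ^ i \<le> p ^ (r - 1)" using i p_gt_2 by (intro power_increasing) auto
      then have "real (p ^ i) \<le> real p ^ (r - 1)" by (simp flip: of_nat_power)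
      then show "rate \<le> dwork_rate / real (p ^ i)" unfolding rate_def
        using p_gt_2 by (intro divide_left_mono) (auto simp: dwork_rate_def)
    qed
  qed
  finally show ?thesis .
qed

lemma rate_pos: "rate > 0" using p_gt_2 by (simp add: rate_def dwork_rate_def)

text \<open>The Tate algebra of the closed unit disc in \<open>x\<close>: the coefficients of the
  powers of \<open>x\<close> tend to zero.\<close>

definition null :: "'k fps \<Rightarrow> bool" where
  "null f \<longleftrightarrow> (\<forall>t. \<forall>\<^sub>F n in sequentially. f $ n \<in> wid n t)"

lemma W_null: "f \<in> W c \<Longrightarrow> c > 0 \<Longrightarrow> null f"
  unfolding null_def
proof
  fix t assume f: "f \<in> W c" and c: "c > 0"
  have "\<forall>\<^sub>F n in sequentially. n \<ge> nat \<lceil>t / c\<rceil>" by (rule eventually_ge_at_top)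
  then show "\<forall>\<^sub>F n in sequentially. f $ n \<in> wid n t"
  proof eventually_elim
    case (elim n)
    then have "t \<le> c * n" using c by (simp add: field_simps nat_le_iff ceiling_le_iff)
    then show ?case using f by (auto simp: W_def intro: wid_mono)
  qed
qed

lemma null_bdd: assumes "null f" shows "\<exists>B. \<forall>n. f $ n \<in> wid n B"
proof -
  obtain N where N: "\<And>n. n \<ge> N \<Longrightarrow> f $ n \<in> wid n 0"
    using assms by (auto simp: null_def eventually_sequentially)
  define B where "B = Min (insert 0 ((\<lambda>n. (real p - 1) * of_int (v (f $ n)) + real n) ` {..<N}))"
  have "f $ n \<in> wid n B" for n
  proof (cases "n < N")
    case True
    then have "B \<le> (real p - 1) * of_int (v (f $ n)) + real n" unfolding B_def by (intro Min_le) auto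
    then show ?thesis by (simp add: wid_def)
  next
    case False
    have "B \<le> 0" unfolding B_def by (intro Min_le) auto
    then show ?thesis using N[of n] False wid_mono by auto
  qed
  then show ?thesis by blast
qed

lemma null_add: "null f \<Longrightarrow> null g \<Longrightarrow> null (f + g)"
  unfolding null_def
proof
  fix t assume "\<forall>t. \<forall>\<^sub>F n in sequentially. f $ n \<in> wid n t" "\<forall>t. \<forall>\<^sub>F n in sequentially. g $ n \<in> wid n t"
  from this[rule_format, of t] show "\<forall>\<^sub>F n in sequentially. (f + g) $ n \<in> wid n t"
    by eventually_elim (simp add: wid_add)
qed

lemma null_finite: "(\<And>n. n \<ge> N \<Longrightarrow> f $ n = 0) \<Longrightarrow> null f"
  unfolding null_def eventually_sequentially by (metis wid_0)

lemma null_mult: assumes f: "null f" and g: "null g" shows "null (f * g)"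
  unfolding null_def
proof
  fix t
  obtain Bf Bg where B: "\<And>n. f $ n \<in> wid n Bf" "\<And>n. g $ n \<in> wid n Bg"
    using null_bdd[OF f] null_bdd[OF g] by blast
  obtain N1 where N1: "\<And>n. n \<ge> N1 \<Longrightarrow> f $ n \<in> wid n (t - Bg)"
    using f by (auto simp: null_def eventually_sequentially)
  obtain N2 where N2: "\<And>n. n \<ge> N2 \<Longrightarrow> g $ n \<in> wid n (t - Bf)"
    using g by (auto simp: null_def eventually_sequentially)
  have "(f * g) $ n \<in> wid n t" if n: "n \<ge> N1 + N2" for n
    unfolding fps_mult_nth
  proof (rule wid_sum)
    fix i assume i: "i \<in> {0..n}"
    have "f $ i * g $ (n - i) \<in> wid (i + (n - i)) t"
    proof (cases "i \<ge> N1")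
      case True
      from wid_mult[OF N1[OF this] B(2)[of "n - i"]] show ?thesis by simp
    next
      case False
      then have "n - i \<ge> N2" using n by linarith
      from wid_mult[OF B(1)[of i] N2[OF this]] show ?thesis by simp
    qed
    then show "f $ i * g $ (n - i) \<in> wid n t" using i by simp
  qed
  then show "\<forall>\<^sub>F n in sequentially. (f * g) $ n \<in> wid n t" by (auto simp: eventually_sequentially)
qed

lemma null_const [simp]: "null (fps_const c)" by (rule null_finite[of 1]) auto

lemma null_1 [simp]: "null 1" by (rule null_finite[of 1]) auto

lemma null_X_power [simp]: "null (fps_X ^ k)" by (rule null_finite[of "Suc k"]) auto

lemma null_prod: "(\<And>i. i \<in> A \<Longrightarrow> null (f i)) \<Longrightarrow> null (\<Prod>i\<in>A. f i)"
  by (induction A rule: infinite_finite_induct) (auto intro: null_mult)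

lemma null_sum: "(\<And>i. i \<in> A \<Longrightarrow> null (f i)) \<Longrightarrow> null (\<Sum>i\<in>A. f i)"
  by (induction A rule: infinite_finite_induct) (auto intro: null_add null_finite[of 0])

lemma null_power: "null f \<Longrightarrow> null (f ^ n)"
  by (induction n) (auto intro: null_mult)

lemma null_cmult: "null f \<Longrightarrow> null (fps_const c * f)"
  by (intro null_mult) auto

lemma null_minus: "null f \<Longrightarrow> null (- f)"
  using null_cmult[of f "-1"] by (simp flip: fps_const_neg)

lemma null_diff: "null f \<Longrightarrow> null g \<Longrightarrow> null (f - g)"
  using null_add[of f "- g"] null_minus by simp

text \<open>Up to the factor \<open>\<pi>^\<rho>\<close>, \<open>Lam \<rho> f\<close> is the value at \<open>u = \<pi>\<close> of the part of \<open>f\<close> with exponents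
congruent to \<open>\<rho>\<close> modulo \<open>q - 1\<close>.\<close>

definition lam :: "nat \<Rightarrow> nat \<Rightarrow> 'k" where
  "lam \<rho> n = (if n mod (q - 1) = \<rho> then w ^ (n div (q - 1)) else 0)"

text \<open>Evaluation at \<open>\<pi>\<close> itself would cost nothing; omitting the factor
  \<open>\<pi>^(n mod (q-1))\<close> lowers the weight by less than \<open>q\<close>, which is the
  \<open>q\<close> in the hypothesis.\<close>

lemma lam_pid:
  assumes "x \<in> wid n t" "(real p - 1) * real_of_int M + q \<le> t"
  shows "x * lam \<rho> n \<in> pid M"
proof (cases "x = 0 \<or> n mod (q - 1) \<noteq> \<rho>")
  case False
  define k where "k = n div (q - 1)"
  have "n mod (q - 1) < q" using q_ge_3 mod_less_divisor[of "q - 1" n] by linarith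
  moreover have "n = k * (q - 1) + n mod (q - 1)" unfolding k_def by (rule div_mult_mod_eq[symmetric])
  ultimately have "n \<le> k * (q - 1) + q" by linarith
  then have "real n \<le> real (k * (q - 1) + q)" unfolding of_nat_le_iff .
  then have "real n \<le> real k * (real q - 1) + real q"
    using q_ge_3 by (simp add: of_nat_diff del: of_nat_power)
  moreover have e: "(real p - 1) * real (repunit r) = real q - 1"
    by (rule repunit_eq_real)
  have "t \<le> (real p - 1) * v x + n" using assms False by (simp add: wid_def)
  ultimately have "(real p - 1) * real_of_int M \<le> (real p - 1) * v x + real k * ((real p - 1) * real (repunit r))"
    unfolding e using assms(2) by linarith
  then have "(real p - 1) * real_of_int M \<le> (real p - 1) * (v x + int k * int (repunit r))"
    by (simp add: algebra_simps)
  then have "real_of_int M \<le> real_of_int (v x + int k * int (repunit r))"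
    by (rule mult_left_le_imp_le) (use p_gt_2 in simp)
  then have "M \<le> v x + int k * int (repunit r)" unfolding of_int_le_iff .
  then show ?thesis using False by (simp add: lam_def pid_def v_mult v_power v_w k_def)
qed (auto simp: lam_def)

lemma lam_add: "lam \<rho> (n + (q - 1)) = w * lam \<rho> n"
proof -
  have "(n + (q - 1)) div (q - 1) = n div (q - 1) + 1" using q_ge_3 by (intro div_add_self2) linarith
  moreover have "(n + (q - 1)) mod (q - 1) = n mod (q - 1)" by (rule mod_add_self2)
  ultimately show ?thesis unfolding lam_def by (simp only: power_add) simp
qed

definition Lam :: "nat \<Rightarrow> 'k fps \<Rightarrow> 'k" where
  "Lam \<rho> f = (THE s. plim (\<lambda>N. \<Sum>n<N. f $ n * lam \<rho> n) s)"

lemma Lam_eqI: "plim (\<lambda>N. \<Sum>n<N. f $ n * lam \<rho> n) s \<Longrightarrow> Lam \<rho> f = s"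
  unfolding Lam_def using plim_unique by blast

lemma Lam_lim: assumes "null f" shows "plim (\<lambda>N. \<Sum>n<N. f $ n * lam \<rho> n) (Lam \<rho> f)"
proof -
  have "\<exists>L. plim (\<lambda>N. \<Sum>n<N. f $ n * lam \<rho> n) L"
  proof (rule plim_Cauchy)
    fix M
    have "\<forall>\<^sub>F n in sequentially. f $ n \<in> wid n ((real p - 1) * real_of_int M + q)"
      using assms by (auto simp: null_def)
    then show "\<forall>\<^sub>F N in sequentially. (\<Sum>n<Suc N. f $ n * lam \<rho> n) - (\<Sum>n<N. f $ n * lam \<rho> n) \<in> pid M"
      by eventually_elim (auto intro: lam_pid)
  qed
  then show ?thesis using Lam_eqI by blast
qed

lemma Lam_add: "null f \<Longrightarrow> null g \<Longrightarrow> Lam \<rho> (f + g) = Lam \<rho> f + Lam \<rho> g"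
  using plim_add[OF Lam_lim[of f \<rho>] Lam_lim[of g \<rho>]]
  by (intro Lam_eqI) (simp add: algebra_simps sum.distrib)

lemma Lam_cmult: "null f \<Longrightarrow> Lam \<rho> (fps_const c * f) = c * Lam \<rho> f"
  using plim_cmult[OF Lam_lim[of f \<rho>], of c]
  by (intro Lam_eqI) (simp add: algebra_simps sum_distrib_left)

lemma Lam_sum: "(\<And>i. i \<in> A \<Longrightarrow> null (f i)) \<Longrightarrow> Lam \<rho> (\<Sum>i\<in>A. f i) = (\<Sum>i\<in>A. Lam \<rho> (f i))"
proof (induction A rule: infinite_finite_induct)
  case (insert x A)
  then show ?case by (simp add: Lam_add null_sum)
qed (auto intro!: Lam_eqI)

lemma Lam_pid:
  assumes "null f" "\<And>n. f $ n \<in> wid n t" "(real p - 1) * real_of_int M + q \<le> t"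
  shows "Lam \<rho> f \<in> pid M"
  using Lam_lim[OF assms(1)]
  by (rule plim_pid) (auto intro!: always_eventually pid_sum lam_pid assms(2,3))

lemma Lam_X_mult:
  assumes "null f"
  shows "plim (\<lambda>N. \<Sum>m<N. f $ m * lam \<rho> (m + k)) (Lam \<rho> (fps_X ^ k * f))"
proof -
  have "plim (\<lambda>N. \<Sum>n<N + k. (fps_X ^ k * f) $ n * lam \<rho> n) (Lam \<rho> (fps_X ^ k * f))"
    by (rule plim_subseq[OF Lam_lim[OF null_mult[OF null_X_power assms]]]) (rule filterlim_add_const_nat_at_top)
  moreover have "(\<Sum>n<N + k. (fps_X ^ k * f) $ n * lam \<rho> n) = (\<Sum>m<N. f $ m * lam \<rho> (m + k))" for N
  proof -
    have "(\<Sum>n<N + k. (fps_X ^ k * f) $ n * lam \<rho> n) = (\<Sum>n\<in>{0+k..<N + k}. (fps_X ^ k * f) $ n * lam \<rho> n)"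
      by (rule sum.mono_neutral_right) (auto simp: fps_X_power_mult_nth)
    also have "\<dots> = (\<Sum>m\<in>{0..<N}. (fps_X ^ k * f) $ (m + k) * lam \<rho> (m + k))"
      by (rule sum.shift_bounds_nat_ivl)
    finally show ?thesis by (simp add: fps_X_power_mult_nth lessThan_atLeast0)
  qed
  ultimately show ?thesis by simp
qed

lemma Lam_shift:
  assumes "null f"
  shows "Lam \<rho> (fps_X ^ (k + (q - 1)) * f) = w * Lam \<rho> (fps_X ^ k * f)"
proof -
  have "f $ m * lam \<rho> (m + (k + (q - 1))) = w * (f $ m * lam \<rho> (m + k))" for m
    unfolding add.assoc[symmetric] lam_add by (rule mult.left_commute)
  then have "(\<lambda>N. \<Sum>m<N. f $ m * lam \<rho> (m + (k + (q - 1)))) = (\<lambda>N. w * (\<Sum>m<N. f $ m * lam \<rho> (m + k)))"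
    unfolding sum_distrib_left by presburger
  then show ?thesis
    using Lam_X_mult[OF assms, of \<rho> "k + (q - 1)"] plim_cmult[OF Lam_X_mult[OF assms, of \<rho> k], of w] plim_unique by metis
qed

lemma Lam_shift_mult:
  assumes "null f"
  shows "Lam \<rho> (fps_X ^ (k + i * (q - 1)) * f) = w ^ i * Lam \<rho> (fps_X ^ k * f)"
proof (induction i)
  case (Suc i)
  have "k + Suc i * (q - 1) = k + i * (q - 1) + (q - 1)" by simp
  then show ?case unfolding Lam_shift[OF assms, of \<rho> "k + i * (q - 1)", folded \<open>k + Suc i * (q - 1) = _\<close>] Suc by simp
qed simp

text \<open>Polynomials are dense and \<open>\<Theta>\<close> is continuous, \<open>K\<close> being
  the constant loss in its bound. Identities between evaluations need then be checked on monomials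
  only.\<close>

lemma null_functional_ext:
  assumes add: "\<And>f g. null f \<Longrightarrow> null g \<Longrightarrow> \<Theta> (f + g) = \<Theta> f + \<Theta> g"
    and cmult: "\<And>f c. null f \<Longrightarrow> \<Theta> (fps_const c * f) = c * \<Theta> f"
    and bdd: "\<And>M f. null f \<Longrightarrow> (\<And>n. f $ n \<in> wid n ((real p - 1) * real_of_int M + K)) \<Longrightarrow> \<Theta> f \<in> pid M"
    and mono: "\<And>j. \<Theta> (fps_X ^ j) = (0::'k)"
    and f: "null f"
  shows "\<Theta> f = 0"
proof (rule pid_all_eq_0)
  fix M
  obtain N where N: "\<And>n. n \<ge> N \<Longrightarrow> f $ n \<in> wid n ((real p - 1) * real_of_int M + K)"
    using f by (auto simp: null_def eventually_sequentially)
  define g where "g = (\<Sum>n<N. fps_const (f $ n) * fps_X ^ n)"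
  have gnth: "g $ n = (if n < N then f $ n else 0)" for n
    by (simp add: g_def fps_sum_nth if_distrib cong: if_cong)
  have g: "null g" unfolding g_def by (intro null_sum null_cmult) simp
  have z: "\<Theta> 0 = 0" using cmult[OF f, of 0] by simp
  have "\<Theta> g = 0" unfolding g_def
  proof (induction N)
    case (Suc N)
    then show ?case using cmult[of "fps_X ^ N" "f $ N"] mono by (simp add: add null_sum null_cmult)
  qed (simp add: z)
  have fg: "null (f - g)" using f g by (rule null_diff)
  have "\<Theta> f = \<Theta> g + \<Theta> (f - g)" using add[OF g fg] by simp
  also have "\<dots> = \<Theta> (f - g)" using \<open>\<Theta> g = 0\<close> by simp
  also have "\<dots> \<in> pid M" by (rule bdd[OF fg]) (use N in \<open>auto simp: gnth\<close>)
  finally show "\<Theta> f \<in> pid M" .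
qed

text \<open>In \<open>x\<close> the substitution is \<open>x -> x^q\<close>: the weight of a
  coefficient is unchanged while its exponent is multiplied by \<open>q\<close>.\<close>

lemma null_compose:
  assumes "null f" shows "null (f oo (fps_const (1 / w) * fps_X ^ q))"
    and "(\<And>n. f $ n \<in> wid n t) \<Longrightarrow> (f oo (fps_const (1 / w) * fps_X ^ q)) $ n \<in> wid n t"
proof -
  have q0: "q > 0" using q_ge_3 by linarith
  have *: "(f oo (fps_const (1 / w) * fps_X ^ q)) $ (q * n) \<in> wid (q * n) t" if "f $ n \<in> wid n t" for n t
  proof (cases "f $ n = 0")
    case False
    have "v (1 / w) = - int (repunit r)" by (simp add: v_divide v_w)
    moreover have "(real p - 1) * real (repunit r) = real q - 1" by (rule repunit_eq_real)
    then have "real n * ((real p - 1) * real (repunit r)) = n * (real q - 1)" by simp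
    moreover have "(f oo (fps_const (1 / w) * fps_X ^ q)) $ (q * n) = f $ n * (1 / w) ^ n"
      unfolding compose_monom_nth[OF q0] using q0 by simp
    ultimately show ?thesis using that False
      by (simp add: wid_def v_mult v_power algebra_simps)
  next
    case True
    then show ?thesis unfolding compose_monom_nth[OF q0] using q0 by simp
  qed
  have **: "(f oo (fps_const (1 / w) * fps_X ^ q)) $ n = 0" if "\<not> q dvd n" for n
    using q0 that by (simp add: compose_monom_nth)
  show "(f oo (fps_const (1 / w) * fps_X ^ q)) $ n \<in> wid n t" if "\<And>n. f $ n \<in> wid n t"
  proof (cases "q dvd n")
    case True
    then show ?thesis using *[OF that] by (auto elim!: dvdE)
  qed (simp add: **)
  show "null (f oo (fps_const (1 / w) * fps_X ^ q))" unfolding null_def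
  proof
    fix t
    obtain N where N: "\<And>n. n \<ge> N \<Longrightarrow> f $ n \<in> wid n t" using assms by (auto simp: null_def eventually_sequentially)
    have "(f oo (fps_const (1 / w) * fps_X ^ q)) $ n \<in> wid n t" if "n \<ge> q * N" for n
    proof (cases "q dvd n")
      case True
      then obtain m where m: "n = q * m" by blast
      then have "m \<ge> N" using that mult_le_cancel1[of q N m] q0 by blast
      then show ?thesis using * N m by blast
    qed (simp add: **)
    then show "\<forall>\<^sub>F n in sequentially. (f oo (fps_const (1 / w) * fps_X ^ q)) $ n \<in> wid n t"
      by (auto simp: eventually_sequentially)
  qed
qed

lemma Lam_bdd_mult:
  assumes "\<And>n. g $ n \<in> wid n B" "\<And>n. f $ n \<in> wid n ((real p - 1) * real_of_int M + (real q - B))" "null f" "null g"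
  shows "Lam \<rho> (g * f) \<in> pid M"
proof (rule Lam_pid[OF null_mult[OF assms(4,3)]])
  fix n
  show "(g * f) $ n \<in> wid n ((real p - 1) * real_of_int M + q)" unfolding fps_mult_nth
  proof (rule wid_sum)
    fix i assume "i \<in> {0..n}"
    then show "g $ i * f $ (n - i) \<in> wid n ((real p - 1) * real_of_int M + q)"
      using wid_mult[OF assms(1)[of i] assms(2)[of "n - i"]] by (simp add: algebra_simps)
  qed
qed simp

text \<open>Under evaluation \<open>u^q / w\<close> may be replaced by \<open>u\<close>.\<close>

lemma Lam_compose:
  assumes g: "null g" and f: "null f"
  shows "Lam \<rho> (g * (f oo (fps_const (1 / w) * fps_X ^ q))) = Lam \<rho> (g * f)"
proof -
  define T where "T f = f oo (fps_const (1 / w) * fps_X ^ q)" for f :: "'k fps"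
  define \<Theta> where "\<Theta> f = Lam \<rho> (g * T f) - Lam \<rho> (g * f)" for f
  obtain B where B: "\<And>n. g $ n \<in> wid n B" using null_bdd[OF g] by blast
  have nT: "null f \<Longrightarrow> null (T f)" for f unfolding T_def by (rule null_compose)
  have q1: "q = 1 + (q - 1)" using q_ge_3 by linarith
  have z0: "(fps_const (1 / w) * fps_X ^ q) $ 0 = (0::'k)" using p_gt_2 r_pos by simp
  have "\<Theta> f = 0"
  proof (rule null_functional_ext[of \<Theta> "real q - B"])
    show "\<Theta> (f + h) = \<Theta> f + \<Theta> h" if "null f" "null h" for f h
    proof -
      have "T (f + h) = T f + T h" by (simp add: T_def fps_compose_add_distrib)
      then show ?thesis using that g nT by (simp add: \<Theta>_def distrib_left Lam_add null_mult)
    qed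
    show "\<Theta> (fps_const c * f) = c * \<Theta> f" if "null f" for f c
    proof -
      have "T (fps_const c * f) = fps_const c * T f"
        unfolding T_def fps_compose_mult_distrib[OF z0] by simp
      then have "\<Theta> (fps_const c * f) = Lam \<rho> (fps_const c * (g * T f)) - Lam \<rho> (fps_const c * (g * f))"
        by (simp add: \<Theta>_def algebra_simps)
      then show ?thesis unfolding Lam_cmult[OF null_mult[OF g nT[OF that]]] Lam_cmult[OF null_mult[OF g that]]
        by (simp add: \<Theta>_def right_diff_distrib)
    qed
    show "\<Theta> f \<in> pid M" if "null f" "\<And>n. f $ n \<in> wid n ((real p - 1) * real_of_int M + (real q - B))" for M f
      unfolding \<Theta>_def using that g nT null_compose(2)[OF that]
      by (intro pid_diff Lam_bdd_mult[OF B]) (auto simp: T_def)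
    \<comment> \<open>The substitution turns \<open>u^j\<close> into
      \<open>u^(j + j (q-1)) / w^j\<close>, and the extra factor \<open>u^(j (q-1))\<close>
      evaluates to \<open>w^j\<close>.\<close>
    show "\<Theta> (fps_X ^ j) = 0" for j
    proof -
      have "T (fps_X ^ j) = fps_const ((1 / w) ^ j) * fps_X ^ (j + j * (q - 1))"
      proof -
        have "T (fps_X ^ j) = (fps_const (1 / w) * fps_X ^ q) ^ j"
          unfolding T_def fps_compose_power[OF z0, symmetric] fps_X_fps_compose_startby0[OF z0] ..
        also have "\<dots> = fps_const ((1 / w) ^ j) * fps_X ^ (q * j)" by (rule monom_power)
        also have "q * j = j + j * (q - 1)" using q1 by (metis mult.commute distrib_left mult.right_neutral)
        finally show ?thesis .
      qed
      then have "Lam \<rho> (g * T (fps_X ^ j)) = Lam \<rho> (fps_const ((1 / w) ^ j) * (fps_X ^ (j + j * (q - 1)) * g))"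
        by (simp add: algebra_simps)
      also have "\<dots> = (1 / w) ^ j * (w ^ j * Lam \<rho> (fps_X ^ j * g))"
        unfolding Lam_cmult[OF null_mult[OF null_X_power g]] Lam_shift_mult[OF g] ..
      also have "\<dots> = Lam \<rho> (g * fps_X ^ j)" by (simp add: power_divide mult.commute)
      finally show ?thesis by (simp add: \<Theta>_def)
    qed
  qed (rule f)
  then show ?thesis by (simp add: \<Theta>_def T_def)
qed

text \<open>Evaluation is multiplicative once one factor lives in a single residue class. Each
  \<open>Lam\<close> omits a power of \<open>\<pi>\<close> with exponent below \<open>q - 1\<close>,
  so the power of \<open>w\<close> records the carry in \<open>a + b\<close>.\<close>

lemma Lam_mult:
  assumes f: "null f" and g: "null g" and fa: "\<And>n. f $ n \<noteq> 0 \<Longrightarrow> n mod (q - 1) = a" and a: "a < q - 1" "b < q - 1"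
  shows "Lam ((a + b) mod (q - 1)) (f * g) = Lam a f * Lam b g * w ^ ((a + b) div (q - 1))"
proof -
  define \<rho> where "\<rho> = (a + b) mod (q - 1)"
  define c where "c = w ^ ((a + b) div (q - 1))"
  define \<Theta> where "\<Theta> g = Lam \<rho> (f * g) - Lam a f * c * Lam b g" for g
  obtain B where B: "\<And>n. f $ n \<in> wid n B" using null_bdd[OF f] by blast
  define L where "L = min 0 (v (Lam a f * c))"
  have L: "Lam a f * c \<in> pid L" by (simp add: pid_def L_def)
  define K where "K = max (real q - B) (real q - (real p - 1) * L)"
  have "\<Theta> g = 0"
  proof (rule null_functional_ext[of \<Theta> K])
    show "\<Theta> (g + h) = \<Theta> g + \<Theta> h" if "null g" "null h" for g h
      using that f by (simp add: \<Theta>_def distrib_left Lam_add null_mult)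
    show "\<Theta> (fps_const x * g) = x * \<Theta> g" if "null g" for g x
    proof -
      have "\<Theta> (fps_const x * g) = Lam \<rho> (fps_const x * (f * g)) - Lam a f * c * Lam b (fps_const x * g)"
        by (simp add: \<Theta>_def algebra_simps)
      moreover have "Lam b (fps_const x * g) = x * Lam b g" using that by (rule Lam_cmult)
      moreover have "Lam \<rho> (fps_const x * (f * g)) = x * Lam \<rho> (f * g)" using null_mult[OF f that] by (rule Lam_cmult)
      ultimately show ?thesis by (simp add: \<Theta>_def right_diff_distrib mult.left_commute)
    qed
    show "\<Theta> g \<in> pid M" if "null g" "\<And>n. g $ n \<in> wid n ((real p - 1) * real_of_int M + K)" for M g
    proof -
      have "Lam b g \<in> pid (M - L)"
        by (rule Lam_pid[OF that]) (simp add: K_def algebra_simps)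
      then have "Lam a f * c * Lam b g \<in> pid (L + (M - L))" using L by (intro pid_mult) auto
      moreover have "Lam \<rho> (f * g) \<in> pid M"
        using f that(1) by (intro Lam_bdd_mult[OF B]) (auto intro: wid_mono[OF that(2)] simp: K_def)
      ultimately show ?thesis unfolding \<Theta>_def by (intro pid_diff) auto
    qed
    show "\<Theta> (fps_X ^ j) = 0" for j
    proof -
      have "Lam b (fps_X ^ j) = lam b j"
      proof (rule Lam_eqI, rule plim_cong[OF plim_const])
        have "lam b j = (\<Sum>n<N. fps_X ^ j $ n * lam b n)" if "N > j" for N
        proof -
          have "(\<Sum>n<N. fps_X ^ j $ n * lam b n) = (\<Sum>n<N. if n = j then lam b n else 0)"
            by (intro sum.cong) auto
          then show ?thesis using that by simp
        qed
        then show "\<forall>\<^sub>F N in sequentially. lam b j = (\<Sum>n<N. fps_X ^ j $ n * lam b n)"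
          by (auto intro: eventually_mono[OF eventually_gt_at_top[of j]])
      qed
      have *: "lam \<rho> (m + j) = lam a m * c * lam b j" if "m mod (q - 1) = a" for m
      proof (cases "j mod (q - 1) = b")
        case True
        have "(m + j) mod (q - 1) = \<rho>" using that True by (metis \<rho>_def mod_add_eq)
        moreover have "(m + j) div (q - 1) = m div (q - 1) + j div (q - 1) + (a + b) div (q - 1)"
          using div_add1_eq[of m j "q - 1"] unfolding that True .
        ultimately show ?thesis using that True by (simp add: lam_def c_def power_add)
      next
        case False
        have "(m + j) mod (q - 1) \<noteq> \<rho>"
        proof
          assume "(m + j) mod (q - 1) = \<rho>"
          then have "[m + j = a + b] (mod (q - 1))" by (simp add: cong_def \<rho>_def)
          moreover have "[m = a] (mod (q - 1))" using that a by (simp add: cong_def)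
          ultimately have "[m + j = m + b] (mod (q - 1))" by (meson cong_add_rcancel_nat cong_sym cong_trans)
          then have "[j = b] (mod (q - 1))" by (simp add: cong_add_lcancel_nat)
          then show False using False a by (simp add: cong_def)
        qed
        then show ?thesis using False by (simp add: lam_def)
      qed
      have "(\<lambda>N. \<Sum>m<N. f $ m * lam \<rho> (m + j)) = (\<lambda>N. c * lam b j * (\<Sum>m<N. f $ m * lam a m))"
      proof
        fix N
        have "(\<Sum>m<N. f $ m * lam \<rho> (m + j)) = (\<Sum>m<N. c * lam b j * (f $ m * lam a m))"
        proof (rule sum.cong)
          fix m show "f $ m * lam \<rho> (m + j) = c * lam b j * (f $ m * lam a m)"
            using *[OF fa, of m] by (cases "f $ m = 0") auto
        qed simp
        then show "(\<Sum>m<N. f $ m * lam \<rho> (m + j)) = c * lam b j * (\<Sum>m<N. f $ m * lam a m)" by (simp add: sum_distrib_left)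
      qed
      then have "Lam \<rho> (fps_X ^ j * f) = c * lam b j * Lam a f"
        using plim_unique[OF Lam_X_mult[OF f, of \<rho> j]] plim_cmult[OF Lam_lim[OF f, of a], of "c * lam b j"] by simp
      then show ?thesis using \<open>Lam b (fps_X ^ j) = lam b j\<close> by (simp add: \<Theta>_def algebra_simps)
    qed
  qed (rule g)
  then show ?thesis by (simp add: \<Theta>_def \<rho>_def c_def algebra_simps)
qed

text \<open>The carries of the successive additions of \<open>a\<close> add up to
  \<open>k a div (q-1)\<close>.\<close>

lemma Lam_power:
  assumes f: "null f" and fa: "\<And>n. f $ n \<noteq> 0 \<Longrightarrow> n mod (q - 1) = a" and a: "a < q - 1"
  shows "Lam ((k * a) mod (q - 1)) (f ^ k) = Lam a f ^ k * w ^ ((k * a) div (q - 1))"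
proof (induction k)
  case 0
  have "Lam 0 1 = 1"
  proof (rule Lam_eqI, rule plim_cong[OF plim_const])
    have "1 = (\<Sum>n<N. 1 $ n * lam 0 n)" if "N > 0" for N
    proof -
      have "(\<Sum>n<N. 1 $ n * lam 0 n) = (\<Sum>n<N. if n = 0 then lam 0 n else 0)"
        by (intro sum.cong) auto
      then show ?thesis using that by (simp add: lam_def)
    qed
    then show "\<forall>\<^sub>F N in sequentially. 1 = (\<Sum>n<N. 1 $ n * lam 0 n)"
      by (auto intro: eventually_mono[OF eventually_gt_at_top[of 0]])
  qed
  then show ?case by simp
next
  case (Suc k)
  define b where "b = (k * a) mod (q - 1)"
  have b: "b < q - 1" using q_ge_3 by (simp add: b_def)
  have "Lam ((a + b) mod (q - 1)) (f * f ^ k) = Lam a f * Lam b (f ^ k) * w ^ ((a + b) div (q - 1))"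
    using f fa a b by (intro Lam_mult null_power) auto
  moreover have "(a + b) mod (q - 1) = (Suc k * a) mod (q - 1)" by (simp add: b_def mod_simps)
  moreover have "(Suc k * a) div (q - 1) = (k * a) div (q - 1) + (a + b) div (q - 1)"
    using div_add1_eq[of a "k * a" "q - 1"] a by (simp add: b_def)
  ultimately show ?case using Suc by (simp add: b_def power_add algebra_simps)
qed

section \<open>The trace formula\<close>

text \<open>Indexed by integers, so that the recurrence holds without case distinctions or truncated subtraction.\<close>

definition dcoeff :: "int \<Rightarrow> 'k" where "dcoeff l = (if l < 0 then 0 else dwork_exp $ nat l)"

lemma dwork_exp_deriv:
  "fps_deriv dwork_exp = (1 - fps_const (of_nat q / w) * fps_X ^ (q - 1)) * dwork_exp"
proof -
  have "fps_deriv (fps_X - fps_const (1 / w) * fps_X ^ q) = 1 - fps_const (of_nat q / w) * fps_X ^ (q - 1)"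
    by (simp add: fps_deriv_power' fps_of_nat[symmetric] mult.assoc[symmetric] del: of_nat_power)
  then show ?thesis unfolding dwork_exp_def using p_gt_2 r_pos by (subst fexp_deriv) auto
qed

text \<open>Coefficients in the differential equation of \<open>dwork_exp\<close> after
  multiplication by \<open>u\<close>; for \<open>l \<le> 0\<close> both sides vanish.\<close>

lemma dcoeff_rec: "of_int l * dcoeff l = dcoeff (l - 1) - of_nat q / w * dcoeff (l - int q)"
proof (cases "l > 0")
  case False
  then show ?thesis using q_ge_3 by (cases "l = 0") (auto simp: dcoeff_def simp del: of_nat_power)
next
  case True
  define m where "m = nat (l - 1)"
  have l: "l = int m + 1" using True by (simp add: m_def)
  have "fps_deriv dwork_exp $ m = (dwork_exp - fps_const (of_nat q / w) * (fps_X ^ (q - 1) * dwork_exp)) $ m"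
    unfolding dwork_exp_deriv by (simp add: algebra_simps)
  then have "of_nat (m + 1) * dwork_exp $ (m + 1) = dwork_exp $ m - of_nat q / w * (if m < q - 1 then 0 else dwork_exp $ (m - (q - 1)))"
    by (simp add: fps_X_power_mult_nth del: of_nat_power)
  moreover have "l - int q < 0 \<longleftrightarrow> m < q - 1" "nat (l - int q) = m - (q - 1)"
    using l q_ge_3 by linarith+
  then have "dcoeff (l - int q) = (if m < q - 1 then 0 else dwork_exp $ (m - (q - 1)))"
    unfolding dcoeff_def by presburger
  moreover have "dcoeff l = dwork_exp $ (m + 1)" "dcoeff (l - 1) = dwork_exp $ m"
    using l by (simp_all add: dcoeff_def nat_add_distrib)
  moreover have "of_int l = (of_nat (m + 1) :: 'k)" using l by simp
  ultimately show ?thesis by presburger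
qed

text \<open>The exponent with \<open>q \<kappa> = \<kappa> + a\<close>. Thus
  \<open>q n + a - m = q (n + \<kappa>) - (m + \<kappa>)\<close>, which makes the shift by
  \<open>a\<close> in \<open>Amat\<close> compatible with a twisted derivation.\<close>

definition kap :: "nat \<Rightarrow> 'k" where "kap a = of_nat a / (of_nat q - 1)"

lemma unit_q1: "unit (of_nat q - 1)"
proof -
  have "\<not> p dvd q - 1"
  proof
    assume "p dvd q - 1"
    moreover have "p dvd q" using r_pos by simp
    ultimately have "p dvd q - (q - 1)" by (rule dvd_diff_nat[rotated])
    then show False using q_ge_3 p_gt_2 by (simp add: diff_diff_eq2 del: of_nat_power)
  qed
  then have "unit (of_nat (q - 1))" by (rule unit_of_nat)
  then show ?thesis using q_ge_3 by (simp add: of_nat_diff)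
qed

lemma kap_pid: "kap a \<in> pid 0"
  unfolding kap_def divide_inverse
  by (rule pid_mult_int[OF pid_of_nat unit_pid[OF unit_inverse[OF unit_q1]]])

lemma kap_mult: "kap a * (of_nat q - 1) = of_nat a"
  using unit_q1 by (simp add: kap_def unit_def)

text \<open>Dwork's operator with row \<open>n\<close> and column \<open>m\<close>: multiply
  \<open>u^m\<close> by \<open>u^(-a)\<close> times the Dwork exponential, keep the exponents
  divisible by \<open>q\<close>, and send \<open>u^(q n)\<close> to \<open>w^n u^n\<close>, which in
  \<open>x\<close> is \<open>x^(q n) -> x^n\<close>.\<close>

definition Amat :: "nat \<Rightarrow> nat \<Rightarrow> nat \<Rightarrow> 'k" where
  "Amat a n m = w ^ n * dcoeff (int (q * n + a) - int m)"

text \<open>\<open>vfun\<close> is the linear form vanishing on the image of \<open>D\<close>, and \<open>Bmat\<close> is \<open>A\<close> composed with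
\<open>f \<mapsto> D^(-1) (f - v(f))\<close>.\<close>

primrec Bmat :: "nat \<Rightarrow> nat \<Rightarrow> nat \<Rightarrow> 'k" where
  "Bmat a n 0 = 0"
| "Bmat a n (Suc m) = Amat a n m - (of_nat m + kap a) * Bmat a n m"

definition vfun :: "nat \<Rightarrow> nat \<Rightarrow> 'k" where "vfun a m = (\<Prod>i<m. - (of_nat i + kap a))"

abbreviation prev :: "(nat \<Rightarrow> 'k) \<Rightarrow> nat \<Rightarrow> 'k" where "prev f n \<equiv> (if n = 0 then 0 else f (n - 1))"

text \<open>With \<open>D y^m = (m + \<kappa>) y^m + y^(m+1)\<close> this reads \<open>A D = q D A\<close>.\<close>

lemma Amat_commute:
  assumes "a < q"
  shows "(of_nat m + kap a) * Amat a n m + Amat a n (Suc m) =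
    of_nat q * ((of_nat n + kap a) * Amat a n m + prev (\<lambda>n. Amat a n m) n)"
proof -
  define l where "l = int (q * n + a) - int m"
  have rec: "of_int l * dcoeff l = dcoeff (l - 1) - of_nat q / w * dcoeff (l - int q)" by (rule dcoeff_rec)
  have 1: "Amat a n (Suc m) = w ^ n * dcoeff (l - 1)" by (simp add: Amat_def l_def algebra_simps)
  have 2: "prev (\<lambda>n. Amat a n m) n = w ^ n / w * dcoeff (l - int q)"
  proof (cases n)
    case 0
    then have "l = int a - int m" by (simp add: l_def)
    then have "l - int q < 0" using assms by linarith
    then show ?thesis using 0 by (simp add: dcoeff_def)
  next
    case (Suc k)
    then show ?thesis by (simp add: Amat_def l_def algebra_simps)
  qed
  have "of_int l = of_nat q * of_nat n + of_nat a - (of_nat m :: 'k)" by (simp add: l_def)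
  also have "\<dots> = of_nat q * (of_nat n + kap a) - (of_nat m + kap a)"
    using kap_mult[of a] by (simp add: algebra_simps)
  finally have 3: "of_int l = of_nat q * (of_nat n + kap a) - (of_nat m + kap a)" .
  have "w ^ n * (of_int l * dcoeff l) = w ^ n * dcoeff (l - 1) - of_nat q * (w ^ n / w * dcoeff (l - int q))"
    unfolding rec by (simp add: algebra_simps)
  then show ?thesis unfolding 1 2 unfolding Amat_def l_def[symmetric] 3
    by (simp add: algebra_simps)
qed

text \<open>Modulo the image of \<open>D\<close> a polynomial \<open>f\<close> is the constant
  \<open>vfun(f)\<close>. Writing \<open>f = D g + vfun(f)\<close> and using
  \<open>A D = q D A\<close> gives \<open>A f = q D (A g) + vfun(f) A(1)\<close>, and
  \<open>Bmat\<close> is the matrix of \<open>f -> A g\<close>.\<close>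

lemma Amat_decomp:
  assumes "a < q"
  shows "Amat a n m = of_nat q * ((of_nat n + kap a) * Bmat a n m + prev (\<lambda>n. Bmat a n m) n) + Amat a n 0 * vfun a m"
proof (induction m)
  case 0 then show ?case by (simp add: vfun_def)
next
  case (Suc m)
  define k where "k = of_nat m + kap a"
  define P where "P = of_nat n + kap a"
  have pB: "prev (\<lambda>n. Bmat a n (Suc m)) n = prev (\<lambda>n. Amat a n m) n - k * prev (\<lambda>n. Bmat a n m) n"
    by (simp add: k_def)
  have vS: "vfun a (Suc m) = - (k * vfun a m)"
    unfolding vfun_def prod.lessThan_Suc k_def mult_minus_right by (simp only: mult.commute)
  have "of_nat q * (P * Bmat a n (Suc m) + prev (\<lambda>n. Bmat a n (Suc m)) n) + Amat a n 0 * vfun a (Suc m)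
     = of_nat q * (P * Amat a n m + prev (\<lambda>n. Amat a n m) n) -
       k * (of_nat q * (P * Bmat a n m + prev (\<lambda>n. Bmat a n m) n) + Amat a n 0 * vfun a m)"
    unfolding pB vS by (simp add: k_def[symmetric] algebra_simps del: of_nat_power)
  also have "\<dots> = (k * Amat a n m + Amat a n (Suc m)) - k * Amat a n m"
    unfolding P_def k_def Amat_commute[OF assms, of m n, symmetric] Suc.IH[symmetric] ..
  finally show ?case by (simp add: P_def)
qed

text \<open>\<open>Tr (D B) = Tr (B D)\<close> becomes a telescoping sum along the diagonal.\<close>

lemma Amat_trace:
  assumes "a < q"
  shows "(1 - of_nat q) * (\<Sum>n\<le>X. Amat a n n) = (\<Sum>n\<le>X. Amat a n 0 * vfun a n) - of_nat q * Bmat a X (Suc X)"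
proof (induction X)
  case 0
  show ?case by (simp add: vfun_def algebra_simps)
next
  case (Suc X)
  have "Amat a (Suc X) (Suc X) = of_nat q * ((of_nat (Suc X) + kap a) * Bmat a (Suc X) (Suc X) + Bmat a X (Suc X)) + Amat a (Suc X) 0 * vfun a (Suc X)"
    using Amat_decomp[OF assms, of "Suc X" "Suc X"] by (simp del: Bmat.simps of_nat_Suc)
  moreover have "Bmat a (Suc X) (Suc (Suc X)) = Amat a (Suc X) (Suc X) - (of_nat (Suc X) + kap a) * Bmat a (Suc X) (Suc X)"
    by (rule Bmat.simps)
  moreover have "(1 - Q) * (S + A) = T + D - Q * B2"
    if "(1 - Q) * S = T - Q * B0" "A = Q * (P * B1 + B0) + D" "B2 = A - P * B1" for Q S A T D B2 B0 P B1 :: 'k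
  proof -
    have "(1 - Q) * (S + A) = (T - Q * B0) + A - Q * A" unfolding that(1)[symmetric] by (simp add: algebra_simps)
    also have "A = Q * (P * B1 + B0) + D" by (rule that(2))
    finally show ?thesis unfolding that(3) that(2) by (simp add: algebra_simps)
  qed
  ultimately show ?case unfolding sum.atMost_Suc using Suc.IH by blast
qed

text \<open>Bound for row \<open>n\<close>: \<open>p - 1\<close> times the valuation of an entry is
  at least \<open>n (q-1)\<close>, from \<open>w^n\<close>, minus \<open>(1 - rate) l\<close>, from
  a coefficient of index \<open>l \<le> q n + q\<close>.\<close>

definition Abound :: "nat \<Rightarrow> int" where
  "Abound n = \<lceil>(real n * (rate * q - 1) - q) / (real p - 1)\<rceil>"

text \<open>The product equals \<open>(p-1)^2 / p\<close>, which exceeds 1 for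
  \<open>p \<ge> 3\<close>; this makes the rows of the Frobenius matrix tend to zero.\<close>

lemma rate_q: "rate * q > 1"
proof -
  have "real q = real p ^ (r - 1) * real p" using r_pos by (metis Suc_pred' of_nat_power power_Suc2)
  then have "rate * q = (real p - 1) ^ 2 / real p"
    using p_gt_2 by (simp add: rate_def dwork_rate_def power2_eq_square)
  moreover have "real p < (real p - 1) ^ 2"
  proof -
    have "0 < real p * (real p - 3) + 1" using p_gt_2 by (intro add_nonneg_pos mult_nonneg_nonneg) auto
    then show ?thesis by (simp add: power2_eq_square algebra_simps)
  qed
  ultimately show ?thesis using p_gt_2 by simp
qed

lemma rate_le_1: "rate \<le> 1"
proof -
  have "dwork_rate \<le> 1" using p_gt_2 by (simp add: dwork_rate_def divide_le_eq power_mono)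
  moreover have "1 \<le> real p ^ (r - 1)" using p_gt_2 by simp
  ultimately have "dwork_rate \<le> real p ^ (r - 1)" by linarith
  then show ?thesis unfolding rate_def using p_gt_2 by (simp add: divide_le_eq)
qed

lemma Amat_pid:
  assumes "a < q" shows "Amat a n m \<in> pid (Abound n)"
proof (cases "Amat a n m = 0")
  case False
  define l where "l = q * n + a - m"
  have dc: "dcoeff (int (q * n + a) - int m) \<noteq> 0" using False by (simp add: Amat_def)
  then have "\<not> int (q * n + a) - int m < 0" unfolding dcoeff_def by presburger
  then have "m \<le> q * n + a" by linarith
  then have dl: "dcoeff (int (q * n + a) - int m) = dwork_exp $ l"
    unfolding of_nat_diff[symmetric, OF \<open>m \<le> q * n + a\<close>] l_def[symmetric] by (simp add: dcoeff_def)
  have nz: "dwork_exp $ l \<noteq> 0" using dc dl by simp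
  have "dwork_exp $ l \<in> wid l (rate * l)" using dwork_exp_W by (auto simp: W_def)
  then have "rate * l \<le> (real p - 1) * v (dwork_exp $ l) + l" using nz by (simp add: wid_def)
  moreover have "l \<le> q * n + q" using assms by (simp add: l_def)
  then have "real l \<le> real (q * n + q)" unfolding of_nat_le_iff .
  then have "real l \<le> real q * real n + q" by simp
  then have "(1 - rate) * l \<le> (1 - rate) * (real q * real n + q)" using rate_le_1 by (intro mult_left_mono) auto
  moreover have "(1 - rate) * (real q * real n + q) \<le> real n * real q - real n * (rate * q) + q"
    using rate_pos by (simp add: algebra_simps)
  moreover have "v (Amat a n m) = int n * int (repunit r) + v (dwork_exp $ l)"
    unfolding Amat_def dl using nz by (simp add: v_mult v_power v_w)
  then have "(real p - 1) * v (Amat a n m) = real n * ((real p - 1) * repunit r) + (real p - 1) * v (dwork_exp $ l)"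
    by (simp add: algebra_simps)
  ultimately have "real n * (rate * q - 1) - q \<le> (real p - 1) * v (Amat a n m)"
    unfolding repunit_eq_real by (simp add: algebra_simps)
  then show ?thesis using p_gt_2 unfolding pid_def Abound_def
    by (simp add: ceiling_le_iff divide_le_eq mult.commute)
qed simp

text \<open>The bound for \<open>Amat\<close> is inherited uniformly in the column because
  \<open>m + \<kappa>\<close> is integral. It makes the boundary term of the trace formula vanish in
  the limit.\<close>

lemma Bmat_pid:
  assumes "a < q" shows "Bmat a n m \<in> pid (Abound n)"
proof (induction m)
  case (Suc m)
  have "(of_nat m + kap a) * Bmat a n m \<in> pid (Abound n)"
    using Suc by (intro pid_mult_int pid_add kap_pid) auto
  then show ?case using Amat_pid[OF assms] by (auto intro: pid_diff)
qed simp

lemma Abound_tendsto: "filterlim Abound at_top sequentially"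
  unfolding filterlim_at_top
proof
  fix M :: int
  have "\<forall>\<^sub>F n in sequentially. n \<ge> nat \<lceil>(M * (real p - 1) + q) / (rate * q - 1)\<rceil>"
    by (rule eventually_ge_at_top)
  then show "\<forall>\<^sub>F n in sequentially. M \<le> Abound n"
  proof eventually_elim
    case (elim n)
    then have "(M * (real p - 1) + q) / (rate * q - 1) \<le> n" by (simp add: nat_le_iff ceiling_le_iff)
    then have "M * (real p - 1) + q \<le> n * (rate * q - 1)" using rate_q by (simp add: pos_divide_le_eq)
    then have "M \<le> (real n * (rate * q - 1) - q) / (real p - 1)" using p_gt_2 by (simp add: le_divide_eq)
    then show ?case unfolding Abound_def by (simp add: le_ceiling_iff)
  qed
qed

lemma Abound_ge: "Abound 0 \<le> Abound n"
  unfolding Abound_def using rate_q p_gt_2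
  by (intro ceiling_mono divide_right_mono) auto

text \<open>The Gauss sum of \<open>\<omega>^(-a)\<close> is \<open>(q - 1) \<pi>^a gam a\<close>.\<close>

definition gam :: "nat \<Rightarrow> 'k" where "gam a = Lam a dwork_exp"

lemma dwork_exp_null: "null dwork_exp" by (rule W_null[OF dwork_exp_W rate_pos])

text \<open>The exponents congruent to \<open>a\<close> are
  \<open>n (q-1) + a = (q n + a) - n\<close>, which are the diagonal positions: \<open>gam a\<close>
  is the trace of \<open>Amat\<close>.\<close>

lemma gam_lim:
  assumes a: "a < q - 1"
  shows "plim (\<lambda>X. \<Sum>n\<le>X. Amat a n n) (gam a)"
proof -
  have q1: "q = 1 + (q - 1)" "q - 1 > 0" using q_ge_3 by linarith+
  have eq: "(\<Sum>n<Suc X * (q - 1). dwork_exp $ n * lam a n) = (\<Sum>n\<le>X. Amat a n n)" for X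
  proof -
    define h where "h k = k * (q - 1) + a" for k
    have hm: "h k mod (q - 1) = a" "h k div (q - 1) = k" for k using a by (auto simp: h_def)
    have inj: "inj_on h {..X}" by (intro inj_onI) (metis hm(2))
    have "(\<Sum>n<Suc X * (q - 1). dwork_exp $ n * lam a n) = (\<Sum>n\<in>h ` {..X}. dwork_exp $ n * lam a n)"
    proof (rule sum.mono_neutral_right)
      show "h ` {..X} \<subseteq> {..<Suc X * (q - 1)}"
      proof safe
        fix k assume "k \<le> X"
        then have "k * (q - 1) \<le> X * (q - 1)" by (rule mult_le_mono1)
        moreover have "Suc X * (q - 1) = X * (q - 1) + (q - 1)" by simp
        ultimately show "h k < Suc X * (q - 1)" using a unfolding h_def by linarith
      qed
      show "\<forall>n\<in>{..<Suc X * (q - 1)} - h ` {..X}. dwork_exp $ n * lam a n = 0"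
      proof
        fix n assume n: "n \<in> {..<Suc X * (q - 1)} - h ` {..X}"
        have "n mod (q - 1) \<noteq> a"
        proof
          assume "n mod (q - 1) = a"
          then have "n = h (n div (q - 1))" unfolding h_def by (metis div_mult_mod_eq)
          moreover have "n div (q - 1) < Suc X" using n q1 by (simp add: div_less_iff_less_mult mult.commute)
          ultimately show False using n by auto
        qed
        then show "dwork_exp $ n * lam a n = 0" by (simp add: lam_def)
      qed
    qed simp
    also have "\<dots> = (\<Sum>k\<le>X. dwork_exp $ h k * lam a (h k))" using sum.reindex[OF inj] by simp
    also have "\<dots> = (\<Sum>n\<le>X. Amat a n n)"
    proof (rule sum.cong)
      fix k
      have "q * k + a = k + h k" unfolding h_def using q1 by (metis add.assoc mult.commute distrib_left mult.right_neutral)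
      then have "int (q * k + a) - int k = int (h k)" by linarith
      then show "dwork_exp $ h k * lam a (h k) = Amat a k k"
        unfolding Amat_def lam_def hm by (simp add: dcoeff_def)
    qed simp
    finally show ?thesis .
  qed
  have "filterlim (\<lambda>X. Suc X * (q - 1)) sequentially sequentially"
  proof (rule filterlim_at_top_mono[OF filterlim_ident], rule always_eventually, rule allI)
    fix X
    have "X \<le> Suc X * 1" by simp
    also have "\<dots> \<le> Suc X * (q - 1)" using q1(2) by (intro mult_le_mono2) simp
    finally show "X \<le> Suc X * (q - 1)" .
  qed
  from plim_subseq[OF Lam_lim[OF dwork_exp_null, of a] this] show ?thesis unfolding eq gam_def .
qed

lemma prod_cong_pid:
  assumes "\<And>i. i \<in> A \<Longrightarrow> f i \<in> pid 0" "\<And>i. i \<in> A \<Longrightarrow> g i \<in> pid 0" "\<And>i. i \<in> A \<Longrightarrow> f i - g i \<in> pid M"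
  shows "prod f A - prod g A \<in> pid M"
  using assms
proof (induction A rule: infinite_finite_induct)
  case (insert x A)
  have "f x * (prod f A - prod g A) + prod g A * (f x - g x) \<in> pid M"
    using insert by (intro pid_add pid_mult_int pid_prod insert.IH) auto
  then show ?case using insert(1,2) by (simp add: algebra_simps)
qed auto

text \<open>The integers \<open>a (q^N - 1) / (q - 1)\<close>, whose base-\<open>q\<close> expansion
  repeats the digit \<open>a\<close>; they converge to \<open>-\<kappa>\<close>.\<close>

definition nseq :: "nat \<Rightarrow> nat \<Rightarrow> nat" where "nseq a N = a * (\<Sum>i<N. q ^ i)"

lemma nseq_Suc: "nseq a (Suc N) = q * nseq a N + a"
  unfolding nseq_def by (subst sum.lessThan_Suc_shift) (simp add: sum_distrib_left algebra_simps)

lemma nseq_kap: "of_nat (nseq a N) + kap a = kap a * of_nat (q ^ N)"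
proof (induction N)
  case 0 then show ?case by (simp add: nseq_def)
next
  case (Suc N)
  have "of_nat (nseq a (Suc N)) + kap a = of_nat q * (of_nat (nseq a N) + kap a) + of_nat a - kap a * (of_nat q - 1)"
    unfolding nseq_Suc by (simp add: algebra_simps)
  also have "\<dots> = kap a * of_nat (q ^ Suc N)" unfolding Suc kap_mult by (simp add: algebra_simps)
  finally show ?case .
qed

lemma nseq_kap_pid: "of_nat (nseq a N) + kap a \<in> pid (int N)"
proof -
  have "int N \<le> int (r * N)" unfolding of_nat_le_iff using r_pos by (cases r) auto
  have "(of_nat (q ^ N) :: 'k) = of_nat p ^ (r * N)" by (simp add: power_mult)
  also have "\<dots> \<in> pid (int (r * N))" by (rule pid_p_power)
  finally show ?thesis unfolding nseq_kap using kap_pid pid_mult_int pid_mono \<open>int N \<le> _\<close> by blast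
qed

lemma nseq_tendsto: "a > 0 \<Longrightarrow> filterlim (nseq a) sequentially sequentially"
proof (rule filterlim_at_top_mono[OF filterlim_ident])
  assume a: "a > 0"
  have "N \<le> nseq a N" for N
  proof (induction N)
    case (Suc N)
    have "nseq a N \<le> q * nseq a N" using q_ge_3 by simp
    then show ?case unfolding nseq_Suc using Suc a by linarith
  qed simp
  then show "\<forall>\<^sub>F x in sequentially. x \<le> nseq a x" by simp
qed

lemma Amat_0: "Amat a n 0 = w ^ n * dwork_exp $ (q * n + a)"
proof -
  have "int (q * n + a) - int 0 = int (q * n + a)" by simp
  then show ?thesis unfolding Amat_def dcoeff_def by (simp only: of_nat_less_0_iff if_False nat_int)
qed

text \<open>When the integer \<open>X\<close> replaces \<open>-\<kappa>\<close>, \<open>vfun\<close>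
  turns into the falling factorial \<open>X! / (X-n)!\<close>. The sum is read off from the
  coefficient of \<open>u^(q X + a)\<close> in
  \<open>dwork_exp * exp (u^q / w) = exp u\<close>.\<close>

lemma Amat_sum_fact:
  assumes "a < q"
  shows "(\<Sum>n\<le>X. Amat a n 0 * (fact X / fact (X - n))) = w ^ X * fact X / fact (q * X + a)"
proof -
  have q0: "q > 0" using q_ge_3 by linarith
  have "dwork_exp * fexp (fps_const (1 / w) * fps_X ^ q) = fexp (fps_const 1 * fps_X)"
    unfolding dwork_exp_def using q0 by (subst fexp_add[symmetric]) auto
  then have "(fexp (fps_const (1 / w) * fps_X ^ q) * dwork_exp) $ (q * X + a) = 1 / fact (q * X + a)"
    unfolding mult.commute[of _ dwork_exp] by (simp add: fexp_const_X_nth del: fps_const_1_eq_1)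
  also have "(fexp (fps_const (1 / w) * fps_X ^ q) * dwork_exp) $ (q * X + a) =
     (\<Sum>i=0..q * X + a. fexp (fps_const (1 / w) * fps_X ^ q) $ i * dwork_exp $ (q * X + a - i))"
    by (rule fps_mult_nth)
  \<comment> \<open>Only multiples of \<open>q\<close> contribute, and \<open>a < q\<close> keeps
    them at most \<open>q X\<close>.\<close>
  also have "\<dots> = (\<Sum>i\<in>(\<lambda>n. q * (X - n)) ` {..X}. fexp (fps_const (1 / w) * fps_X ^ q) $ i * dwork_exp $ (q * X + a - i))"
  proof (rule sum.mono_neutral_right)
    show "(\<lambda>n. q * (X - n)) ` {..X} \<subseteq> {0..q * X + a}" by (auto intro!: trans_le_add1 mult_le_mono2)
    show "\<forall>i\<in>{0..q * X + a} - (\<lambda>n. q * (X - n)) ` {..X}. fexp (fps_const (1 / w) * fps_X ^ q) $ i * dwork_exp $ (q * X + a - i) = 0"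
    proof
      fix i assume i: "i \<in> {0..q * X + a} - (\<lambda>n. q * (X - n)) ` {..X}"
      have "\<not> q dvd i"
      proof
        assume "q dvd i"
        then obtain k where k: "i = q * k" by blast
        then have "q * k < q * (X + 1)" using i assms by simp
        then have "k \<le> X" using q0 by (simp only: mult_less_cancel1) simp
        then have "i = q * (X - (X - k))" "X - k \<in> {..X}" using k by auto
        then show False using i by blast
      qed
      then show "fexp (fps_const (1 / w) * fps_X ^ q) $ i * dwork_exp $ (q * X + a - i) = 0"
        using q0 by (simp add: fexp_const_Xm_nth)
    qed
  qed simp
  also have "\<dots> = (\<Sum>n\<le>X. fexp (fps_const (1 / w) * fps_X ^ q) $ (q * (X - n)) * dwork_exp $ (q * X + a - q * (X - n)))"
    by (subst sum.reindex) (use q0 in \<open>auto intro!: inj_onI\<close>)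
  also have "\<dots> = (\<Sum>n\<le>X. Amat a n 0 / (w ^ X * fact (X - n)))"
  proof (rule sum.cong)
    fix n assume n: "n \<in> {..X}"
    then have qX: "q * X = q * (X - n) + q * n" by (simp add: distrib_left[symmetric] del: distrib_left)
    then have "q * X + a - q * (X - n) = q * n + a" by linarith
    moreover have "w ^ X = w ^ (X - n) * w ^ n" using n by (simp flip: power_add)
    moreover have "Amat a n 0 = w ^ n * dwork_exp $ (q * n + a)" by (rule Amat_0)
    ultimately show "fexp (fps_const (1 / w) * fps_X ^ q) $ (q * (X - n)) * dwork_exp $ (q * X + a - q * (X - n)) = Amat a n 0 / (w ^ X * fact (X - n))"
      using q0 by (simp add: fexp_const_Xm_nth power_divide)
  qed simp
  finally have "w ^ X * fact X * (1 / fact (q * X + a)) = w ^ X * fact X * (\<Sum>n\<le>X. Amat a n 0 / (w ^ X * fact (X - n)))"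
    by simp
  also have "\<dots> = (\<Sum>n\<le>X. Amat a n 0 * (fact X / fact (X - n)))"
    unfolding sum_distrib_left by (intro sum.cong refl) (simp add: field_simps)
  finally show ?thesis by simp
qed

text \<open>The trace formula truncated at \<open>X = nseq a N\<close>: its boundary term tends to
  zero, and \<open>vfun\<close> may be replaced by falling factorials of \<open>X\<close>, uniformly
  in the index, because \<open>X + \<kappa>\<close> is divisible by \<open>p^N\<close>. The
  denominator arises as \<open>q X + a = nseq a (Suc N)\<close>.\<close>

theorem gam_fact_lim:
  assumes a: "0 < a" "a < q - 1"
  shows "plim (\<lambda>N. w ^ nseq a N * fact (nseq a N) / fact (nseq a (Suc N))) ((1 - of_nat q) * gam a)"
proof -
  have aq: "a < q" using a by linarith
  have "plim (\<lambda>N. (1 - of_nat q) * (\<Sum>n\<le>nseq a N. Amat a n n)) ((1 - of_nat q) * gam a)"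
    by (intro plim_cmult plim_subseq[OF gam_lim[OF a(2)] nseq_tendsto[OF a(1)]])
  moreover have "plim (\<lambda>N. of_nat q * Bmat a (nseq a N) (Suc (nseq a N))) (of_nat q * 0)"
  proof (intro plim_cmult plim_subseq[OF _ nseq_tendsto[OF a(1)], of "\<lambda>n. Bmat a n (Suc n)"])
    show "plim (\<lambda>n. Bmat a n (Suc n)) 0" using Bmat_pid[OF aq] Abound_tendsto by (rule plim_of_pid)
  qed
  moreover have "plim (\<lambda>N. w ^ nseq a N * fact (nseq a N) / fact (nseq a (Suc N)) - (\<Sum>n\<le>nseq a N. Amat a n 0 * vfun a n)) 0"
  proof (rule plim_of_pid)
    fix N
    define X where "X = nseq a N"
    have "w ^ X * fact X / fact (nseq a (Suc N)) - (\<Sum>n\<le>X. Amat a n 0 * vfun a n) =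
      (\<Sum>n\<le>X. Amat a n 0 * (fact X / fact (X - n) - vfun a n))"
      unfolding nseq_Suc X_def[symmetric] Amat_sum_fact[OF aq, symmetric] by (simp add: sum_subtractf right_diff_distrib)
    also have "\<dots> \<in> pid (Abound 0 + int N)"
    proof (rule pid_sum, rule pid_mult)
      fix n assume n: "n \<in> {..X}"
      show "Amat a n 0 \<in> pid (Abound 0)" using Amat_pid[OF aq] Abound_ge pid_mono by blast
      have "fact X / fact (X - n) = (\<Prod>i<n. of_nat X - of_nat i :: 'k)"
        using n
      proof (induction n)
        case (Suc n)
        have e: "X - n = Suc (X - Suc n)" using Suc by auto
        have "(\<Prod>i<Suc n. of_nat X - of_nat i :: 'k) = fact X / fact (X - n) * of_nat (X - n)"
          using Suc by (simp add: of_nat_diff)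
        also have "\<dots> = fact X / fact (X - Suc n)" unfolding e by (simp add: fact_Suc del: of_nat_Suc)
        finally show ?case ..
      qed simp
      moreover have "(\<Prod>i<n. of_nat X - of_nat i) - vfun a n \<in> pid (int N)"
        unfolding vfun_def
      proof (rule prod_cong_pid)
        fix i
        show "of_nat X - of_nat i \<in> pid 0" "- (of_nat i + kap a) \<in> pid 0"
          by (intro pid_diff pid_minus pid_add kap_pid pid_of_nat)+
        show "of_nat X - of_nat i - - (of_nat i + kap a) \<in> pid (int N)"
          using nseq_kap_pid[of a N] by (simp add: X_def algebra_simps)
      qed
      ultimately show "fact X / fact (X - n) - vfun a n \<in> pid (int N)" by simp
    qed
    finally show "w ^ nseq a N * fact (nseq a N) / fact (nseq a (Suc N)) - (\<Sum>n\<le>nseq a N. Amat a n 0 * vfun a n) \<in> pid (Abound 0 + int N)"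
      unfolding X_def .
  next
    show "filterlim (\<lambda>N. Abound 0 + int N) at_top sequentially"
      unfolding filterlim_at_top
    proof
      fix Z
      show "\<forall>\<^sub>F N in sequentially. Z \<le> Abound 0 + int N"
        by (rule eventually_mono[OF eventually_ge_at_top[of "nat (Z - Abound 0)"]]) linarith
    qed
  qed
  ultimately have "plim (\<lambda>N. (1 - of_nat q) * (\<Sum>n\<le>nseq a N. Amat a n n) + of_nat q * Bmat a (nseq a N) (Suc (nseq a N)) +
     (w ^ nseq a N * fact (nseq a N) / fact (nseq a (Suc N)) - (\<Sum>n\<le>nseq a N. Amat a n 0 * vfun a n))) ((1 - of_nat q) * gam a + of_nat q * 0 + 0)"
    by (intro plim_add)
  then show ?thesis unfolding Amat_trace[OF aq] by simp
qed

end

section \<open>Teichmueller representatives and Jacobi sums\<close>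

lemma finite_field_power_card_minus_1:
  fixes a :: "'a::{finite,field}"
  assumes "a \<noteq> 0" shows "a ^ (card (UNIV :: 'a set) - 1) = 1"
proof -
  have "(\<Prod>x\<in>UNIV - {0}. x) = (\<Prod>x\<in>UNIV - {0}. a * x)"
    by (rule prod.reindex_bij_witness[of _ "\<lambda>x. a * x" "\<lambda>x. x / a"]) (use assms in auto)
  also have "\<dots> = a ^ card (UNIV - {0 :: 'a}) * (\<Prod>x\<in>UNIV - {0}. x)" by (simp add: prod.distrib)
  finally have "a ^ card (UNIV - {0 :: 'a}) = 1" by simp
  then show ?thesis by simp
qed

lemma power_mod_eq:
  fixes a :: "'a::monoid_mult"
  assumes "a ^ m = 1" shows "a ^ (n mod m) = a ^ n"
proof -
  have "a ^ n = a ^ (m * (n div m) + n mod m)" by simp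
  also have "\<dots> = a ^ (n mod m)" by (simp only: power_add power_mult assms) simp
  finally show ?thesis ..
qed

context unram begin

lemma q_pos: "q > 0" using p_gt_2 by simp

lemma power_q_eq: "(x :: 'a::monoid_mult) ^ q = x * x ^ (q - 1)"
  by (metis Suc_pred' q_pos power_Suc)

lemma F_power_q1: "(a :: 'f) \<noteq> 0 \<Longrightarrow> a ^ (q - 1) = 1"
  using finite_field_power_card_minus_1[of a] card_F by simp

lemma F_power_q: "(a :: 'f) ^ q = a"
proof (cases "a = 0")
  case False
  then show ?thesis unfolding power_q_eq[of a] F_power_q1[OF False] by simp
qed (use q_pos in simp)

lemma F_exists_power_ne_1:
  assumes "0 < n" "n < q - 1" shows "\<exists>a::'f. a \<noteq> 0 \<and> a ^ n \<noteq> 1"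
proof (rule ccontr)
  assume "\<not> ?thesis"
  then have *: "a \<noteq> 0 \<Longrightarrow> a ^ n = 1" for a :: 'f by blast
  define P :: "'f poly" where "P = monom 1 n + [:- 1:]"
  have deg: "degree P = n" unfolding P_def using assms
    by (subst degree_add_eq_left) (auto simp: degree_monom_eq)
  have P0: "P \<noteq> 0" using deg assms by auto
  have "UNIV - {0} \<subseteq> {x. poly P x = 0}" using * by (auto simp: P_def poly_monom)
  then have "card (UNIV - {0 :: 'f}) \<le> card {x. poly P x = 0}" by (intro card_mono) auto
  also have "\<dots> \<le> n" using card_poly_roots_bound[OF P0] deg by simp
  finally show False using assms card_F by simp
qed

lemma power_cong_pid: "x \<in> pid 0 \<Longrightarrow> y \<in> pid 0 \<Longrightarrow> x - y \<in> pid M \<Longrightarrow> x ^ n - y ^ n \<in> pid M"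
  using prod_cong_pid[of "{..<n}" "\<lambda>_. x" "\<lambda>_. y" M] by simp

text \<open>In \<open>x^p - y^p = (x - y) S\<close> the factor \<open>S\<close> is congruent to
  \<open>p x^(p-1)\<close> modulo \<open>x - y\<close>, hence divisible by \<open>p\<close>.\<close>

lemma power_p_cong_pid:
  assumes "x \<in> pid 0" "y \<in> pid 0" "x - y \<in> pid M" "M \<ge> 1"
  shows "x ^ p - y ^ p \<in> pid (M + 1)"
proof -
  have "(\<Sum>i<p. y ^ (p - Suc i) * x ^ i) = (\<Sum>i<p. x ^ i * (y ^ (p - Suc i) - x ^ (p - Suc i))) + of_nat p * x ^ (p - 1)"
  proof -
    have "(\<Sum>i<p. x ^ i * (y ^ (p - Suc i) - x ^ (p - Suc i))) + of_nat p * x ^ (p - 1) =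
      (\<Sum>i<p. x ^ i * (y ^ (p - Suc i) - x ^ (p - Suc i)) + x ^ (p - 1))"
      by (simp add: sum.distrib)
    also have "\<dots> = (\<Sum>i<p. y ^ (p - Suc i) * x ^ i)"
    proof (rule sum.cong)
      fix i assume "i \<in> {..<p}"
      then have "x ^ (p - 1) = x ^ i * x ^ (p - Suc i)" by (simp flip: power_add)
      then show "x ^ i * (y ^ (p - Suc i) - x ^ (p - Suc i)) + x ^ (p - 1) = y ^ (p - Suc i) * x ^ i"
        by (simp add: algebra_simps)
    qed simp
    finally show ?thesis ..
  qed
  also have "\<dots> \<in> pid 1"
  proof (rule pid_add)
    have yx: "y - x \<in> pid 1" using pid_minus[OF pid_mono[OF assms(3,4)]] by simp
    show "(\<Sum>i<p. x ^ i * (y ^ (p - Suc i) - x ^ (p - Suc i))) \<in> pid 1"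
      by (intro pid_sum pid_mult_int pid_power power_cong_pid assms yx)
    have "x ^ (p - 1) * of_nat p \<in> pid 1"
      using pid_p_power[of 1] by (intro pid_mult_int pid_power assms) simp
    then show "of_nat p * x ^ (p - 1) \<in> pid 1" by (simp add: mult.commute)
  qed
  finally have "(x - y) * (\<Sum>i<p. y ^ (p - Suc i) * x ^ i) \<in> pid (M + 1)"
    by (rule pid_mult[OF assms(3)])
  then show ?thesis by (simp add: power_diff_sumr2)
qed

lemma power_q_cong_pid:
  assumes "x \<in> pid 0" "y \<in> pid 0" "x - y \<in> pid M" "M \<ge> 1"
  shows "x ^ q - y ^ q \<in> pid (M + 1)"
proof -
  have "x ^ (p ^ k) - y ^ (p ^ k) \<in> pid (M + int k)" for k
  proof (induction k)
    case 0 then show ?case using assms by simp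
  next
    case (Suc k)
    have "(x ^ (p ^ k)) ^ p - (y ^ (p ^ k)) ^ p \<in> pid (M + int k + 1)"
      using assms Suc by (intro power_p_cong_pid pid_power) auto
    then show ?case by (simp add: mult.commute add_ac flip: power_mult)
  qed
  from this[of r] show ?thesis by (rule pid_mono) (use r_pos in simp)
qed

text \<open>The \<open>q\<close>-th power map contracts residue discs, so each contains at most one
  fixed point.\<close>

lemma fixed_power_q_unique:
  assumes "x \<in> pid 0" "y \<in> pid 0" "x - y \<in> pid 1" "x ^ q = x" "y ^ q = y"
  shows "x = y"
proof -
  have "x - y \<in> pid (1 + int n)" for n
  proof (induction n)
    case (Suc n)
    from power_q_cong_pid[OF assms(1,2) this] show ?case unfolding assms(4,5) by (simp add: add_ac)
  qed (use assms in simp)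
  then have "x - y \<in> pid M" for M by (rule pid_mono[of _ "1 + int (nat M)"]) linarith
  then show ?thesis using pid_all_eq_0[of "x - y"] by simp
qed

lemma res_0 [simp]: "res 0 = 0" using res_eq_0_iff[of 0] by simp

lemma res_minus: "x \<in> pid 0 \<Longrightarrow> res (- x) = - res x"
  using res_add[of x "- x"] pid_minus[of x 0] by (simp add: eq_neg_iff_add_eq_0 add.commute)

lemma res_diff: "x \<in> pid 0 \<Longrightarrow> y \<in> pid 0 \<Longrightarrow> res (x - y) = res x - res y"
  using res_add[of x "- y"] pid_minus[of y 0] res_minus by simp

lemma res_power: "x \<in> pid 0 \<Longrightarrow> res (x ^ n) = res x ^ n"
  by (induction n) (auto simp: res_1 res_mult pid_power)

lemma res_sum: "(\<And>i. i \<in> A \<Longrightarrow> f i \<in> pid 0) \<Longrightarrow> res (\<Sum>i\<in>A. f i) = (\<Sum>i\<in>A. res (f i))"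
  by (induction A rule: infinite_finite_induct) (auto simp: res_add pid_sum)

lemma res_eq_iff: "x \<in> pid 0 \<Longrightarrow> y \<in> pid 0 \<Longrightarrow> res x = res y \<longleftrightarrow> x - y \<in> pid 1"
  using res_eq_0_iff[of "x - y"] res_diff[of x y] pid_diff[of x 0 y] by auto

lemma power_q_eq_iff: "z \<noteq> 0 \<Longrightarrow> z ^ q = z \<longleftrightarrow> z ^ (q - 1) = (1::'k)"
proof -
  assume "z \<noteq> 0"
  then show ?thesis unfolding power_q_eq[of z] by simp
qed

text \<open>Iterating the contraction: \<open>x^(q^n)\<close> converges to a fixed point in the
  residue disc of \<open>x\<close>.\<close>

lemma teich_exists: "\<exists>z \<in> pid 0. z ^ q = z \<and> res z = a"
proof -
  obtain x where x: "x \<in> pid 0" "res x = a" using res_surj by (metis UNIV_I image_iff)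
  define s where "s n = x ^ (q ^ n)" for n
  have s0: "s n \<in> pid 0" for n using x by (simp add: s_def pid_power)
  have s_Suc: "s (Suc n) = s n ^ q" for n
    unfolding s_def power_mult[symmetric] power_Suc by (simp only: mult.commute)
  have step: "s (Suc n) - s n \<in> pid (1 + int n)" for n
  proof (induction n)
    case 0
    have "res (s 1) = res (s 0)" using x by (simp add: s_def res_power F_power_q del: power_one_right)
    then show ?case using res_eq_iff[OF s0 s0] by simp
  next
    case (Suc n)
    have "s (Suc n) ^ q - s n ^ q \<in> pid (1 + int n + 1)"
      using Suc s0 by (intro power_q_cong_pid) auto
    then show ?case unfolding s_Suc[symmetric] by (simp add: add_ac)
  qed
  have "\<exists>L. plim s L"
  proof (rule plim_Cauchy)
    fix M
    show "\<forall>\<^sub>F n in sequentially. s (Suc n) - s n \<in> pid M"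
      by (rule eventually_mono[OF eventually_ge_at_top[of "nat M"]]) (rule pid_mono[OF step], linarith)
  qed
  then obtain z where z: "plim s z" by blast
  have z0: "z \<in> pid 0" using z s0 by (auto intro: plim_pid)
  have "plim (\<lambda>n. s n ^ q) (z ^ q)" by (rule plim_power[OF z])
  moreover have "plim (\<lambda>n. s (Suc n)) z" by (rule plim_subseq[OF z filterlim_Suc])
  ultimately have zq: "z ^ q = z" unfolding s_Suc using plim_unique by blast
  obtain n where n: "s n - z \<in> pid 1" using plimD[OF z, of 1] by (auto simp: eventually_sequentially)
  have "res (s n) = a" using x by (simp add: s_def res_power) (induction n; simp add: F_power_q power_mult)
  moreover have "res (s n) = res z" unfolding res_eq_iff[OF s0 z0] by (rule n)
  ultimately have "res z = a" by simp
  then show ?thesis using z0 zq by blast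
qed

abbreviation tau :: "'f \<Rightarrow> 'k" where "tau \<equiv> teich v res"

lemma tau_props: "tau a \<in> pid 0" "tau a ^ q = tau a" "res (tau a) = a"
proof -
  have "tau a \<in> pid 0 \<and> tau a ^ q = tau a \<and> res (tau a) = a"
  proof (cases "a = 0")
    case True
    then show ?thesis using p_gt_2 by (simp add: teich_def)
  next
    case False
    obtain z where z: "z \<in> pid 0" "z ^ q = z" "res z = a" using teich_exists by blast
    have z0: "z \<noteq> 0" using z False by auto
    have "(THE z. z \<in> padic_int v \<and> z ^ (card (UNIV :: 'f set) - 1) = 1 \<and> res z = a) = z"
    proof (rule the_equality)
      show "z \<in> padic_int v \<and> z ^ (card (UNIV :: 'f set) - 1) = 1 \<and> res z = a"
        using z z0 power_q_eq_iff[OF z0] card_F by (simp add: pid_0_eq)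
      fix y assume y: "y \<in> padic_int v \<and> y ^ (card (UNIV :: 'f set) - 1) = 1 \<and> res y = a"
      have y0: "y \<noteq> 0" using y False by auto
      show "y = z"
        by (rule fixed_power_q_unique) (use y z power_q_eq_iff[OF y0] card_F res_eq_iff in \<open>auto simp: pid_0_eq\<close>)
    qed
    then show ?thesis using False z by (simp add: teich_def)
  qed
  then show "tau a \<in> pid 0" "tau a ^ q = tau a" "res (tau a) = a" by auto
qed

lemma tau_eqI: "z \<in> pid 0 \<Longrightarrow> z ^ q = z \<Longrightarrow> res z = a \<Longrightarrow> tau a = z"
  by (rule fixed_power_q_unique) (use tau_props[of a] res_eq_iff in auto)

lemma tau_0 [simp]: "tau 0 = 0" by (simp add: teich_def)

lemma tau_1 [simp]: "tau 1 = 1" by (rule tau_eqI) (auto simp: res_1)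

lemma tau_mult: "tau (a * b) = tau a * tau b"
  by (rule tau_eqI) (auto simp: tau_props pid_mult_int res_mult power_mult_distrib)

lemma tau_eq_0_iff [simp]: "tau a = 0 \<longleftrightarrow> a = 0"
  using tau_props(3)[of a] by (metis res_0 tau_0)

lemma tau_power: "tau (a ^ n) = tau a ^ n" by (induction n) (auto simp: tau_mult)

lemma tau_inverse: "tau (inverse a) = inverse (tau a)"
proof (cases "a = 0")
  case False
  have "tau a * tau (inverse a) = 1" using False by (simp flip: tau_mult)
  then show ?thesis by (rule inverse_unique[symmetric])
qed simp

lemma tau_prod: "tau (\<Prod>i\<in>A. f i) = (\<Prod>i\<in>A. tau (f i))"
  by (induction A rule: infinite_finite_induct) (auto simp: tau_mult)

lemma tau_power_q1: "a \<noteq> 0 \<Longrightarrow> tau a ^ (q - 1) = 1"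
  using tau_props(2)[of a] power_q_eq_iff[of "tau a"] by simp

lemma tau_inj: "tau a = tau b \<longleftrightarrow> a = b" using tau_props(3) by metis

section \<open>Orthogonality of characters, and the additive character obtained from Dwork's
  series\<close>

lemma sum_tau_power:
  "(\<Sum>a\<in>UNIV - {0}. tau a ^ n) = (if (q - 1) dvd n then of_nat q - 1 else 0)"
proof (cases "(q - 1) dvd n")
  case True
  have "(\<Sum>a\<in>UNIV - {0}. tau a ^ n) = (\<Sum>a\<in>UNIV - {0 :: 'f}. 1)"
    using True by (intro sum.cong) (auto elim!: dvdE simp: power_mult tau_power_q1 simp del: One_nat_def)
  also have "\<dots> = of_nat (q - 1)" using card_F by simp
  also have "\<dots> = of_nat q - 1" by (rule of_nat_q1)
  finally show ?thesis using True by simp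
next
  case False
  then have "0 < n mod (q - 1)" by (simp add: dvd_eq_mod_eq_0)
  moreover have "n mod (q - 1) < q - 1" using q_ge_3 by (intro mod_less_divisor) linarith
  ultimately obtain b :: 'f where b: "b \<noteq> 0" "b ^ (n mod (q - 1)) \<noteq> 1" using F_exists_power_ne_1 by blast
  then have bn: "b ^ n \<noteq> 1" using power_mod_eq[OF F_power_q1[OF b(1)]] by metis
  have "(\<Sum>a\<in>UNIV - {0}. tau a ^ n) = (\<Sum>a\<in>UNIV - {0}. tau (b * a) ^ n)"
    by (rule sum.reindex_bij_witness[of _ "\<lambda>x. b * x" "\<lambda>x. x / b"]) (use b in auto)
  also have "\<dots> = tau (b ^ n) * (\<Sum>a\<in>UNIV - {0}. tau a ^ n)"
    by (simp add: tau_mult tau_power power_mult_distrib sum_distrib_left)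
  finally have "(1 - tau (b ^ n)) * (\<Sum>a\<in>UNIV - {0}. tau a ^ n) = 0" by (simp add: algebra_simps)
  then have "(\<Sum>a\<in>UNIV - {0}. tau a ^ n) = 0" using bn tau_inj[of "b ^ n" 1] by auto
  then show ?thesis using False by simp
qed

lemma sum_tau_power_index:
  assumes "b \<noteq> 0"
  shows "(\<Sum>j\<in>{0..q - 2}. tau b ^ j) = (if b = 1 then of_nat q - 1 else 0)"
proof -
  have S: "{0..q - 2} = {..<q - 1}" using q_ge_3 by auto
  show ?thesis
  proof (cases "b = 1")
    case True
    then show ?thesis using S of_nat_q1[where 'a = 'k] by simp
  next
    case False
    then have "tau b \<noteq> 1" using tau_inj[of b 1] by simp
    moreover have "(tau b - 1) * (\<Sum>j<q - 1. tau b ^ j) = tau b ^ (q - 1) - 1"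
      by (rule power_diff_1_eq[symmetric])
    ultimately show ?thesis using False S tau_power_q1[OF assms] by auto
  qed
qed

text \<open>For \<open>t^q = t\<close> this is \<open>dwork_exp\<close> at \<open>t u\<close>. It is
  written with \<open>t\<close> linear in the exponent, so that a product of twists becomes one
  exponential of the same shape.\<close>

definition twist :: "'k \<Rightarrow> 'k fps" where "twist t = fexp (fps_const t * fps_X - fps_const (t / w) * fps_X ^ q)"

lemma twist_nth:
  assumes "t ^ q = t" shows "twist t $ n = dwork_exp $ n * t ^ n"
proof -
  have q0: "q > 0" using q_ge_3 by linarith
  have z: "(fps_X - fps_const (1 / w) * fps_X ^ q) $ 0 = (0::'k)" using p_gt_2 r_pos by simp
  have "dwork_exp oo (fps_const t * fps_X) = fexp ((fps_X - fps_const (1 / w) * fps_X ^ q) oo (fps_const t * fps_X))"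
    unfolding dwork_exp_def by (rule fexp_compose[OF z]) simp
  also have "(fps_X - fps_const (1 / w) * fps_X ^ q) oo (fps_const t * fps_X) = fps_const t * fps_X - fps_const (t / w) * fps_X ^ q"
    using assms by (simp add: fps_compose_sub_distrib fps_compose_mult_distrib flip: fps_compose_power)
      (simp add: power_mult_distrib fps_const_power mult.assoc[symmetric] mult.commute)
  finally have "twist t = dwork_exp oo (fps_const t * fps_X ^ 1)" by (simp add: twist_def)
  then show ?thesis by (simp only: compose_monom_nth[OF zero_less_one]) simp
qed

lemma twist_null:
  assumes "t ^ q = t" "t \<in> pid 0" shows "null (twist t)"
proof (rule W_null[OF _ rate_pos])
  show "twist t \<in> W rate" unfolding W_def
  proof (intro CollectI allI)
    fix n
    have "t ^ n \<in> wid 0 0" using pid_wid[OF pid_power[OF assms(2)], of n 0] by simp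
    moreover have "dwork_exp $ n \<in> wid n (rate * n)" using dwork_exp_W by (auto simp: W_def)
    ultimately have "dwork_exp $ n * t ^ n \<in> wid (n + 0) (rate * n + 0)" by (intro wid_mult)
    then show "twist t $ n \<in> wid n (rate * n)" by (simp add: twist_nth[OF assms(1)])
  qed
qed

text \<open>The factor \<open>p^n\<close> in \<open>e^n\<close> outweighs \<open>n!\<close>, so
  \<open>exp (e u)\<close> can be evaluated at \<open>u = \<pi>\<close>.\<close>

lemma fexp_pid_1_null:
  assumes "e \<in> pid 1" shows "null (fexp (fps_const e * fps_X))"
proof (rule W_null)
  show "fexp (fps_const e * fps_X) \<in> W 1" unfolding W_def
  proof (intro CollectI allI)
    fix n :: nat
    show "fexp (fps_const e * fps_X) $ n \<in> wid n (1 * real n)"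
    proof (cases "n = 0")
      case False
      have en: "e ^ n \<in> pid (int n)"
      proof (induction n)
        case (Suc n)
        from pid_mult[OF assms Suc] show ?case by (simp add: add.commute)
      qed simp
      have "e ^ n * inverse (fact n) \<in> wid (n + 0) ((real p - 1) * real_of_int (int n) + n + - (real n - 1))"
        using False by (intro wid_mult pid_wid' en inverse_fact_wid) auto
      moreover have "1 * real n \<le> (real p - 1) * real_of_int (int n) + n + - (real n - 1)"
        using p_gt_2 mult_right_mono[of 1 "real p - 1" "real n"] by simp
      ultimately show ?thesis by (auto simp: fexp_const_X_nth divide_inverse intro: wid_mono)
    qed simp
  qed
qed simp

text \<open>Additivity of the Dwork character. The sum of the \<open>y i\<close> differs from
  \<open>t\<close> by an \<open>e\<close> divisible by \<open>p\<close>, and the discrepancy is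
  \<open>exp (e u - e u^q / w)\<close>. As \<open>exp (e u)\<close> and \<open>exp (-e u)\<close>
  converge separately, \<open>u^q / w\<close> may be replaced by \<open>u\<close>, after which the
  discrepancy is 1.\<close>

lemma Lam_twist_prod:
  assumes "finite I" and y: "\<And>i. i \<in> I \<Longrightarrow> y i ^ q = y i" "\<And>i. i \<in> I \<Longrightarrow> y i \<in> pid 0"
    and t: "t ^ q = t" "t \<in> pid 0" and e: "(\<Sum>i\<in>I. y i) - t \<in> pid 1"
  shows "Lam \<rho> (\<Prod>i\<in>I. twist (y i)) = Lam \<rho> (twist t)"
proof -
  have q0: "q > 0" using q_ge_3 by linarith
  have z0: "(fps_const (1 / w) * fps_X ^ q) $ 0 = (0::'k)" using p_gt_2 r_pos by simp
  define e where "e = (\<Sum>i\<in>I. y i) - t"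
  define L where "L c = fps_const c * fps_X - fps_const (c / w) * fps_X ^ q" for c :: 'k
  have L0: "L c $ 0 = 0" for c using p_gt_2 r_pos by (simp add: L_def)
  have Ladd: "L (a + b) = L a + L b" for a b
    by (simp add: L_def add_divide_distrib algebra_simps flip: fps_const_add)
  have L00: "L 0 = 0" by (simp add: L_def)
  have Lsum: "L (\<Sum>i\<in>I. y i) = (\<Sum>i\<in>I. L (y i))"
    using \<open>finite I\<close> by (induction I rule: finite_induct) (auto simp: L00 Ladd)
  have "(\<Prod>i\<in>I. twist (y i)) = fexp (\<Sum>i\<in>I. L (y i))"
    unfolding twist_def L_def[symmetric] by (rule fexp_sum[symmetric]) (rule L0)
  also have "\<dots> = fexp (L t + L e)" unfolding Lsum[symmetric] Ladd[symmetric] by (simp add: e_def)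
  also have "\<dots> = twist t * fexp (L e)" unfolding fexp_add[OF L0 L0] by (simp add: twist_def L_def)
  also have "L e = fps_const e * fps_X + - (fps_const (e / w) * fps_X ^ q)" by (simp add: L_def)
  also have "fexp \<dots> = fexp (fps_const e * fps_X) * fexp (- (fps_const (e / w) * fps_X ^ q))"
    using q0 by (intro fexp_add) auto
  also have "- (fps_const (e / w) * fps_X ^ q) = (fps_const (- e) * fps_X) oo (fps_const (1 / w) * fps_X ^ q)"
    unfolding fps_compose_mult_distrib[OF z0] fps_X_fps_compose_startby0[OF z0] fps_const_compose
    by (simp add: mult.assoc[symmetric] flip: fps_const_neg)
  also have "fexp \<dots> = fexp (fps_const (- e) * fps_X) oo (fps_const (1 / w) * fps_X ^ q)"
    using q0 by (intro fexp_compose[symmetric]) auto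
  finally have 1: "(\<Prod>i\<in>I. twist (y i)) = (twist t * fexp (fps_const e * fps_X)) * (fexp (fps_const (- e) * fps_X) oo (fps_const (1 / w) * fps_X ^ q))"
    by (simp add: mult.assoc)
  have "e \<in> pid 1" using assms(6) by (simp add: e_def)
  then have "e \<in> pid 1" "- e \<in> pid 1" by (auto intro: pid_minus)
  then have "Lam \<rho> (\<Prod>i\<in>I. twist (y i)) = Lam \<rho> ((twist t * fexp (fps_const e * fps_X)) * fexp (fps_const (- e) * fps_X))"
    unfolding 1 by (intro Lam_compose null_mult twist_null t fexp_pid_1_null)
  also have "(twist t * fexp (fps_const e * fps_X)) * fexp (fps_const (- e) * fps_X) = twist t"
    using fexp_mult_neg[of "fps_const e * fps_X"] by (simp add: mult.assoc flip: fps_const_neg)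
  finally show ?thesis .
qed

lemma Lam_twist:
  assumes "t ^ q = t" "t \<in> pid 0" "\<rho> > 0" "\<rho> < q - 1"
  shows "Lam \<rho> (twist t) = t ^ \<rho> * gam \<rho>"
proof -
  have tp: "t ^ n = t ^ \<rho>" if "n mod (q - 1) = \<rho>" for n
  proof (cases "t = 0")
    case True
    \<comment> \<open>For \<open>t = 0\<close> only positive exponents occur, since
      \<open>\<rho> > 0\<close>; both powers vanish.\<close>
    have "n \<noteq> 0" using that assms(3) by (cases n) auto
    then show ?thesis using True assms(3) by (simp add: power_0_left)
  next
    case False
    then have "t ^ (q - 1) = 1" using power_q_eq_iff assms(1) by blast
    from power_mod_eq[OF this, of n] show ?thesis using that by simp
  qed
  have "twist t $ n * lam \<rho> n = t ^ \<rho> * (dwork_exp $ n * lam \<rho> n)" for n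
    unfolding twist_nth[OF assms(1)] using tp[of n] by (cases "n mod (q - 1) = \<rho>") (auto simp: lam_def)
  then have "plim (\<lambda>N. \<Sum>n<N. twist t $ n * lam \<rho> n) (t ^ \<rho> * gam \<rho>)"
    unfolding gam_def using plim_cmult[OF Lam_lim[OF dwork_exp_null, of \<rho>], of "t ^ \<rho>"]
    by (simp only: sum_distrib_left)
  then show ?thesis by (rule Lam_eqI)
qed

abbreviation torus :: "nat \<Rightarrow> (nat \<Rightarrow> 'f) set" where "torus n \<equiv> {..<n} \<rightarrow>\<^sub>E (UNIV - {0})"

text \<open>The summand is homogeneous of degree 0, so if \<open>q - 1\<close> does not divide
  \<open>d a\<close> this is \<open>q - 1\<close> times the usual Jacobi sum over tuples with sum 1.
  The exponent is reduced modulo \<open>q - 1\<close> because it is also the index of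
  \<open>gam\<close> in the quotient of Gauss sums.\<close>

definition jacobi :: "nat \<Rightarrow> nat \<Rightarrow> 'k" where
  "jacobi d a = (\<Sum>y\<in>torus d. (\<Prod>i<d. tau (inverse (y i)) ^ a) * tau (\<Sum>i<d. y i) ^ (d * a mod (q - 1)))"

text \<open>Summing twists against \<open>\<omega>^(-a)\<close> isolates \<open>q - 1\<close> times
  the part \<open>Ea\<close> of \<open>dwork_exp\<close> in the class of \<open>a\<close>. The
  \<open>d\<close>-th power of this sum is evaluated once by \<open>Lam_power\<close>, and once by
  expanding it over the torus and merging each product of twists into a single twist.\<close>

theorem gam_jacobi:
  assumes a: "a < q - 1" and \<rho>: "d * a mod (q - 1) \<noteq> 0"
  shows "(of_nat q - 1) ^ d * gam a ^ d * w ^ (d * a div (q - 1)) = gam (d * a mod (q - 1)) * jacobi d a"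
proof -
  define \<rho> where "\<rho> = d * a mod (q - 1)"
  have r0: "\<rho> > 0" "\<rho> < q - 1" using \<rho> q_ge_3 by (auto simp: \<rho>_def)
  define Ea where "Ea = Abs_fps (\<lambda>n. if n mod (q - 1) = a then dwork_exp $ n else 0)"
  have tw: "null (twist (tau y))" for y by (intro twist_null tau_props)
  have class_part: "(\<Sum>y\<in>UNIV - {0}. fps_const (tau (inverse y) ^ a) * twist (tau y)) = fps_const (of_nat q - 1) * Ea"
  proof (rule fps_ext)
    fix n
    have "(\<Sum>y\<in>UNIV - {0}. fps_const (tau (inverse y) ^ a) * twist (tau y)) $ n =
       dwork_exp $ n * (\<Sum>y\<in>UNIV - {0}. tau y ^ (n + (q - 1 - a)))"
      unfolding fps_sum_nth sum_distrib_left
    proof (rule sum.cong)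
      fix y :: 'f assume y: "y \<in> UNIV - {0}"
      have "tau y ^ a * tau y ^ (q - 1 - a) = tau y ^ (q - 1)" using a by (simp flip: power_add)
      then have "tau y ^ a * tau y ^ (q - 1 - a) = 1" using y tau_power_q1 by simp
      then have "inverse (tau y ^ a) = tau y ^ (q - 1 - a)" by (rule inverse_unique)
      then show "(fps_const (tau (inverse y) ^ a) * twist (tau y)) $ n = dwork_exp $ n * tau y ^ (n + (q - 1 - a))"
        by (simp add: twist_nth tau_props tau_inverse power_inverse power_add del: of_nat_power)
    qed simp
    also have "(q - 1) dvd n + (q - 1 - a) \<longleftrightarrow> n mod (q - 1) = a"
    proof -
      have "(q - 1) dvd n + (q - 1 - a) \<longleftrightarrow> [n + (q - 1 - a) = a + (q - 1 - a)] (mod (q - 1))"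
        using a by (simp add: cong_def dvd_eq_mod_eq_0)
      also have "\<dots> \<longleftrightarrow> n mod (q - 1) = a" unfolding cong_add_rcancel_nat using a by (simp add: cong_def)
      finally show ?thesis .
    qed
    then have "dwork_exp $ n * (\<Sum>y\<in>UNIV - {0}. tau y ^ (n + (q - 1 - a))) = (fps_const (of_nat q - 1) * Ea) $ n"
      unfolding sum_tau_power by (simp add: Ea_def)
    finally show "(\<Sum>y\<in>UNIV - {0}. fps_const (tau (inverse y) ^ a) * twist (tau y)) $ n = (fps_const (of_nat q - 1) * Ea) $ n" .
  qed
  have nE: "null Ea" unfolding null_def
  proof
    fix t show "\<forall>\<^sub>F n in sequentially. Ea $ n \<in> wid n t"
      using dwork_exp_null[unfolded null_def, rule_format, of t] by eventually_elim (simp add: Ea_def)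
  qed
  have LE: "Lam a Ea = gam a"
  proof -
    have "(\<lambda>N. \<Sum>n<N. Ea $ n * lam a n) = (\<lambda>N. \<Sum>n<N. dwork_exp $ n * lam a n)"
      by (intro ext sum.cong refl) (simp add: Ea_def lam_def)
    then show ?thesis unfolding gam_def Lam_def by simp
  qed
  have "(fps_const (of_nat q - 1) * Ea) ^ d = (\<Prod>i<d. \<Sum>y\<in>UNIV - {0}. fps_const (tau (inverse y) ^ a) * twist (tau y))"
    unfolding class_part by simp
  also have "\<dots> = (\<Sum>y\<in>torus d. \<Prod>i<d. fps_const (tau (inverse (y i)) ^ a) * twist (tau (y i)))"
    by (rule prod_sum_PiE) auto
  also have "\<dots> = (\<Sum>y\<in>torus d. fps_const (\<Prod>i<d. tau (inverse (y i)) ^ a) * (\<Prod>i<d. twist (tau (y i))))"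
  proof (rule sum.cong)
    have "fps_const (prod f A) = (\<Prod>i\<in>A. fps_const (f i))" for f :: "nat \<Rightarrow> 'k" and A
      by (induction A rule: infinite_finite_induct) (auto simp flip: fps_const_mult)
    then show "(\<Prod>i<d. fps_const (tau (inverse (y i)) ^ a) * twist (tau (y i))) = fps_const (\<Prod>i<d. tau (inverse (y i)) ^ a) * (\<Prod>i<d. twist (tau (y i)))" for y
      by (simp only: prod.distrib)
  qed simp
  finally have "Lam \<rho> ((fps_const (of_nat q - 1) * Ea) ^ d) = (\<Sum>y\<in>torus d. (\<Prod>i<d. tau (inverse (y i)) ^ a) * Lam \<rho> (\<Prod>i<d. twist (tau (y i))))"
    using tw by (simp add: Lam_sum Lam_cmult null_prod null_cmult)
  also have "\<dots> = gam \<rho> * jacobi d a"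
    unfolding jacobi_def sum_distrib_left \<rho>_def[symmetric]
  proof (rule sum.cong)
    fix y
    have "Lam \<rho> (\<Prod>i<d. twist (tau (y i))) = Lam \<rho> (twist (tau (\<Sum>i<d. y i)))"
    proof (rule Lam_twist_prod)
      have "res (\<Sum>i<d. tau (y i)) = res (tau (\<Sum>i<d. y i))" by (simp add: res_sum tau_props)
      then show "(\<Sum>i<d. tau (y i)) - tau (\<Sum>i<d. y i) \<in> pid 1"
        by (subst (asm) res_eq_iff) (auto intro: pid_sum tau_props)
    qed (auto simp: tau_props)
    also have "\<dots> = tau (\<Sum>i<d. y i) ^ \<rho> * gam \<rho>" by (intro Lam_twist tau_props r0)
    finally show "(\<Prod>i<d. tau (inverse (y i)) ^ a) * Lam \<rho> (\<Prod>i<d. twist (tau (y i))) =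
      gam \<rho> * ((\<Prod>i<d. tau (inverse (y i)) ^ a) * tau (\<Sum>i<d. y i) ^ \<rho>)" by simp
  qed simp
  finally have "Lam \<rho> ((fps_const (of_nat q - 1) * Ea) ^ d) = gam \<rho> * jacobi d a" .
  moreover have "(fps_const (of_nat q - 1) * Ea) ^ d = fps_const ((of_nat q - 1) ^ d) * Ea ^ d"
    by (simp add: power_mult_distrib fps_const_power)
  moreover have "Lam \<rho> (fps_const ((of_nat q - 1) ^ d) * Ea ^ d) = (of_nat q - 1) ^ d * Lam \<rho> (Ea ^ d)"
    by (intro Lam_cmult null_power nE)
  moreover have "Lam \<rho> (Ea ^ d) = gam a ^ d * w ^ (d * a div (q - 1))"
    unfolding \<rho>_def LE[symmetric] by (rule Lam_power[OF nE _ a]) (auto simp: Ea_def split: if_splits)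
  ultimately show ?thesis by (simp add: \<rho>_def mult.assoc)
qed

section \<open>The p-adic gamma function\<close>

text \<open>With a generator \<open>g\<close> and half its order \<open>h\<close>, the product is
  \<open>(g^h)^(2h - 1)\<close>. Here \<open>g^h\<close> is a square root of 1 other than 1, and it
  must be \<open>-1\<close> because the odd prime \<open>p\<close> divides at most one of
  \<open>x - 1\<close> and \<open>x + 1\<close>.\<close>

lemma wilson_prime_power:
  assumes "M > 0"
  shows "[(\<Prod>j\<in>totatives (p ^ M). int j) = - 1] (mod int p ^ M)"
proof -
  define m where "m = p ^ M"
  have m1: "m > 2"
  proof -
    have "p ^ 1 \<le> p ^ M" using assms p_gt_2 by (intro power_increasing) auto
    then show ?thesis using p_gt_2 by (simp add: m_def)
  qed
  obtain g where g: "residue_primroot m g"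
    using residue_primroot_odd_prime_power_exists[OF prime_p odd_p] assms unfolding m_def by metis
  have cop: "coprime m g" and ord: "ord m g = totient m" using g by (auto simp: residue_primroot_def)
  have "even (totient m)" using m1 by (intro totient_even) auto
  then obtain h where h: "totient m = 2 * h" by blast
  have h0: "h > 0" using h m1 by (metis gr0I mult_0_right totient_gt_0_iff not_numeral_less_zero)
  define x where "x = int g ^ h"
  have "[g ^ totient m = 1] (mod m)" using cop by (intro euler_theorem) (simp add: coprime_commute)
  then have "[int (g ^ totient m) = int 1] (mod int m)" unfolding cong_int_iff .
  then have x2: "[x ^ 2 = 1] (mod int m)" by (simp add: x_def h flip: power_mult) (simp add: mult.commute)
  have x1: "\<not> [x = 1] (mod int m)"
  proof
    assume "[x = 1] (mod int m)"
    then have "[int (g ^ h) = int 1] (mod int m)" by (simp add: x_def)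
    then have "[g ^ h = 1] (mod m)" unfolding cong_int_iff .
    then have "ord m g dvd h" by (simp add: ord_divides')
    then show False using ord h h0 by (auto dest: dvd_imp_le)
  qed
  have "int p ^ M dvd (x - 1) * (x + 1)"
    using x2 by (simp add: cong_iff_dvd_diff m_def power2_eq_square algebra_simps)
  moreover have "\<not> int p dvd x - 1"
  proof
    assume a: "int p dvd x - 1"
    have "\<not> int p dvd x + 1"
    proof
      assume "int p dvd x + 1"
      then have "int p dvd (x + 1) - (x - 1)" using a by (rule dvd_diff)
      then have "int p \<le> 2" by (intro zdvd_imp_le) auto
      then show False using p_gt_2 by simp
    qed
    then have "coprime (int p ^ M) (x + 1)" using prime_p by (simp add: prime_imp_coprime)
    then have "int p ^ M dvd x - 1" using \<open>int p ^ M dvd (x - 1) * (x + 1)\<close> by (simp add: coprime_dvd_mult_left_iff)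
    then show False using x1 by (simp add: cong_iff_dvd_diff m_def)
  qed
  then have "coprime (int p ^ M) (x - 1)" using prime_p by (simp add: prime_imp_coprime)
  ultimately have "int p ^ M dvd x + 1" by (simp add: coprime_dvd_mult_right_iff)
  then have xm1: "[x = - 1] (mod int m)" by (simp add: cong_iff_dvd_diff m_def)
  have "(\<Prod>j\<in>totatives m. int j) = (\<Prod>i<totient m. int (g ^ i mod m))"
    using m1 by (intro prod.reindex_bij_betw[symmetric] residue_primroot_is_generator g) auto
  also have "[\<dots> = (\<Prod>i<totient m. int (g ^ i))] (mod int m)"
    by (intro cong_prod) (simp add: cong_def zmod_int)
  also have "(\<Prod>i<totient m. int (g ^ i)) = int g ^ (\<Sum>i<totient m. i)" by (simp add: power_sum)
  also have "(\<Sum>i<totient m. i) = h * (totient m - 1)"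
  proof -
    have "2 * (\<Sum>i<n. i) = n * (n - 1)" for n :: nat by (induction n) (auto simp: algebra_simps)
    from this[of "totient m"] show ?thesis unfolding h by simp
  qed
  also have "int g ^ \<dots> = x ^ (totient m - 1)" by (simp add: x_def power_mult)
  also have "[\<dots> = (- 1) ^ (totient m - 1)] (mod int m)" using xm1 by (rule cong_pow)
  also have "(- 1) ^ (totient m - 1) = (- 1 :: int)" using h h0 by (intro neg_one_odd_power) simp
  finally show ?thesis by (simp add: m_def)
qed

lemma gamma_nat_0 [simp]: "gamma_nat p 0 = 1" by (simp add: gamma_nat_def)

lemma gamma_nat_Suc: "gamma_nat p (Suc n) = - (if p dvd n then 1 else int n) * gamma_nat p n"
proof (cases "p dvd n")
  case True
  then have "{j. 0 < j \<and> j < Suc n \<and> \<not> p dvd j} = {j. 0 < j \<and> j < n \<and> \<not> p dvd j}"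
    by (auto simp: less_Suc_eq)
  then show ?thesis using True by (simp add: gamma_nat_def)
next
  case False
  then have "n > 0" by (intro gr0I) auto
  then have "{j. 0 < j \<and> j < Suc n \<and> \<not> p dvd j} = insert n {j. 0 < j \<and> j < n \<and> \<not> p dvd j}"
    using False by (auto simp: less_Suc_eq)
  then show ?thesis using False by (simp add: gamma_nat_def)
qed

text \<open>Wilson's theorem is the case \<open>n = 0\<close>, the odd sign exponent
  \<open>p^M\<close> turning \<open>-1\<close> into 1; the recurrence carries the congruence to all
  \<open>n\<close>.\<close>

lemma gamma_nat_period:
  assumes "M > 0" shows "[gamma_nat p (n + p ^ M) = gamma_nat p n] (mod int p ^ M)"
proof (induction n)
  case 0
  have "{j. 0 < j \<and> j < p ^ M \<and> \<not> p dvd j} = totatives (p ^ M)"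
  proof -
    have cop: "coprime j (p ^ M) \<longleftrightarrow> \<not> p dvd j" for j
    proof
      assume "coprime j (p ^ M)"
      then have "coprime j p" using assms by simp
      then show "\<not> p dvd j" using prime_p by (meson coprime_common_divisor dvd_refl not_prime_unit)
    next
      assume "\<not> p dvd j"
      then have "coprime p j" using prime_p by (simp add: prime_imp_coprime)
      then have "coprime j p" using coprime_commute by blast
      then show "coprime j (p ^ M)" by simp
    qed
    have "p dvd p ^ M" using assms by simp
    then have "j \<le> p ^ M \<and> \<not> p dvd j \<longleftrightarrow> j < p ^ M \<and> \<not> p dvd j" for j by (metis le_less)
    then show ?thesis unfolding totatives_def cop by auto
  qed
  then have "gamma_nat p (p ^ M) = - (\<Prod>j\<in>totatives (p ^ M). int j)"
    using odd_p by (simp add: gamma_nat_def)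
  also have "[\<dots> = - (- 1)] (mod int p ^ M)" unfolding cong_minus_minus_iff by (rule wilson_prime_power[OF assms])
  finally show ?case by simp
next
  case (Suc n)
  have "p dvd n + p ^ M \<longleftrightarrow> p dvd n" using assms by (simp add: dvd_add_left_iff)
  moreover have "[int (n + p ^ M) = int n] (mod int p ^ M)" by (simp add: cong_def)
  ultimately have "[- (if p dvd n + p ^ M then 1 else int (n + p ^ M)) = - (if p dvd n then 1 else int n)] (mod int p ^ M)"
    by (cases "p dvd n") (simp_all only: if_True if_False cong_minus_minus_iff cong_refl)
  from cong_mult[OF this Suc] show ?case unfolding add_Suc gamma_nat_Suc .
qed

lemma gamma_nat_cong:
  assumes "(of_nat m - of_nat n :: 'k) \<in> pid M"
  shows "(of_int (gamma_nat p m) - of_int (gamma_nat p n) :: 'k) \<in> pid M"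
proof (cases "M \<le> 0")
  case True
  have "(of_int (gamma_nat p m) - of_int (gamma_nat p n) :: 'k) \<in> pid 0" by (intro pid_diff) auto
  then show ?thesis using True by (rule pid_mono)
next
  case False
  define K where "K = nat M"
  have K: "K > 0" "M = int K" using False by (auto simp: K_def)
  have period: "[gamma_nat p (n + k * p ^ K) = gamma_nat p n] (mod int p ^ K)" for n k
  proof (induction k)
    case (Suc k)
    have "[gamma_nat p (n + k * p ^ K + p ^ K) = gamma_nat p (n + k * p ^ K)] (mod int p ^ K)"
      by (rule gamma_nat_period[OF K(1)])
    from cong_trans[OF this Suc] show ?case by (simp add: algebra_simps)
  qed simp
  have *: "[gamma_nat p m = gamma_nat p n] (mod int p ^ K)" if "n \<le> m" "(of_nat m - of_nat n :: 'k) \<in> pid (int K)" for m n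
  proof -
    have "(of_int (int m - int n) :: 'k) \<in> pid (int K)" using that by simp
    then have "int p ^ K dvd int m - int n" unfolding of_int_in_pid_iff .
    then have "int (p ^ K) dvd int (m - n)" using that(1) by (simp add: of_nat_diff)
    then have "p ^ K dvd m - n" unfolding int_dvd_int_iff .
    then obtain k where "m - n = p ^ K * k" by blast
    then have "m = n + k * p ^ K" using that(1) by (simp add: mult.commute)
    then show ?thesis using period by blast
  qed
  have "[gamma_nat p m = gamma_nat p n] (mod int p ^ K)"
  proof (cases "n \<le> m")
    case True then show ?thesis using * assms K by blast
  next
    case False
    have "(of_nat n - of_nat m :: 'k) \<in> pid (int K)" using pid_minus[OF assms] K by simp
    then show ?thesis using *[of m n] False by (simp add: cong_sym)
  qed
  then have "int p ^ K dvd gamma_nat p m - gamma_nat p n" by (simp add: cong_iff_dvd_diff)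
  from pid_of_int_dvd[OF this] show ?thesis using K by simp
qed

section \<open>Morita's gamma function on the p-integral rationals\<close>

definition pint :: "rat \<Rightarrow> bool" where "pint x \<longleftrightarrow> (of_rat x :: 'k) \<in> pid 0"

lemma pint_of_nat [simp]: "pint (of_nat n)" by (simp add: pint_def)

lemma pint_1 [simp]: "pint 1" by (simp add: pint_def)

lemma pint_add: "pint x \<Longrightarrow> pint y \<Longrightarrow> pint (x + y)" by (simp add: pint_def of_rat_add pid_add)

lemma pint_diff: "pint x \<Longrightarrow> pint y \<Longrightarrow> pint (x - y)" by (simp add: pint_def of_rat_diff pid_diff)

lemma pint_minus: "pint x \<Longrightarrow> pint (- x)" by (simp add: pint_def of_rat_minus pid_minus)

lemma pint_divide: "pint x \<Longrightarrow> \<not> p dvd d \<Longrightarrow> pint (x / of_nat d)"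
  unfolding pint_def of_rat_divide of_rat_of_nat_eq
  unfolding divide_inverse using pid_mult_int[of "of_rat x" "inverse (of_nat d)" 0] unit_pid[OF unit_inverse[OF unit_of_nat, of d]] by simp

lemma pint_approx:
  assumes "pint x" shows "\<exists>n::nat. n > 0 \<and> (of_nat n - of_rat x :: 'k) \<in> pid (int M)"
proof -
  obtain a b where xk: "of_rat x = (of_int a / of_int b :: 'k)" and b: "b > 0" and pb: "\<not> int p dvd b"
    using assms unfolding pint_def by (rule of_rat_pid_0)
  have "coprime (int p ^ M) b" using pb prime_p by (simp add: prime_imp_coprime)
  then have "coprime b (int p ^ M)" using coprime_commute by blast
  then obtain c where c: "[b * c = 1] (mod int p ^ M)" using cong_solve_coprime_int by blast
  \<comment> \<open>\<open>c\<close> inverts the denominator modulo \<open>p^M\<close>; the summand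
    \<open>p^M\<close> only makes \<open>n\<close> positive.\<close>
  define n where "n = nat ((a * c) mod int p ^ M) + p ^ M"
  have "int n = (a * c) mod int p ^ M + int p ^ M" using p_gt_2 by (simp add: n_def)
  then have "[int n = a * c] (mod int p ^ M)" by (simp add: cong_def)
  then have "[b * int n = b * (a * c)] (mod int p ^ M)" by (rule cong_scalar_left)
  also have "b * (a * c) = a * (b * c)" by simp
  also have "[\<dots> = a * 1] (mod int p ^ M)" using c by (rule cong_scalar_left)
  finally have "int p ^ M dvd b * int n - a" by (simp add: cong_iff_dvd_diff)
  from pid_of_int_dvd[OF this] have 1: "(of_int (b * int n - a) :: 'k) \<in> pid (int M)" .
  have "(of_nat n - of_rat x :: 'k) = inverse (of_int b) * of_int (b * int n - a)"
    using b by (simp add: xk field_simps)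
  also have "\<dots> \<in> pid (int M)" by (intro pid_mult_int 1 unit_pid unit_inverse unit_of_int pb)
  finally show ?thesis using p_gt_2 by (intro exI[of _ n]) (simp add: n_def)
qed

text \<open>The congruences for \<open>gamma_nat\<close> give all approximating sequences the same
  limit, which justifies the definite description in \<open>padic_gamma\<close>.\<close>

lemma padic_gamma_lim:
  assumes x: "pint x" and s: "plim (\<lambda>k. of_nat (s k)) (of_rat x)"
  shows "plim (\<lambda>k. of_int (gamma_nat p (s k))) (padic_gamma p v x)"
proof -
  obtain t :: "nat \<Rightarrow> nat" where t: "\<And>k. t k > 0" "\<And>k. (of_nat (t k) - of_rat x :: 'k) \<in> pid (int k)"
    using pint_approx[OF x] by metis
  have tx: "plim (\<lambda>k. of_nat (t k)) (of_rat x)"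
    using plim_of_pid[OF t(2) filterlim_int_sequentially] by (simp only: plim_0_iff)
  have cong: "plim (\<lambda>k. of_int (gamma_nat p (s k)) - of_int (gamma_nat p (s' k))) 0"
    if "plim (\<lambda>k. of_nat (s k)) (of_rat x)" "plim (\<lambda>k. of_nat (s' k)) (of_rat x)" for s s' :: "nat \<Rightarrow> nat"
    unfolding plim_iff
  proof
    fix M
    have "plim (\<lambda>k. of_nat (s k) - of_nat (s' k)) 0" using plim_diff[OF that] by simp
    from plimD[OF this, of M] show "\<forall>\<^sub>F k in sequentially. of_int (gamma_nat p (s k)) - of_int (gamma_nat p (s' k)) - 0 \<in> pid M"
      by eventually_elim (use gamma_nat_cong in simp)
  qed
  have "\<exists>L. plim (\<lambda>k. of_int (gamma_nat p (t k))) L"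
  proof (rule plim_Cauchy)
    fix M
    have "plim (\<lambda>k. of_nat (t (Suc k))) (of_rat x)" by (rule plim_subseq[OF tx filterlim_Suc])
    from plimD[OF cong[OF this tx], of M]
    show "\<forall>\<^sub>F k in sequentially. of_int (gamma_nat p (t (Suc k))) - of_int (gamma_nat p (t k)) \<in> pid M" by simp
  qed
  then obtain L where L: "plim (\<lambda>k. of_int (gamma_nat p (t k))) L" by blast
  have all: "plim (\<lambda>k. of_int (gamma_nat p (s k))) L" if "plim (\<lambda>k. of_nat (s k)) (of_rat x)" for s
    using plim_add[OF cong[OF that tx] L] by simp
  have "padic_gamma p v x = L"
    unfolding padic_gamma_def
  proof (rule the_equality)
    show "\<forall>s. (\<forall>k. 0 < s k) \<longrightarrow> plim (\<lambda>k. of_nat (s k)) (of_rat x) \<longrightarrow> plim (\<lambda>k. of_int (gamma_nat p (s k))) L"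
      using all by blast
    fix L' assume "\<forall>s. (\<forall>k. 0 < s k) \<longrightarrow> plim (\<lambda>k. of_nat (s k)) (of_rat x) \<longrightarrow> plim (\<lambda>k. of_int (gamma_nat p (s k))) L'"
    then have "plim (\<lambda>k. of_int (gamma_nat p (t k))) L'" using t(1) tx by blast
    then show "L' = L" using L plim_unique by blast
  qed
  then show ?thesis using all[OF s] by simp
qed

abbreviation Gp :: "rat \<Rightarrow> 'k" where "Gp \<equiv> padic_gamma p v"

lemma pint_seq:
  assumes "pint x" obtains s :: "nat \<Rightarrow> nat" where "plim (\<lambda>k. of_nat (s k)) (of_rat x)"
proof -
  obtain t :: "nat \<Rightarrow> nat" where t: "\<And>k. (of_nat (t k) - of_rat x :: 'k) \<in> pid (int k)"
    using pint_approx[OF assms] by metis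
  have "plim (\<lambda>k. of_nat (t k)) (of_rat x)"
    using plim_of_pid[OF t filterlim_int_sequentially] by (simp only: plim_0_iff)
  then show ?thesis using that by blast
qed

lemma Gp_of_nat: "Gp (of_nat n) = of_int (gamma_nat p n)"
proof -
  have "plim (\<lambda>k. of_int (gamma_nat p n)) (Gp (of_nat n))"
    by (rule padic_gamma_lim[of _ "\<lambda>_. n"]) auto
  then show ?thesis using plim_unique plim_const by blast
qed

lemma Gp_0 [simp]: "Gp 0 = 1" using Gp_of_nat[of 0] by simp

lemma Gp_1: "Gp 1 = - 1" using Gp_of_nat[of 1] gamma_nat_Suc[of 0] by simp

lemma unit_Gp: assumes "pint x" shows "unit (Gp x)"
proof -
  obtain s :: "nat \<Rightarrow> nat" where s: "plim (\<lambda>k. of_nat (s k)) (of_rat x)" using pint_seq[OF assms] .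
  show ?thesis by (rule plim_unit[OF padic_gamma_lim[OF assms s] unit_gamma_nat])
qed

lemma Gp_cong:
  assumes x: "pint x" and y: "pint y" and xy: "(of_rat x - of_rat y :: 'k) \<in> pid M"
  shows "Gp x - Gp y \<in> pid M"
proof -
  obtain s :: "nat \<Rightarrow> nat" where s: "plim (\<lambda>k. of_nat (s k)) (of_rat x)" using pint_seq[OF x] .
  obtain t :: "nat \<Rightarrow> nat" where t: "plim (\<lambda>k. of_nat (t k)) (of_rat y)" using pint_seq[OF y] .
  show ?thesis
  proof (rule plim_pid[OF plim_diff[OF padic_gamma_lim[OF x s] padic_gamma_lim[OF y t]]])
    from plimD[OF plim_diff[OF s t], of M]
    show "\<forall>\<^sub>F k in sequentially. of_int (gamma_nat p (s k)) - of_int (gamma_nat p (t k)) \<in> pid M"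
    proof eventually_elim
      case (elim k)
      from pid_add[OF elim xy] show ?case by (intro gamma_nat_cong) simp
    qed
  qed
qed

lemma Gp_continuous:
  assumes "\<And>k. pint (s k)" "pint x" "plim (\<lambda>k. of_rat (s k)) (of_rat x)"
  shows "plim (\<lambda>k. Gp (s k)) (Gp x)"
  unfolding plim_iff
proof
  fix M
  show "\<forall>\<^sub>F k in sequentially. Gp (s k) - Gp x \<in> pid M"
    using plimD[OF assms(3), of M] by eventually_elim (rule Gp_cong[OF assms(1,2)])
qed

lemma Gp_plus_1:
  assumes x: "pint x"
  shows "Gp (x + 1) = - (if of_rat x \<in> pid 1 then 1 else of_rat x) * Gp x"
proof -
  obtain s :: "nat \<Rightarrow> nat" where s: "plim (\<lambda>k. of_nat (s k)) (of_rat x)" using pint_seq[OF x] .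
  have "plim (\<lambda>k. of_nat (s k) + 1) (of_rat x + 1)" by (intro plim_add s plim_const)
  then have s1: "plim (\<lambda>k. of_nat (Suc (s k))) (of_rat (x + 1))" by (simp add: of_rat_add add.commute)
  have 1: "plim (\<lambda>k. of_int (gamma_nat p (Suc (s k)))) (Gp (x + 1))"
    by (rule padic_gamma_lim[OF _ s1]) (use x pint_add in auto)
  have dvd: "\<forall>\<^sub>F k in sequentially. p dvd s k \<longleftrightarrow> of_rat x \<in> pid 1"
    using plimD[OF s, of 1]
  proof eventually_elim
    case (elim k)
    have "p dvd s k \<longleftrightarrow> (of_nat (s k) :: 'k) \<in> pid 1" using of_int_in_pid_iff[of "int (s k)" 1] by simp
    also have "\<dots> \<longleftrightarrow> of_rat x \<in> pid 1"
    proof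
      assume "(of_nat (s k) :: 'k) \<in> pid 1"
      from pid_diff[OF this elim] show "of_rat x \<in> pid 1" by simp
    next
      assume "of_rat x \<in> pid 1"
      from pid_add[OF elim this] show "(of_nat (s k) :: 'k) \<in> pid 1" by simp
    qed
    finally show ?case .
  qed
  have "plim (\<lambda>k. - (if of_rat x \<in> pid 1 then 1 else of_nat (s k)) * of_int (gamma_nat p (s k)))
     (- (if of_rat x \<in> pid 1 then 1 else of_rat x) * Gp x)"
    using s by (intro plim_mult padic_gamma_lim x plim_uminus) auto
  then have "plim (\<lambda>k. of_int (gamma_nat p (Suc (s k)))) (- (if of_rat x \<in> pid 1 then 1 else of_rat x) * Gp x)"
    by (rule plim_cong) (use dvd in eventually_elim, simp add: gamma_nat_Suc)
  then show ?thesis using 1 plim_unique by blast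
qed

text \<open>The product itself is a sign that varies with \<open>x\<close>. Its square is stable
  under \<open>x -> x + 1\<close>, hence constant on the naturals and, by continuity, everywhere.
  The sign disappears in the application, where the square is raised to the power
  \<open>(d-1)/2\<close>.\<close>

lemma Gp_reflection_sq:
  assumes "pint x" shows "(Gp x * Gp (1 - x)) ^ 2 = 1"
proof -
  have nat: "(Gp (of_nat n) * Gp (1 - of_nat n)) ^ 2 = 1" for n
  proof (induction n)
    case 0 then show ?case by (simp add: Gp_1)
  next
    case (Suc n)
    define u :: 'k where "u = (if of_nat n \<in> pid 1 then 1 else of_nat n)"
    have m: "(- of_nat n :: 'k) \<in> pid 1 \<longleftrightarrow> of_nat n \<in> pid 1" by (auto simp: pid_def)
    have 1: "Gp (of_nat (Suc n)) = - u * Gp (of_nat n)"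
      using Gp_plus_1[of "of_nat n"] by (simp add: u_def add.commute)
    have "Gp (- of_nat n + 1) = - (if of_rat (- of_nat n) \<in> pid 1 then 1 else of_rat (- of_nat n)) * Gp (- of_nat n)"
      by (intro Gp_plus_1 pint_minus) simp
    then have 2: "Gp (1 - of_nat n) ^ 2 = u ^ 2 * Gp (- of_nat n) ^ 2"
      using m by (simp add: u_def of_rat_minus power_mult_distrib)
    have e: "1 - of_nat (Suc n) = (- of_nat n :: rat)" by simp
    show ?case unfolding e 1 using Suc 2 by (simp add: power_mult_distrib algebra_simps)
  qed
  obtain s :: "nat \<Rightarrow> nat" where s: "plim (\<lambda>k. of_nat (s k)) (of_rat x)" using pint_seq[OF assms] .
  have "plim (\<lambda>k. Gp (of_nat (s k))) (Gp x)" using s assms by (intro Gp_continuous) auto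
  moreover have "plim (\<lambda>k. Gp (1 - of_nat (s k))) (Gp (1 - x))"
    using plim_diff[OF plim_const s] assms by (intro Gp_continuous pint_diff) (auto simp: of_rat_diff)
  ultimately have "plim (\<lambda>k. (Gp (of_nat (s k)) * Gp (1 - of_nat (s k))) ^ 2) ((Gp x * Gp (1 - x)) ^ 2)"
    by (intro plim_power plim_mult)
  then show ?thesis unfolding nat using plim_unique plim_const by blast
qed

text \<open>Passing from \<open>n\<close> to \<open>n + 1\<close> trades the factor at
  \<open>n / d\<close> for the one at \<open>n / d + 1\<close>. The functional equation contributes
  \<open>-n / d\<close> on the left and \<open>-n\<close> on the right; the discrepancy
  \<open>d\<close> arises just when \<open>p\<close> does not divide \<open>n\<close>, whence the
  exponent of \<open>d\<close>.\<close>

lemma Gp_multiplication_nat: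
  assumes d: "d > 0" "\<not> p dvd d"
  shows "(\<Prod>h<d. Gp ((of_nat n + of_nat h) / of_nat d)) * of_nat d ^ card {i. i < n \<and> \<not> p dvd i}
     = (\<Prod>h<d. Gp (of_nat h / of_nat d)) * Gp (of_nat n)"
proof (induction n)
  case 0 then show ?case by simp
next
  case (Suc n)
  define g where "g h = Gp ((of_nat n + of_nat h) / of_nat d)" for h
  define u :: 'k where "u = (if p dvd n then 1 else of_nat n)"
  have pn: "(of_nat n :: 'k) \<in> pid 1 \<longleftrightarrow> p dvd n" using of_int_in_pid_iff[of "int n" 1] by simp
  have ud: "unit (of_nat d :: 'k)" using d by (intro unit_of_nat)
  then have dnz: "(of_nat d :: 'k) \<noteq> 0" and vd: "v (of_nat d) = 0" by (auto simp: unit_def)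
  have pnd: "(of_nat n / of_nat d :: 'k) \<in> pid 1 \<longleftrightarrow> p dvd n"
    unfolding pn[symmetric] using dnz vd by (cases "n = 0") (auto simp: pid_def v_divide)
  have cop: "pint (of_nat n / of_nat d)" using d by (intro pint_divide) auto
  have gd: "g d = - (if p dvd n then 1 else of_nat n / of_nat d) * g 0"
  proof -
    have "g d = Gp (of_nat n / of_nat d + 1)" using d by (simp add: g_def add_divide_distrib)
    then show ?thesis using Gp_plus_1[OF cop] pnd by (simp add: g_def of_rat_divide)
  qed
  have c: "of_nat d ^ card {i. i < Suc n \<and> \<not> p dvd i} = of_nat d ^ card {i. i < n \<and> \<not> p dvd i} * (if p dvd n then 1 else of_nat d :: 'k)"
  proof (cases "p dvd n")
    case True
    then have "{i. i < Suc n \<and> \<not> p dvd i} = {i. i < n \<and> \<not> p dvd i}" by (auto simp: less_Suc_eq)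
    then show ?thesis using True by simp
  next
    case False
    then have "{i. i < Suc n \<and> \<not> p dvd i} = insert n {i. i < n \<and> \<not> p dvd i}" by (auto simp: less_Suc_eq)
    then show ?thesis using False by simp
  qed
  have u: "Gp (of_nat (Suc n)) = - u * Gp (of_nat n)"
    using Gp_plus_1[of "of_nat n"] pn by (simp add: u_def add.commute)
  have gS: "Gp ((of_nat (Suc n) + of_nat h) / of_nat d) = g (Suc h)" for h by (simp add: g_def algebra_simps)
  have g0: "g 0 \<noteq> 0" using unit_Gp[OF cop] by (simp add: g_def unit_def)
  have "g 0 * (\<Prod>h<d. g (Suc h)) = (\<Prod>h<d. g h) * g d"
    using prod.lessThan_Suc_shift[of g d] by simp
  also have "\<dots> = g 0 * (- (if p dvd n then 1 else of_nat n / of_nat d) * (\<Prod>h<d. g h))" unfolding gd by simp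
  finally have "(\<Prod>h<d. g (Suc h)) = - (if p dvd n then 1 else of_nat n / of_nat d) * (\<Prod>h<d. g h)"
    unfolding mult_left_cancel[OF g0] .
  then show ?case unfolding gS c u using Suc[folded g_def] dnz by (simp add: u_def)
qed

lemma card_not_dvd_less_Suc: "card {i. i < Suc m \<and> \<not> p dvd i} = m - m div p"
proof -
  have "card {i. i < Suc m \<and> \<not> p dvd i} + m div p = m"
  proof (induction m)
    case 0
    have "{i. i < Suc 0 \<and> \<not> p dvd i} = {}" by (auto intro!: gr0I)
    then show ?case by (simp only: card.empty) simp
  next
    case (Suc m)
    show ?case
    proof (cases "p dvd Suc m")
      case True
      then have "{i. i < Suc (Suc m) \<and> \<not> p dvd i} = {i. i < Suc m \<and> \<not> p dvd i}" by (auto simp: less_Suc_eq)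
      moreover have "Suc m div p = Suc (m div p)" using True by (simp add: div_Suc dvd_eq_mod_eq_0)
      ultimately show ?thesis using Suc by simp
    next
      case False
      then have "{i. i < Suc (Suc m) \<and> \<not> p dvd i} = insert (Suc m) {i. i < Suc m \<and> \<not> p dvd i}" by (auto simp: less_Suc_eq)
      moreover have "Suc m div p = m div p" using False by (simp add: div_Suc dvd_eq_mod_eq_0)
      ultimately show ?thesis using Suc by simp
    qed
  qed
  then show ?thesis by simp
qed

section \<open>The Gross-Koblitz formula\<close>

text \<open>Multiplication by \<open>p^k\<close> rotates the \<open>r\<close> base-\<open>p\<close> digits of \<open>a\<close>, which is why the integral part of
\<open>a p^k / (q - 1)\<close> is a quotient by a power of \<open>p\<close>.\<close>

definition fl :: "nat \<Rightarrow> nat \<Rightarrow> nat" where "fl a k = a div p ^ (r - k)"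

definition fr :: "nat \<Rightarrow> nat \<Rightarrow> rat" where
  "fr a k = of_nat a * of_nat p ^ k / (of_nat q - 1) - of_nat (fl a k)"

lemma q_rat_pos: "(of_nat q - 1 :: rat) > 0"
proof -
  have "(of_nat q :: rat) \<ge> of_nat 3" unfolding of_nat_le_iff by (rule q_ge_3)
  then show ?thesis by linarith
qed

text \<open>With \<open>a = c p^(r-k) + b\<close> one has
  \<open>a p^k = c (q-1) + (c + b p^k)\<close>, where \<open>c + b p^k\<close> is the number with
  rotated digits. It lies strictly between 0 and \<open>q - 1\<close> because the digits of
  \<open>a\<close> are neither all 0 nor all \<open>p - 1\<close>.\<close>

lemma fr_bounds:
  assumes a: "0 < a" "a < q - 1" and k: "k < r"
  shows "0 < fr a k" "fr a k < 1"
proof -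
  define c where "c = a div p ^ (r - k)"
  define b where "b = a mod p ^ (r - k)"
  have qk: "q = p ^ (r - k) * p ^ k" using k by (simp flip: power_add)
  have ab: "a = c * p ^ (r - k) + b" unfolding c_def b_def by (rule div_mult_mod_eq[symmetric])
  have b: "b < p ^ (r - k)" using p_gt_2 by (simp add: b_def)
  have c: "c < p ^ k"
  proof -
    have "a < p ^ k * p ^ (r - k)" using a qk by (simp add: mult.commute)
    then show ?thesis unfolding c_def by (rule less_mult_imp_div_less)
  qed
  have eq: "a * p ^ k = c * q + b * p ^ k" unfolding ab qk by (simp add: algebra_simps)
  have lt: "c + b * p ^ k < q - 1"
  proof (rule ccontr)
    assume "\<not> ?thesis"
    then have ge: "c + b * p ^ k \<ge> q - 1" by simp
    have "b + 1 \<le> p ^ (r - k)" using b by simp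
    then have "(b + 1) * p ^ k \<le> q" unfolding qk by (rule mult_le_mono1)
    then have 1: "b * p ^ k + p ^ k \<le> q" by simp
    \<comment> \<open>Equality forces every digit of \<open>b\<close> and \<open>c\<close> to be
      \<open>p - 1\<close>, that is \<open>a = q - 1\<close>.\<close>
    then have c1: "c + 1 = p ^ k" "b * p ^ k + p ^ k = q" using ge c by linarith+
    then have "(b + 1) * p ^ k = p ^ (r - k) * p ^ k" using qk by simp
    moreover have "p ^ k \<noteq> 0" using p_gt_2 by simp
    ultimately have "b + 1 = p ^ (r - k)" using mult_right_cancel by blast
    then have "a + 1 = (c + 1) * p ^ (r - k)" unfolding ab by simp
    also have "\<dots> = q" unfolding c1 qk by (rule mult.commute)
    finally show False using a by simp
  qed
  have pos: "c + b * p ^ k > 0"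
  proof (rule ccontr)
    assume "\<not> ?thesis"
    then have "c = 0" "b = 0" using p_gt_2 by auto
    then show False using ab a by simp
  qed
  have "(of_nat (a * p ^ k) :: rat) = of_nat (c * q + b * p ^ k)" unfolding eq ..
  then have "of_nat a * of_nat p ^ k = of_nat c * of_nat q + (of_nat b * of_nat p ^ k :: rat)" by simp
  then have "fr a k * (of_nat q - 1) = of_nat c + of_nat b * of_nat p ^ k"
  proof -
    assume h: "of_nat a * of_nat p ^ k = of_nat c * of_nat q + (of_nat b * of_nat p ^ k :: rat)"
    have "of_nat a * of_nat p ^ k / (of_nat q - 1) * (of_nat q - 1) = (of_nat a * of_nat p ^ k :: rat)"
      unfolding times_divide_eq_left
      by (rule nonzero_mult_div_cancel_right) (use q_rat_pos in linarith)
    then show ?thesis unfolding fr_def fl_def c_def[symmetric] left_diff_distrib h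
      by (simp add: algebra_simps del: of_nat_power)
  qed
  then have e: "fr a k * (of_nat q - 1) = of_nat (c + b * p ^ k)" by simp
  have "0 < fr a k * (of_nat q - 1)" unfolding e using pos by (simp only: of_nat_0_less_iff)
  then show "0 < fr a k" using q_rat_pos by (simp add: zero_less_mult_iff)
  have "of_nat (c + b * p ^ k) < (of_nat (q - 1) :: rat)" using lt by (simp only: of_nat_less_iff)
  also have "(of_nat (q - 1) :: rat) = of_nat q - 1" by (rule of_nat_q1)
  finally have "fr a k * (of_nat q - 1) < 1 * (of_nat q - 1)" unfolding e by simp
  then show "fr a k < 1" using q_rat_pos by (simp add: mult_less_cancel_right_pos)
qed

lemma floor_fr:
  assumes "0 < a" "a < q - 1" "k < r"
  shows "\<lfloor>of_nat a * of_nat p ^ k / (of_nat q - 1) :: rat\<rfloor> = int (fl a k)"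
    and "frac (of_nat a * of_nat p ^ k / (of_nat q - 1) :: rat) = fr a k"
proof -
  have "of_nat a * of_nat p ^ k / (of_nat q - 1) = fr a k + of_nat (fl a k)" by (simp add: fr_def)
  moreover have "\<lfloor>fr a k\<rfloor> = 0" using fr_bounds[OF assms] by (simp add: floor_eq_iff)
  ultimately show *: "\<lfloor>of_nat a * of_nat p ^ k / (of_nat q - 1) :: rat\<rfloor> = int (fl a k)" by simp
  show "frac (of_nat a * of_nat p ^ k / (of_nat q - 1) :: rat) = fr a k"
    unfolding frac_def * by (simp add: fr_def)
qed

lemma of_rat_kap: "of_rat (of_nat a * of_nat p ^ k / (of_nat q - 1)) = kap a * of_nat p ^ k"
  by (simp add: kap_def of_rat_divide of_rat_mult of_rat_diff of_rat_power)

lemma pint_fr: "pint (fr a k)"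
  unfolding fr_def pint_def of_rat_diff of_rat_kap of_rat_of_nat_eq
  by (intro pid_diff pid_of_nat) (metis kap_pid mult.commute pid_mult_int pid_of_nat of_nat_power)

text \<open>A shift by \<open>r - k\<close> digits, read as no shift for \<open>k = 0\<close>, so
  that the index is the \<open>k\<close> of \<open>mcG\<close> while the shifts run through
  \<open>0..r-1\<close>.\<close>

definition mseq :: "nat \<Rightarrow> nat \<Rightarrow> nat \<Rightarrow> nat" where
  "mseq a N k = nseq a (Suc N) div p ^ ((r - k) mod r)"

lemma nseq_div:
  assumes "i \<le> r" shows "nseq a (Suc N) div p ^ i = p ^ (r - i) * nseq a N + a div p ^ i"
proof -
  have "q = p ^ i * p ^ (r - i)" using assms by (simp flip: power_add)
  then have "nseq a (Suc N) = a + p ^ i * (p ^ (r - i) * nseq a N)" unfolding nseq_Suc by simp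
  then show ?thesis using p_gt_2 by (simp only: div_mult_self2) simp
qed

text \<open>The sum of \<open>mseq a N k\<close> and \<open>fr a k\<close> is
  \<open>p^k (nseq a N + \<kappa>)\<close> for \<open>k > 0\<close> and
  \<open>nseq a (Suc N) + \<kappa>\<close> for \<open>k = 0\<close>, both divisible by
  \<open>p^N\<close>.\<close>

lemma mseq_lim:
  assumes "k < r" "a < q"
  shows "plim (\<lambda>N. of_nat (mseq a N k)) (- of_rat (fr a k))"
proof (rule plim_of_pid[THEN plim_0_iff[THEN iffD1]])
  fix N
  show "of_nat (mseq a N k) - - of_rat (fr a k) \<in> pid (int N)"
  proof (cases "k = 0")
    case True
    have "of_nat (nseq a (Suc N)) + kap a \<in> pid (int (Suc N))" by (rule nseq_kap_pid)
    then have "of_nat (nseq a (Suc N)) + kap a \<in> pid (int N)" by (rule pid_mono) simp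
    moreover have "mseq a N k = nseq a (Suc N)" using True r_pos by (simp add: mseq_def)
    moreover have "of_rat (fr a k) = kap a"
      using of_rat_kap[of a 0] True assms by (simp add: fr_def fl_def)
    ultimately show ?thesis by simp
  next
    case False
    then have "(r - k) mod r = r - k" using assms by simp
    then have "mseq a N k = p ^ k * nseq a N + fl a k"
      using assms by (simp add: mseq_def nseq_div fl_def)
    moreover have "of_rat (fr a k) = kap a * of_nat p ^ k - of_nat (fl a k)"
      unfolding fr_def of_rat_diff of_rat_kap by simp
    ultimately have "of_nat (mseq a N k) - - of_rat (fr a k) = of_nat (p ^ k) * (of_nat (nseq a N) + kap a)"
      by (simp add: algebra_simps)
    also have "\<dots> \<in> pid (int N)" by (intro pid_mult_int nseq_kap_pid pid_of_nat)
    finally show ?thesis .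
  qed
qed (rule filterlim_int_sequentially)

lemma Suc_mseq_lim:
  assumes "k < r" "a < q"
  shows "plim (\<lambda>N. of_nat (Suc (mseq a N k))) (of_rat (1 - fr a k))"
  using plim_add[OF mseq_lim[OF assms] plim_const[of 1]] by (simp add: of_rat_diff add.commute)

lemma gamma_mseq_lim:
  assumes "k < r" "a < q"
  shows "plim (\<lambda>N. of_int (gamma_nat p (Suc (mseq a N k)))) (Gp (1 - fr a k))"
  by (rule padic_gamma_lim[OF _ Suc_mseq_lim[OF assms]]) (intro pint_diff pint_fr pint_1)

lemma diff_mod_involution: "i < r \<Longrightarrow> (r - (r - i) mod r) mod r = i"
  by (cases "i = 0") auto

lemma mseq_reindex_prod: "(\<Prod>i<r. f (nseq a (Suc N) div p ^ i)) = (\<Prod>k<r. f (mseq a N k))"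
  unfolding mseq_def
  by (rule prod.reindex_bij_witness[of _ "\<lambda>k. (r - k) mod r" "\<lambda>k. (r - k) mod r"])
    (use r_pos diff_mod_involution in auto)

lemma mseq_reindex_sum: "(\<Sum>i<r. f (nseq a (Suc N) div p ^ i)) = (\<Sum>k<r. f (mseq a N k))"
  unfolding mseq_def
  by (rule sum.reindex_bij_witness[of _ "\<lambda>k. (r - k) mod r" "\<lambda>k. (r - k) mod r"])
    (use r_pos diff_mod_involution in auto)

text \<open>\<open>fact_split\<close> applied to the successive quotients
  \<open>n div p^i\<close>.\<close>

lemma fact_iter:
  "(fact n :: int) = int p ^ (\<Sum>i<t. n div p ^ Suc i) * (- 1) ^ (\<Sum>i<t. Suc (n div p ^ i)) *
     (\<Prod>i<t. gamma_nat p (Suc (n div p ^ i))) * fact (n div p ^ t)"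
proof (induction t)
  case (Suc t)
  have "(fact (n div p ^ t) :: int) = int p ^ (n div p ^ Suc t) * fact (n div p ^ Suc t) * ((- 1) ^ Suc (n div p ^ t) * gamma_nat p (Suc (n div p ^ t)))"
    by (subst fact_split) (simp add: div_mult2_eq[symmetric] mult.commute)
  then show ?case by (subst Suc) (simp add: power_add algebra_simps)
qed simp

text \<open>For \<open>a < q\<close> this is the p-adic valuation of \<open>a!\<close> by Legendre's
  formula; up to a unit the Gauss sum is \<open>\<pi>^a\<close> divided by this power of
  \<open>-p\<close>.\<close>

definition Vp :: "nat \<Rightarrow> nat" where "Vp a = (\<Sum>k<r. fl a k)"

text \<open>For \<open>0 < a < q - 1\<close> the arguments are the fractional parts of
  \<open>-a p^k / (q-1)\<close>, as in the Gross-Koblitz formula.\<close>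

definition GP :: "nat \<Rightarrow> 'k" where "GP a = (\<Prod>k<r. Gp (1 - fr a k))"

lemma unit_GP: "unit (GP a)"
proof -
  have "unit (\<Prod>k\<in>A. Gp (1 - fr a k))" for A
    by (induction A rule: infinite_finite_induct) (auto intro!: unit_mult unit_Gp pint_diff pint_fr)
  then show ?thesis by (simp add: GP_def)
qed

lemma sum_nseq_div: "(\<Sum>i<r. nseq a (Suc N) div p ^ Suc i) = repunit r * nseq a N + Vp a"
proof -
  have "(\<Sum>i<r. nseq a (Suc N) div p ^ Suc i) = (\<Sum>i<r. p ^ (r - Suc i) * nseq a N + fl a (r - Suc i))"
  proof (rule sum.cong)
    fix i assume i: "i \<in> {..<r}"
    then have "r - (r - Suc i) = Suc i" by auto
    then show "nseq a (Suc N) div p ^ Suc i = p ^ (r - Suc i) * nseq a N + fl a (r - Suc i)"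
      using i by (simp only: fl_def nseq_div Suc_leI lessThan_iff)
  qed simp
  also have "\<dots> = (\<Sum>k<r. p ^ k * nseq a N + fl a k)" by (rule sum.nat_diff_reindex)
  also have "\<dots> = repunit r * nseq a N + Vp a" by (simp add: sum.distrib repunit_def Vp_def sum_distrib_right)
  finally show ?thesis .
qed

lemma sum_nseq_shift: "(\<Sum>i<r. nseq a (Suc N) div p ^ i) + nseq a N = nseq a (Suc N) + (\<Sum>i<r. nseq a (Suc N) div p ^ Suc i)"
  if "a < q"
proof -
  have "(\<Sum>i<Suc r. nseq a (Suc N) div p ^ i) = nseq a (Suc N) + (\<Sum>i<r. nseq a (Suc N) div p ^ Suc i)"
    by (subst sum.lessThan_Suc_shift) simp
  moreover have "nseq a (Suc N) div p ^ r = nseq a N" using that by (simp add: nseq_div)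
  ultimately show ?thesis by simp
qed

text \<open>\<open>fact_iter\<close> with \<open>t = r\<close> reduces the factorial of
  \<open>nseq a (Suc N)\<close> to that of \<open>nseq a N\<close>, since dividing by
  \<open>q\<close> removes the last base-\<open>q\<close> digit. The ratio in
  \<open>gam_fact_lim\<close> thus becomes a constant sign and power of \<open>-p\<close> over a
  product of gamma values that tends to \<open>GP a\<close>.\<close>

theorem gross_koblitz:
  assumes a: "0 < a" "a < q - 1"
  shows "(1 - of_nat q) * gam a * (- of_nat p) ^ Vp a * GP a = (- 1) ^ (r + a)"
proof -
  have aq: "a < q" using a by linarith
  define T where "T N = w ^ nseq a N * fact (nseq a N) / fact (nseq a (Suc N))" for N
  define G where "G N = (\<Prod>k<r. of_int (gamma_nat p (Suc (mseq a N k))) :: 'k)" for N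
  have TG: "T N * (- of_nat p) ^ Vp a * G N = (- 1) ^ (r + a)" for N
  proof -
    define n1 where "n1 = nseq a (Suc N)"
    define n0 where "n0 = nseq a N"
    define S where "S = repunit r * n0 + Vp a"
    have div_r: "n1 div p ^ r = n0" using aq by (simp add: n1_def n0_def nseq_div)
    have Sd: "(\<Sum>i<r. n1 div p ^ Suc i) = S" unfolding n1_def S_def n0_def by (rule sum_nseq_div)
    have "(fact n1 :: 'k) = of_int (fact n1)" by simp
    also have "\<dots> = of_int (int p ^ S * (- 1) ^ (\<Sum>i<r. Suc (n1 div p ^ i)) * (\<Prod>i<r. gamma_nat p (Suc (n1 div p ^ i))) * fact n0)"
      using fact_iter[of n1 r] unfolding div_r Sd by presburger
    also have "\<dots> = of_nat p ^ S * (- 1) ^ (\<Sum>i<r. Suc (n1 div p ^ i)) * G N * fact n0"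
      using mseq_reindex_prod[of "\<lambda>m. of_int (gamma_nat p (Suc m)) :: 'k" a N] by (simp add: n1_def G_def)
    finally have f: "(fact n1 :: 'k) = of_nat p ^ S * (- 1) ^ (\<Sum>i<r. Suc (n1 div p ^ i)) * G N * fact n0" .
    \<comment> \<open>Parity of the sign exponent: shifting the sum by one step leaves the boundary
      terms \<open>n1\<close> and \<open>n0\<close>, and \<open>n1 = q n0 + a\<close> with
      \<open>q\<close> odd makes \<open>n0\<close> cancel.\<close>
    have "(\<Sum>i<r. Suc (n1 div p ^ i)) + n0 = r + n1 + S"
      using sum_nseq_shift[OF aq, of N, folded n1_def n0_def] unfolding sum_Suc Sd by simp
    moreover have "n1 = q * n0 + a" by (simp add: n1_def n0_def nseq_Suc)
    ultimately have "(\<Sum>i<r. Suc (n1 div p ^ i)) + n0 = r + a + S + q * n0" by simp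
    moreover have "odd q" by (rule odd_q)
    ultimately have "even (\<Sum>i<r. Suc (n1 div p ^ i)) \<longleftrightarrow> even (r + a + S)" by (metis even_add even_mult_iff)
    then have sg: "(- 1 :: 'k) ^ (\<Sum>i<r. Suc (n1 div p ^ i)) = (- 1) ^ (r + a + S)"
      by (simp add: minus_one_power_iff del: of_nat_sum sum.lessThan_Suc)
    have Gnz: "G N \<noteq> 0" unfolding G_def using unit_gamma_nat by (simp add: unit_def)
    have "(of_nat p :: 'k) ^ S * (- 1) ^ S = (- of_nat p) ^ S" by (simp flip: power_mult_distrib)
    also have "\<dots> = w ^ n0 * (- of_nat p) ^ Vp a" by (simp add: S_def w_def power_add power_mult)
    finally have pS: "(of_nat p :: 'k) ^ S * (- 1) ^ S = w ^ n0 * (- of_nat p) ^ Vp a" .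
    have "(fact n1 :: 'k) = ((of_nat p :: 'k) ^ S * (- 1) ^ S) * (- 1) ^ (r + a) * G N * fact n0"
      unfolding f sg by (simp add: power_add)
    then have f2: "(fact n1 :: 'k) = w ^ n0 * (- of_nat p) ^ Vp a * (- 1) ^ (r + a) * G N * fact n0"
      unfolding pS .
    have sq: "(- 1 :: 'k) ^ (r + a) * (- 1) ^ (r + a) = 1" by (simp flip: power_mult_distrib)
    have "T N * (fact n1 :: 'k) = w ^ n0 * fact n0" by (simp add: T_def n1_def n0_def)
    then have "(w ^ n0 * fact n0) * (T N * (- of_nat p) ^ Vp a * G N * (- 1) ^ (r + a)) = (w ^ n0 * fact n0) * 1"
      unfolding f2 by (simp add: algebra_simps)
    then have "T N * (- of_nat p) ^ Vp a * G N * (- 1) ^ (r + a) = 1"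
      unfolding mult_left_cancel[OF no_zero_divisors[OF power_not_zero[OF w_nz] fact_nonzero]] .
    then have "T N * (- of_nat p) ^ Vp a * G N * ((- 1) ^ (r + a) * (- 1) ^ (r + a)) = (- 1) ^ (r + a)"
      by (metis mult.assoc mult_1)
    then show ?thesis unfolding sq by simp
  qed
  have "plim T ((1 - of_nat q) * gam a)" unfolding T_def by (rule gam_fact_lim[OF a])
  moreover have "plim G (GP a)" unfolding G_def GP_def by (intro plim_prod gamma_mseq_lim aq) simp
  ultimately have "plim (\<lambda>N. T N * (- of_nat p) ^ Vp a * G N) ((1 - of_nat q) * gam a * (- of_nat p) ^ Vp a * GP a)"
    by (intro plim_mult plim_const)
  then show ?thesis unfolding TG using plim_unique plim_const by blast
qed

lemma res_of_nat: "res (of_nat n) = of_nat n"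
  by (induction n) (auto simp: res_add res_1)

lemma power_q_lim:
  assumes "x \<in> pid 0" shows "plim (\<lambda>N. x ^ (q ^ N)) (tau (res x))"
proof (rule plim_of_pid[THEN plim_0_iff[THEN iffD1]])
  define t where "t = tau (res x)"
  have tN: "t ^ (q ^ N) = t" for N
    by (induction N) (simp_all add: power_mult t_def tau_props(2) mult.commute[of q])
  fix N
  have "x ^ (q ^ N) - t ^ (q ^ N) \<in> pid (1 + int N)"
  proof (induction N)
    case 0
    then show ?case using res_eq_iff[OF assms tau_props(1), of "res x"] by (simp add: t_def tau_props(3))
  next
    case (Suc N)
    have "(x ^ (q ^ N)) ^ q - (t ^ (q ^ N)) ^ q \<in> pid (1 + int N + 1)"
      using Suc assms by (intro power_q_cong_pid pid_power) (auto simp: t_def tau_props)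
    then show ?case by (simp add: mult.commute add_ac flip: power_mult)
  qed
  then have "x ^ (q ^ N) - t \<in> pid (1 + int N)" unfolding tN .
  then show "x ^ (q ^ N) - tau (res x) \<in> pid (int N)" unfolding t_def by (rule pid_mono) simp
qed (rule filterlim_int_sequentially)

text \<open>Gauss's multiplication formula, multiplied over the \<open>r\<close> digit rotations. At
  the arguments given by \<open>mseq a N k\<close> the exponents of \<open>d\<close> telescope to
  \<open>nseq a (Suc N) - nseq a N = q^N a\<close>, and \<open>d^(q^N)\<close> tends to the
  Teichmueller representative of \<open>d\<close>.\<close>

lemma Gp_multiplication:
  assumes d: "d > 0" "\<not> p dvd d" and a: "a < q"
  shows "(\<Prod>k<r. \<Prod>h<d. Gp ((1 - fr a k + of_nat h) / of_nat d)) * tau (of_nat d) ^ a =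
    (\<Prod>h<d. Gp (of_nat h / of_nat d)) ^ r * GP a"
proof -
  define H where "H = (\<Prod>h<d. Gp (of_nat h / of_nat d))"
  define P where "P N k = (\<Prod>h<d. Gp ((of_nat (Suc (mseq a N k)) + of_nat h) / of_nat d))" for N k
  have step: "(\<Prod>k<r. P N k) * (of_nat d ^ (q ^ N)) ^ a = H ^ r * (\<Prod>k<r. of_int (gamma_nat p (Suc (mseq a N k))))" for N
  proof -
    have "P N k * of_nat d ^ (mseq a N k - mseq a N k div p) = H * of_int (gamma_nat p (Suc (mseq a N k)))" for k
      using Gp_multiplication_nat[OF d, of "Suc (mseq a N k)"]
      unfolding P_def H_def Gp_of_nat card_not_dvd_less_Suc .
    then have "(\<Prod>k<r. P N k * of_nat d ^ (mseq a N k - mseq a N k div p)) = (\<Prod>k<r. H * of_int (gamma_nat p (Suc (mseq a N k))))"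
      by simp
    then have "(\<Prod>k<r. P N k) * of_nat d ^ (\<Sum>k<r. mseq a N k - mseq a N k div p) = H ^ r * (\<Prod>k<r. of_int (gamma_nat p (Suc (mseq a N k))))"
      by (simp add: prod.distrib power_sum)
    also have "(\<Sum>k<r. mseq a N k - mseq a N k div p) = (\<Sum>i<r. nseq a (Suc N) div p ^ i - nseq a (Suc N) div p ^ i div p)"
      by (rule mseq_reindex_sum[symmetric])
    also have "\<dots> = (\<Sum>i<r. nseq a (Suc N) div p ^ i - nseq a (Suc N) div p ^ Suc i)"
      by (simp add: div_mult2_eq[symmetric] mult.commute)
    also have "\<dots> = (\<Sum>i<r. nseq a (Suc N) div p ^ i) - (\<Sum>i<r. nseq a (Suc N) div p ^ Suc i)"
      using p_gt_2 by (intro sum_subtractf_nat div_le_mono2 power_increasing) auto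
    also have "\<dots> = nseq a (Suc N) - nseq a N" using sum_nseq_shift[OF a, of N] by linarith
    also have "\<dots> = q ^ N * a" by (simp add: nseq_def algebra_simps)
    finally show ?thesis by (simp add: H_def power_mult)
  qed
  have "plim (\<lambda>N. (\<Prod>k<r. P N k) * (of_nat d ^ (q ^ N)) ^ a)
     ((\<Prod>k<r. \<Prod>h<d. Gp ((1 - fr a k + of_nat h) / of_nat d)) * tau (res (of_nat d)) ^ a)"
    unfolding P_def
  proof (intro plim_mult plim_prod plim_power power_q_lim pid_of_nat Gp_continuous)
    fix k h assume k: "k \<in> {..<r}"
    show "pint ((1 - fr a k + of_nat h) / of_nat d)"
      by (intro pint_divide pint_add pint_diff pint_fr d) auto
    have "pint ((of_nat (Suc (mseq a N k)) + of_nat h) / of_nat d)" for N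
      by (intro pint_divide pint_add pint_of_nat d)
    then show "pint ((of_nat (Suc (mseq a N k)) + of_nat h) / of_nat d)" for N .
    have "plim (\<lambda>N. (of_nat (Suc (mseq a N k)) + of_nat h) * inverse (of_nat d)) ((of_rat (1 - fr a k) + of_nat h) * inverse (of_nat d))"
      using k a by (intro plim_mult plim_add plim_const Suc_mseq_lim) auto
    then show "plim (\<lambda>N. of_rat ((of_nat (Suc (mseq a N k)) + of_nat h) / of_nat d)) (of_rat ((1 - fr a k + of_nat h) / of_nat d))"
      unfolding of_rat_divide of_rat_add of_rat_of_nat_eq unfolding divide_inverse .
  qed
  moreover have "plim (\<lambda>N. H ^ r * (\<Prod>k<r. of_int (gamma_nat p (Suc (mseq a N k))))) (H ^ r * GP a)"
    unfolding GP_def using a by (intro plim_mult plim_const plim_prod gamma_mseq_lim) auto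
  ultimately show ?thesis unfolding step res_of_nat H_def[symmetric] using plim_unique by blast
qed

end

section \<open>Counting points\<close>

lemma sum_PiE_lessThan_Suc:
  fixes G :: "(nat \<Rightarrow> 'b) \<Rightarrow> 'c::comm_monoid_add"
  shows "(\<Sum>y\<in>{..<Suc n} \<rightarrow>\<^sub>E B. G y) = (\<Sum>g\<in>{..<n} \<rightarrow>\<^sub>E B. \<Sum>b\<in>B. G (g(n := b)))"
proof -
  have "{..<Suc n} \<rightarrow>\<^sub>E B = (\<lambda>(b, g). g(n := b)) ` (B \<times> ({..<n} \<rightarrow>\<^sub>E B))"
    unfolding lessThan_Suc by (rule PiE_insert_eq)
  moreover have "inj_on (\<lambda>(b, g). g(n := b)) (B \<times> ({..<n} \<rightarrow>\<^sub>E B))"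
    using inj_combinator[of n "{..<n}" "\<lambda>_. B"] by simp
  ultimately have "(\<Sum>y\<in>{..<Suc n} \<rightarrow>\<^sub>E B. G y) = (\<Sum>(b, g)\<in>B \<times> ({..<n} \<rightarrow>\<^sub>E B). G (g(n := b)))"
    by (simp add: sum.reindex case_prod_unfold)
  also have "\<dots> = (\<Sum>b\<in>B. \<Sum>g\<in>{..<n} \<rightarrow>\<^sub>E B. G (g(n := b)))" by (rule sum.cartesian_product[symmetric])
  also have "\<dots> = (\<Sum>g\<in>{..<n} \<rightarrow>\<^sub>E B. \<Sum>b\<in>B. G (g(n := b)))" by (rule sum.swap)
  finally show ?thesis .
qed

lemma sum_fun_upd_lessThan: "(\<Sum>i<Suc n. (g(n := b)) i) = (\<Sum>i<n. g i) + b"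
  by simp

text \<open>The nonzero scalars act freely on the nonzero solutions, so each class has as many
  elements as there are nonzero scalars.\<close>

lemma card_proj_points:
  fixes P :: "(nat \<Rightarrow> 'a::{finite,field}) \<Rightarrow> bool"
  assumes hom: "\<And>c x. c \<noteq> 0 \<Longrightarrow> P x \<Longrightarrow> P (\<lambda>i. c * x i)"
    and restr: "\<And>x y. (\<And>i. i < d \<Longrightarrow> x i = y i) \<Longrightarrow> P x \<Longrightarrow> P y"
  shows "(card (UNIV :: 'a set) - 1) * card (proj_points d P) =
    card {y \<in> {..<d} \<rightarrow>\<^sub>E UNIV. (\<exists>i<d. y i \<noteq> 0) \<and> P y}"
proof -
  define A where "A = {x :: nat \<Rightarrow> 'a. (\<forall>i\<ge>d. x i = 0) \<and> (\<exists>i<d. x i \<noteq> 0) \<and> P x}"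
  define R where "R = {(x, y). x \<in> A \<and> y \<in> A \<and> (\<exists>c. c \<noteq> 0 \<and> y = (\<lambda>i. c * x i))}"
  have pp: "proj_points d P = A // R" by (simp add: proj_points_def A_def R_def Let_def)
  \<comment> \<open>Representatives vanish from index \<open>d\<close> on, whereas members of the
    function space are \<open>undefined\<close> there; \<open>restr\<close> carries \<open>P\<close>
    across this change of convention.\<close>
  have bij: "bij_betw (\<lambda>x. restrict x {..<d}) A {y \<in> {..<d} \<rightarrow>\<^sub>E UNIV. (\<exists>i<d. y i \<noteq> 0) \<and> P y}"
  proof (rule bij_betw_byWitness[where f' = "\<lambda>y i. if i < d then y i else 0"])
    show "\<forall>x\<in>A. (\<lambda>i. if i < d then restrict x {..<d} i else 0) = x"
      by (auto simp: A_def fun_eq_iff)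
    show "\<forall>y\<in>{y \<in> {..<d} \<rightarrow>\<^sub>E UNIV. (\<exists>i<d. y i \<noteq> 0) \<and> P y}. restrict (\<lambda>i. if i < d then y i else 0) {..<d} = y"
      by (auto simp: fun_eq_iff PiE_iff extensional_def)
    show "(\<lambda>x. restrict x {..<d}) ` A \<subseteq> {y \<in> {..<d} \<rightarrow>\<^sub>E UNIV. (\<exists>i<d. y i \<noteq> 0) \<and> P y}"
    proof (rule image_subsetI)
      fix x assume x: "x \<in> A"
      then have "\<exists>i<d. restrict x {..<d} i \<noteq> 0" by (auto simp: A_def)
      moreover have "P x" using x by (simp add: A_def)
      then have "P (restrict x {..<d})" by (rule restr[rotated]) simp
      ultimately show "restrict x {..<d} \<in> {y \<in> {..<d} \<rightarrow>\<^sub>E UNIV. (\<exists>i<d. y i \<noteq> 0) \<and> P y}" by simp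
    qed
    show "(\<lambda>y i. if i < d then y i else 0) ` {y \<in> {..<d} \<rightarrow>\<^sub>E UNIV. (\<exists>i<d. y i \<noteq> 0) \<and> P y} \<subseteq> A"
    proof safe
      fix y i assume y: "P y" "i < d" "y i \<noteq> 0"
      have "P (\<lambda>i. if i < d then y i else 0)" using y(1) by (rule restr[rotated]) simp
      then show "(\<lambda>i. if i < d then y i else 0) \<in> A" using y by (auto simp: A_def)
    qed
  qed
  have "finite ({..<d} \<rightarrow>\<^sub>E (UNIV :: 'a set))" by (intro finite_PiE) auto
  then have fin: "finite A" unfolding bij_betw_finite[OF bij] by (rule finite_subset[rotated]) blast
  have scale: "(\<lambda>i. c * x i) \<in> A" if "x \<in> A" "c \<noteq> 0" for c x
  proof -
    have "P (\<lambda>i. c * x i)" using that by (intro hom) (simp_all add: A_def)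
    then show ?thesis using that unfolding A_def by simp
  qed
  have RI: "(x, y) \<in> R" if "x \<in> A" "y \<in> A" "c \<noteq> 0" "y = (\<lambda>i. c * x i)" for x y c
    unfolding R_def using that by auto
  have RD: "x \<in> A \<and> y \<in> A \<and> (\<exists>c. c \<noteq> 0 \<and> y = (\<lambda>i. c * x i))" if "(x, y) \<in> R" for x y
    using that unfolding R_def by simp
  have eq: "equiv A R"
  proof (rule equivI)
    show "R \<subseteq> A \<times> A" by (rule subsetI) (auto dest: RD)
    show "refl_on A R"
    proof (rule refl_onI)
      fix x assume "x \<in> A"
      then show "(x, x) \<in> R" by (intro RI[of _ _ 1]) auto
    qed
    show "sym R"
    proof (rule symI)
      fix x y assume "(x, y) \<in> R"
      then obtain c where c: "x \<in> A" "y \<in> A" "c \<noteq> 0" "y = (\<lambda>i. c * x i)" using RD by meson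
      have "x = (\<lambda>i. inverse c * y i)" unfolding c(4) using c(3) by (simp add: mult.assoc[symmetric])
      moreover have "inverse c \<noteq> 0" using c(3) by simp
      ultimately show "(y, x) \<in> R" using RI[OF c(2,1)] by metis
    qed
    show "trans R"
    proof (rule transI)
      fix x y z assume "(x, y) \<in> R" "(y, z) \<in> R"
      then obtain b c where bc: "x \<in> A" "y \<in> A" "z \<in> A" "b \<noteq> 0" "c \<noteq> 0" "y = (\<lambda>i. b * x i)" "z = (\<lambda>i. c * y i)"
        using RD by meson
      have "z = (\<lambda>i. (c * b) * x i)" unfolding bc(7) bc(6) by (simp add: mult.assoc)
      moreover have "c * b \<noteq> 0" using bc(4,5) by simp
      ultimately show "(x, z) \<in> R" using RI[OF bc(1,3)] by metis
    qed
  qed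
  have "(card (UNIV :: 'a set) - 1) * card (A // R) = card (\<Union> (A // R))"
  proof (rule card_partition)
    show "finite (A // R)" using fin eq by (auto intro: finite_quotient simp: equiv_def)
    show "finite (\<Union> (A // R))" using fin Union_quotient[OF eq] by simp
    show "X \<inter> Y = {}" if "X \<in> A // R" "Y \<in> A // R" "X \<noteq> Y" for X Y
      using quotient_disj[OF eq] that by blast
    fix X assume "X \<in> A // R"
    then obtain x where x: "x \<in> A" "X = R `` {x}" by (auto elim: quotientE)
    have "X = (\<lambda>c i. c * x i) ` (UNIV - {0})" unfolding x(2)
    proof (intro equalityI subsetI)
      fix y assume "y \<in> R `` {x}"
      then have "\<exists>c. c \<noteq> 0 \<and> y = (\<lambda>i. c * x i)" using RD by simp
      then show "y \<in> (\<lambda>c i. c * x i) ` (UNIV - {0})" by auto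
    next
      fix y assume "y \<in> (\<lambda>c i. c * x i) ` (UNIV - {0})"
      then obtain c where c: "c \<noteq> 0" "y = (\<lambda>i. c * x i)" by auto
      then have "(x, y) \<in> R" using x(1) scale by (intro RI[of _ _ c]) auto
      then show "y \<in> R `` {x}" by simp
    qed
    moreover have "inj_on (\<lambda>c i. c * x i) (UNIV - {0})"
    proof (rule inj_onI)
      fix b c assume "(\<lambda>i. b * x i) = (\<lambda>i. c * x i)"
      moreover obtain i where "x i \<noteq> 0" using x by (auto simp: A_def)
      ultimately show "b = c" using fun_cong[of "\<lambda>i. b * x i" "\<lambda>i. c * x i" i] by simp
    qed
    ultimately show "card X = card (UNIV :: 'a set) - 1" by (simp add: card_image)
  qed
  then show ?thesis unfolding pp Union_quotient[OF eq] using bij_betw_same_card[OF bij] by simp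
qed

section \<open>The number of points in terms of Jacobi sums\<close>

context unram begin

lemma of_nat_F_eq_0: "(of_nat n :: 'f) = 0 \<longleftrightarrow> p dvd n"
proof -
  have "(of_nat n :: 'f) = 0 \<longleftrightarrow> (of_nat n :: 'k) \<in> pid 1"
    using res_eq_0_iff[of "of_nat n"] by (simp add: res_of_nat)
  also have "\<dots> \<longleftrightarrow> p dvd n" using of_int_in_pid_iff[of "int n" 1] by simp
  finally show ?thesis .
qed

lemma power_map_bij:
  assumes "coprime d (q - 1)"
  shows "d > 0" "\<exists>e>0. \<forall>a :: 'f. (a ^ d) ^ e = a \<and> (a ^ e) ^ d = a"
proof -
  obtain e where e: "[d * e = Suc 0] (mod (q - 1))" using cong_solve_coprime_nat[OF assms] by auto
  have q2: "q - 1 > 1" using q_ge_3 by linarith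
  have mod1: "d * e mod (q - 1) = 1" using e q2 by (simp add: cong_def)
  then have e0: "e > 0" "d > 0" using q2 by (auto intro!: Nat.gr0I)
  have "a ^ (d * e) = a" for a :: 'f
  proof (cases "a = 0")
    case False
    have "a ^ (d * e) = a ^ (d * e mod (q - 1))" by (rule power_mod_eq[OF F_power_q1[OF False], symmetric])
    then show ?thesis unfolding mod1 by simp
  qed (use e0 in simp)
  then have "\<forall>a :: 'f. (a ^ d) ^ e = a \<and> (a ^ e) ^ d = a"
    by (simp add: power_mult[symmetric] mult.commute[of e])
  then show "d > 0" "\<exists>e>0. \<forall>a :: 'f. (a ^ d) ^ e = a \<and> (a ^ e) ^ d = a" using e0 by blast+
qed

lemma sum_PiE_power:
  fixes G :: "(nat \<Rightarrow> 'f) \<Rightarrow> 'c::comm_monoid_add"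
  assumes "coprime d (q - 1)" "B = UNIV \<or> B = UNIV - {0}"
  shows "(\<Sum>x\<in>{..<n} \<rightarrow>\<^sub>E B. G (restrict (\<lambda>i. x i ^ d) {..<n})) = (\<Sum>y\<in>{..<n} \<rightarrow>\<^sub>E B. G y)"
proof -
  obtain e where e: "\<And>a :: 'f. (a ^ d) ^ e = a" "\<And>a :: 'f. (a ^ e) ^ d = a" "e > 0" "d > 0"
        using power_map_bij[OF assms(1)] by auto
  show ?thesis
    by (rule sum.reindex_bij_witness[of _ "\<lambda>y. restrict (\<lambda>i. y i ^ e) {..<n}" "\<lambda>x. restrict (\<lambda>i. x i ^ d) {..<n}"])
      (use assms(2) e in \<open>auto simp: PiE_iff extensional_def fun_eq_iff\<close>)
qed

definition ind :: "bool \<Rightarrow> 'k" where "ind P = (if P then 1 else 0)"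

lemma of_nat_card_ind: "finite S \<Longrightarrow> of_nat (card {x \<in> S. P x}) = (\<Sum>x\<in>S. ind (P x))"
  by (simp add: ind_def sum.If_cases Int_def)

lemma hyperplane_count: "(\<Sum>y\<in>{..<Suc n} \<rightarrow>\<^sub>E (UNIV :: 'f set). ind ((\<Sum>i<Suc n. y i) = 0)) = of_nat q ^ n"
proof -
  have "(\<Sum>b\<in>UNIV. ind (s + b = 0)) = 1" for s :: 'f
  proof -
    have "(\<Sum>b\<in>UNIV. ind (s + b = 0)) = (\<Sum>b\<in>UNIV. if b = - s then 1 else 0 :: 'k)"
      by (rule sum.cong) (auto simp: ind_def eq_neg_iff_add_eq_0 add.commute)
    then show ?thesis by simp
  qed
  then show ?thesis
    unfolding sum_PiE_lessThan_Suc sum_fun_upd_lessThan by (simp add: card_PiE card_F)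
qed

lemma card_torus: "of_nat (card (torus n)) = (of_nat q - 1 :: 'k) ^ n"
proof -
  have "card (torus n) = (q - 1) ^ n" by (simp add: card_PiE card_F)
  then show ?thesis by (metis of_nat_power of_nat_q1)
qed

text \<open>Let \<open>z\<close> be the count for \<open>n\<close>. A new last coordinate must be
  minus the sum of the others and is admissible unless that sum is zero, so the next count is
  \<open>(q-1)^n - z\<close>; the combination on the left then just changes sign.\<close>

lemma torus_hyperplane_count:
  "(of_nat q - 1) ^ n - of_nat q * (\<Sum>y\<in>torus n. ind ((\<Sum>i<n. y i) = 0)) = (- 1) ^ n * (1 - of_nat q)"
proof (induction n)
  case 0 then show ?case by (simp add: ind_def)
next
  case (Suc n)
  have "(\<Sum>b\<in>UNIV - {0}. ind (s + b = 0)) = 1 - ind (s = 0)" for s :: 'f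
  proof -
    have "(\<Sum>b\<in>UNIV - {0}. ind (s + b = 0)) = (\<Sum>b\<in>UNIV - {0}. if b = - s then 1 else 0 :: 'k)"
      by (rule sum.cong) (auto simp: ind_def eq_neg_iff_add_eq_0 add.commute)
    then show ?thesis by (simp add: ind_def)
  qed
  then have eq: "(\<Sum>y\<in>torus (Suc n). ind ((\<Sum>i<Suc n. y i) = 0))
    = (of_nat q - 1) ^ n - (\<Sum>y\<in>torus n. ind ((\<Sum>i<n. y i) = 0))"
    unfolding sum_PiE_lessThan_Suc sum_fun_upd_lessThan by (simp add: sum_subtractf card_torus)
  have alg: "(Q - 1) * X - Q * (X - z) = - (X - Q * z)" for Q X z :: 'k by (simp add: algebra_simps)
  show ?case unfolding eq power_Suc alg Suc by simp
qed

lemma tau_ratio_expand: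
  assumes "b \<noteq> 0"
  shows "tau (s ^ d / (b * (\<Prod>i<d. y i))) ^ j = tau (inverse b) ^ j * ((\<Prod>i<d. tau (inverse (y i)) ^ j) * tau s ^ (d * j))"
  by (simp add: divide_inverse tau_mult tau_power tau_inverse tau_prod power_mult_distrib power_mult prod_inversef[symmetric] prod_power_distrib)

lemma mod_q1_mult_ne_0:
  assumes "coprime d (q - 1)" "0 < j" "j < q - 1"
  shows "d * j mod (q - 1) \<noteq> 0"
proof
  assume "d * j mod (q - 1) = 0"
  then have "(q - 1) dvd d * j" by (simp add: dvd_eq_mod_eq_0)
  then have "(q - 1) dvd j" using assms(1) by (simp add: coprime_commute coprime_dvd_mult_right_iff)
  then show False using assms by (auto dest: dvd_imp_le)
qed

text \<open>The affine count differs from that of \<open>\<Sum> x_i^d = 0\<close> only on the torus,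
  and the latter is the count of a hyperplane because \<open>d\<close>-th powers permute the field.
  On the torus, for \<open>d \<lambda> \<noteq> 0\<close>, the condition is that a ratio
  \<open>b\<close> equals 1, which the sum over all characters detects; the trivial one leads to the
  summand 1, the others to Jacobi sums.\<close>

theorem dwork_count:
  fixes lam :: 'f
  assumes d: "odd d" "coprime d (q - 1)"
  shows "(of_nat q - 1) * of_nat (card (dwork_points d lam)) =
    (of_nat q ^ (d - 1) - 1 :: 'k) + (if of_nat d * lam = 0 then 0 else 1 + (\<Sum>j\<in>{1..q - 2}. tau (inverse ((of_nat d * lam) ^ d)) ^ j * jacobi d j) / (of_nat q - 1))"
proof -
  obtain e where e: "\<And>a :: 'f. (a ^ d) ^ e = a" "\<And>a :: 'f. (a ^ e) ^ d = a" "e > 0" "d > 0"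
        using power_map_bij[OF d(2)] by auto
  have q1nz: "(of_nat q - 1 :: 'k) \<noteq> 0" using unit_q1 by (simp add: unit_def)
  define \<mu> where "\<mu> = of_nat d * lam"
  define U where "U = {..<d} \<rightarrow>\<^sub>E (UNIV :: 'f set)"
  define T where "T = torus d"
  define E1 where "E1 x \<longleftrightarrow> (\<Sum>i<d. x i ^ d) = \<mu> * (\<Prod>i<d. x i)" for x
  define E0 where "E0 x \<longleftrightarrow> (\<Sum>i<d. x i ^ d) = 0" for x :: "nat \<Rightarrow> 'f"
  have fin: "finite U" "finite T" by (auto simp: U_def T_def intro!: finite_PiE)
  have TU: "T \<subseteq> U" by (auto simp: T_def U_def PiE_iff)
  have "(q - 1) * card (dwork_points d lam) = card {y \<in> U. (\<exists>i<d. y i \<noteq> 0) \<and> E1 y}"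
    unfolding dwork_points_def U_def E1_def \<mu>_def card_F[symmetric]
  proof (rule card_proj_points)
    fix c :: 'f and x assume "(\<Sum>i<d. x i ^ d) = of_nat d * lam * (\<Prod>i<d. x i)"
    moreover have "(\<Sum>i<d. (c * x i) ^ d) = c ^ d * (\<Sum>i<d. x i ^ d)"
      by (simp add: power_mult_distrib sum_distrib_left)
    ultimately show "(\<Sum>i<d. (c * x i) ^ d) = of_nat d * lam * (\<Prod>i<d. c * x i)"
      by (simp add: prod.distrib)
  next
    fix x y :: "nat \<Rightarrow> 'f"
    assume eq: "\<And>i. i < d \<Longrightarrow> x i = y i" and "(\<Sum>i<d. x i ^ d) = of_nat d * lam * (\<Prod>i<d. x i)"
    moreover have "(\<Sum>i<d. x i ^ d) = (\<Sum>i<d. y i ^ d)" "(\<Prod>i<d. x i) = (\<Prod>i<d. y i)"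
      using eq by (auto intro!: sum.cong prod.cong)
    ultimately show "(\<Sum>i<d. y i ^ d) = of_nat d * lam * (\<Prod>i<d. y i)" by simp
  qed
  \<comment> \<open>The affine solutions include the origin, which projective space omits.\<close>
  moreover have "card {y \<in> U. E1 y} = Suc (card {y \<in> U. (\<exists>i<d. y i \<noteq> 0) \<and> E1 y})"
  proof -
    define o0 where "o0 = restrict (\<lambda>_. 0 :: 'f) {..<d}"
    have "{y \<in> U. E1 y} = insert o0 {y \<in> U. (\<exists>i<d. y i \<noteq> 0) \<and> E1 y}"
    proof -
      have "y = o0" if "y \<in> U" "\<forall>i<d. y i = 0" for y
        using that by (auto simp: o0_def U_def PiE_iff extensional_def fun_eq_iff)
      moreover have "o0 \<in> U" "E1 o0" using e(4) by (auto simp: o0_def U_def E1_def)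
      ultimately show ?thesis by auto
    qed
    moreover have "o0 \<notin> {y \<in> U. (\<exists>i<d. y i \<noteq> 0) \<and> E1 y}" by (auto simp: o0_def)
    ultimately show ?thesis using fin by simp
  qed
  ultimately have "of_nat (Suc ((q - 1) * card (dwork_points d lam))) = (of_nat (card {y \<in> U. E1 y}) :: 'k)" by simp
  then have c1: "(of_nat q - 1) * of_nat (card (dwork_points d lam)) + 1 = (\<Sum>y\<in>U. ind (E1 y))"
    unfolding of_nat_card_ind[OF fin(1)] of_nat_Suc of_nat_mult of_nat_q1 by (simp only: add.commute)
  have "(\<Sum>y\<in>U. ind (E1 y)) - (\<Sum>y\<in>U. ind (E0 y)) = (\<Sum>y\<in>U. ind (E1 y) - ind (E0 y))" by (simp add: sum_subtractf)
  also have "\<dots> = (\<Sum>y\<in>T. ind (E1 y) - ind (E0 y))"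
  proof (rule sum.mono_neutral_right[OF fin(1) TU], safe)
    fix y assume "y \<in> U" "y \<notin> T"
    then have "\<exists>i<d. y i = 0" by (auto simp: U_def T_def PiE_iff)
    then have P0: "(\<Prod>i<d. y i) = 0" by auto
    show "ind (E1 y) - ind (E0 y) = 0" unfolding E1_def E0_def P0 by simp
  qed
  finally have c2: "(\<Sum>y\<in>U. ind (E1 y)) = (\<Sum>y\<in>U. ind (E0 y)) + (\<Sum>y\<in>T. ind (E1 y)) - (\<Sum>y\<in>T. ind (E0 y))"
    by (simp add: sum_subtractf algebra_simps)
  have c3: "(\<Sum>y\<in>U. ind (E0 y)) = of_nat q ^ (d - 1)"
  proof -
    have "(\<Sum>y\<in>U. ind (E0 y)) = (\<Sum>x\<in>U. ind ((\<Sum>i<d. restrict (\<lambda>i. x i ^ d) {..<d} i) = 0))" by (simp add: E0_def)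
    also have "\<dots> = (\<Sum>y\<in>U. ind ((\<Sum>i<d. y i) = 0))"
      unfolding U_def by (rule sum_PiE_power[OF d(2), where G = "\<lambda>x. ind ((\<Sum>i<d. x i) = 0)"]) simp
    also have "\<dots> = of_nat q ^ (d - 1)" using hyperplane_count[of "d - 1"] e(4) by (simp add: U_def)
    finally show ?thesis .
  qed
  define z where "z = (\<Sum>y\<in>T. ind ((\<Sum>i<d. y i) = 0))"
  have c4: "(\<Sum>y\<in>T. ind (E0 y)) = z"
  proof -
    have "(\<Sum>y\<in>T. ind (E0 y)) = (\<Sum>x\<in>T. ind ((\<Sum>i<d. restrict (\<lambda>i. x i ^ d) {..<d} i) = 0))" by (simp add: E0_def)
    also have "\<dots> = z"
      unfolding T_def z_def by (rule sum_PiE_power[OF d(2), where G = "\<lambda>x. ind ((\<Sum>i<d. x i) = 0)"]) simp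
    finally show ?thesis .
  qed
  have c5: "(\<Sum>y\<in>T. ind (E1 y)) = (\<Sum>y\<in>T. ind ((\<Sum>i<d. y i) ^ d = \<mu> ^ d * (\<Prod>i<d. y i)))"
  proof -
    have inj: "a ^ d = b ^ d \<longleftrightarrow> a = b" for a b :: 'f by (metis e(1))
    have "(\<Sum>y\<in>T. ind (E1 y)) = (\<Sum>x\<in>T. ind ((\<Sum>i<d. restrict (\<lambda>i. x i ^ d) {..<d} i) ^ d = \<mu> ^ d * (\<Prod>i<d. restrict (\<lambda>i. x i ^ d) {..<d} i)))"
    proof (rule sum.cong)
      fix x :: "nat \<Rightarrow> 'f"
      have "\<mu> ^ d * (\<Prod>i<d. x i ^ d) = (\<mu> * (\<Prod>i<d. x i)) ^ d" by (simp add: power_mult_distrib prod_power_distrib)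
      then show "ind (E1 x) = ind ((\<Sum>i<d. restrict (\<lambda>i. x i ^ d) {..<d} i) ^ d = \<mu> ^ d * (\<Prod>i<d. restrict (\<lambda>i. x i ^ d) {..<d} i))"
        by (simp add: E1_def inj)
    qed simp
    also have "\<dots> = (\<Sum>y\<in>T. ind ((\<Sum>i<d. y i) ^ d = \<mu> ^ d * (\<Prod>i<d. y i)))"
      unfolding T_def by (rule sum_PiE_power[OF d(2), where G = "\<lambda>x. ind ((\<Sum>i<d. x i) ^ d = \<mu> ^ d * (\<Prod>i<d. x i))"]) simp
    finally show ?thesis .
  qed
  have main: "(of_nat q - 1) * of_nat (card (dwork_points d lam)) + 1 = of_nat q ^ (d - 1) + (\<Sum>y\<in>T. ind (E1 y)) - z"
    unfolding c1 c2 c3 c4 ..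
  show ?thesis
  proof (cases "\<mu> = 0")
    case True
    have "(\<Sum>y\<in>T. ind (E1 y)) = (\<Sum>y\<in>T. ind (E0 y))" using True by (simp add: E1_def E0_def)
    then show ?thesis using main c4 True by (simp add: \<mu>_def algebra_simps)
  next
    case False
    then have D: "\<mu> ^ d \<noteq> 0" by simp
    define \<chi> where "\<chi> y s j = tau (inverse (\<mu> ^ d)) ^ j * ((\<Prod>i<d. tau (inverse (y i)) ^ j) * tau s ^ (d * j mod (q - 1)))" for y s j
    have "(of_nat q - 1) * (\<Sum>y\<in>T. ind (E1 y)) = (\<Sum>y\<in>T. (of_nat q - 1) * ind ((\<Sum>i<d. y i) ^ d = \<mu> ^ d * (\<Prod>i<d. y i)))"
      unfolding c5 by (rule sum_distrib_left)
    also have "\<dots> = (\<Sum>y\<in>T. (1 - ind ((\<Sum>i<d. y i) = 0)) + (\<Sum>j\<in>{1..q - 2}. \<chi> y (\<Sum>i<d. y i) j))"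
    proof (rule sum.cong)
      fix y assume "y \<in> T"
      then have P: "(\<Prod>i<d. y i) \<noteq> 0" by (auto simp: T_def PiE_iff)
      define s where "s = (\<Sum>i<d. y i)"
      define b where "b = s ^ d / (\<mu> ^ d * (\<Prod>i<d. y i))"
      have exp: "tau b ^ j = \<chi> y s j" if j: "j \<in> {1..q - 2}" for j
      proof (cases "s = 0")
        case True
        \<comment> \<open>At \<open>s = 0\<close> both sides vanish because the reduced exponent
          stays positive; coprimality of \<open>d\<close> and \<open>q - 1\<close> rules out
          \<open>0^0\<close>.\<close>
        have "d * j mod (q - 1) > 0" using mod_q1_mult_ne_0[OF d(2), of j] j q_ge_3 by fastforce
        then show ?thesis using True j e(4) by (simp add: \<chi>_def b_def power_0_left)
      next
        case False
        have "tau s ^ (d * j mod (q - 1)) = tau s ^ (d * j)" by (rule power_mod_eq[OF tau_power_q1[OF False]])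
        then show ?thesis using tau_ratio_expand[OF D, of s d y j] by (simp add: \<chi>_def b_def)
      qed
      show "(of_nat q - 1) * ind ((\<Sum>i<d. y i) ^ d = \<mu> ^ d * (\<Prod>i<d. y i)) = (1 - ind ((\<Sum>i<d. y i) = 0)) + (\<Sum>j\<in>{1..q - 2}. \<chi> y (\<Sum>i<d. y i) j)"
        unfolding s_def[symmetric]
      proof (cases "s = 0")
        case True
        have "(\<Sum>j\<in>{1..q - 2}. \<chi> y s j) = (\<Sum>j\<in>{1..q - 2}. tau b ^ j)"
          using exp by (intro sum.cong) auto
        also have "\<dots> = 0" using True e(4) by (intro sum.neutral) (auto simp: b_def power_0_left)
        finally have 0: "(\<Sum>j\<in>{1..q - 2}. \<chi> y s j) = 0" .
        have "\<not> s ^ d = \<mu> ^ d * (\<Prod>i<d. y i)" using True D P e(4) by (simp add: power_0_left)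
        then show "(of_nat q - 1) * ind (s ^ d = \<mu> ^ d * (\<Prod>i<d. y i)) = (1 - ind (s = 0)) + (\<Sum>j\<in>{1..q - 2}. \<chi> y s j)"
          unfolding 0 using True by (simp add: ind_def)
      next
        case False
        then have b0: "b \<noteq> 0" using D P by (simp add: b_def)
        have "s ^ d = \<mu> ^ d * (\<Prod>i<d. y i) \<longleftrightarrow> b = 1" using D P by (auto simp: b_def)
        then have "(of_nat q - 1) * ind (s ^ d = \<mu> ^ d * (\<Prod>i<d. y i)) = (\<Sum>j\<in>{0..q - 2}. tau b ^ j)"
          unfolding sum_tau_power_index[OF b0] by (simp add: ind_def)
        also have "\<dots> = 1 + (\<Sum>j\<in>{1..q - 2}. tau b ^ j)" by (subst sum.atLeast_Suc_atMost) auto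
        also have "(\<Sum>j\<in>{1..q - 2}. tau b ^ j) = (\<Sum>j\<in>{1..q - 2}. \<chi> y s j)"
          using exp by (intro sum.cong) auto
        finally show "(of_nat q - 1) * ind (s ^ d = \<mu> ^ d * (\<Prod>i<d. y i)) = (1 - ind (s = 0)) + (\<Sum>j\<in>{1..q - 2}. \<chi> y s j)"
          using False by (simp add: ind_def)
      qed
    qed simp
    also have "\<dots> = ((of_nat q - 1) ^ d - z) + (\<Sum>j\<in>{1..q - 2}. tau (inverse (\<mu> ^ d)) ^ j * jacobi d j)"
    proof -
      have "of_nat (card T) = ((of_nat q - 1) ^ d :: 'k)"
        unfolding T_def by (rule card_torus)
      then have "(\<Sum>y\<in>T. 1 - ind ((\<Sum>i<d. y i) = 0)) = (of_nat q - 1) ^ d - z" by (simp add: sum_subtractf z_def)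
      moreover have "(\<Sum>y\<in>T. \<Sum>j\<in>{1..q - 2}. \<chi> y (\<Sum>i<d. y i) j)
        = (\<Sum>j\<in>{1..q - 2}. tau (inverse (\<mu> ^ d)) ^ j * jacobi d j)"
        unfolding jacobi_def \<chi>_def T_def[symmetric] sum_distrib_left by (rule sum.swap)
      ultimately show ?thesis unfolding sum.distrib by simp
    qed
    finally have c6: "(of_nat q - 1) * (\<Sum>y\<in>T. ind (E1 y)) = (of_nat q - 1) ^ d - z + (\<Sum>j\<in>{1..q - 2}. tau (inverse (\<mu> ^ d)) ^ j * jacobi d j)" .
    \<comment> \<open>The parity of \<open>d\<close> enters here through
      \<open>(-1)^d (1 - q) = q - 1\<close>; after division by \<open>q - 1\<close> this is the
      summand 1.\<close>
    have c7: "(of_nat q - 1) ^ d - of_nat q * z = of_nat q - 1"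
      using torus_hyperplane_count[of d] d(1) by (simp add: T_def z_def)
    define J where "J = (\<Sum>j\<in>{1..q - 2}. tau (inverse (\<mu> ^ d)) ^ j * jacobi d j)"
    have "(of_nat q - 1) * ((\<Sum>y\<in>T. ind (E1 y)) - z) = (of_nat q - 1) ^ d - of_nat q * z + J"
      unfolding right_diff_distrib c6 J_def by (simp add: algebra_simps)
    also have "\<dots> = (of_nat q - 1) * (1 + J / (of_nat q - 1))" unfolding c7 using q1nz by (simp add: distrib_left)
    finally have "(\<Sum>y\<in>T. ind (E1 y)) - z = 1 + J / (of_nat q - 1)"
      unfolding mult_left_cancel[OF q1nz] .
    then have "(of_nat q - 1) * of_nat (card (dwork_points d lam)) + 1 = of_nat q ^ (d - 1) + (1 + J / (of_nat q - 1))"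
      using main by (simp add: algebra_simps)
    then show ?thesis using False unfolding J_def \<mu>_def by (simp add: algebra_simps)
  qed
qed

end

section \<open>The hypergeometric function\<close>

lemma power_int_sum:
  "x \<noteq> 0 \<Longrightarrow> (x :: 'a::field) powi (\<Sum>i\<in>A. f i) = (\<Prod>i\<in>A. x powi f i)"
  by (induction A rule: infinite_finite_induct) (auto simp: power_int_add)

lemma frac_add_of_int: "frac (x + of_int n) = frac x"
  by (simp add: frac_def)

text \<open>The points \<open>frac (i * a / d - z)\<close> are the solutions \<open>x \<in> [0,1)\<close> of \<open>d x \<equiv> - d z\<close> modulo 1.\<close>

lemma frac_translates_bij:
  fixes z :: rat
  assumes d: "d > 0" "coprime a d"
  obtains h where "bij_betw h {..<d} {..<d}"
    "\<And>i. i < d \<Longrightarrow> frac (of_nat i / of_nat d * of_nat a - z) = (frac (- (of_nat d * z)) + of_nat (h i)) / of_nat d"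
proof -
  define u where "u i = of_nat i / of_nat d * of_nat a - z" for i
  define y where "y = frac (- (of_nat d * z))"
  define h where "h i = nat \<lfloor>of_nat d * frac (u i)\<rfloor>" for i
  have eq: "of_nat d * frac (u i) = y + of_nat (h i)" "h i < d" for i
  proof -
    \<comment> \<open>\<open>d frac (u i)\<close> is congruent to \<open>-d z\<close> modulo 1, so
      its fractional part is \<open>y\<close> and its floor is \<open>h i\<close>.\<close>
    have du: "of_nat d * frac (u i) = - (of_nat d * z) + of_int (int i * int a - int d * \<lfloor>u i\<rfloor>)"
      using d by (simp add: frac_def u_def right_diff_distrib)
    have f: "frac (of_nat d * frac (u i)) = y"
      unfolding du y_def by (rule frac_add_of_int)
    have nn: "0 \<le> of_nat d * frac (u i)" by (simp add: frac_ge_0)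
    then have "of_nat (h i) = (of_int \<lfloor>of_nat d * frac (u i)\<rfloor> :: rat)" by (simp add: h_def)
    then show e: "of_nat d * frac (u i) = y + of_nat (h i)" using f by (simp add: frac_def)
    have "of_nat d * frac (u i) < of_nat d * 1" using d frac_lt_1[of "u i"] by (intro mult_strict_left_mono) auto
    moreover have "0 \<le> y" by (simp add: y_def frac_ge_0)
    ultimately have "of_nat (h i) < (of_nat d :: rat)" using e by linarith
    then show "h i < d" by simp
  qed
  have inj: "inj_on h {..<d}"
  proof (rule inj_onI)
    fix i j assume ij: "i \<in> {..<d}" "j \<in> {..<d}" "h i = h j"
    have "of_nat d * frac (u i) = of_nat d * frac (u j)" unfolding eq(1) ij(3) ..
    then have "frac (u i) = frac (u j)" using d by simp
    then have "u i - u j = of_int (\<lfloor>u i\<rfloor> - \<lfloor>u j\<rfloor>)" by (simp add: frac_def)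
    then have "of_nat d * (u i - u j) = of_nat d * of_int (\<lfloor>u i\<rfloor> - \<lfloor>u j\<rfloor>)" by simp
    moreover have "of_nat d * (u i - u j) = of_int ((int i - int j) * int a)"
      using d by (simp add: u_def field_simps)
    ultimately have "of_int ((int i - int j) * int a) = (of_int (int d * (\<lfloor>u i\<rfloor> - \<lfloor>u j\<rfloor>)) :: rat)" by simp
    then have "(int i - int j) * int a = int d * (\<lfloor>u i\<rfloor> - \<lfloor>u j\<rfloor>)" unfolding of_int_eq_iff .
    then have "int d dvd (int i - int j) * int a" by simp
    moreover have "coprime (int d) (int a)" using d(2) by (simp add: coprime_commute)
    ultimately have "int d dvd int i - int j" by (simp add: coprime_dvd_mult_left_iff)
    then have "int i mod int d = int j mod int d" by (simp add: mod_eq_dvd_iff)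
    then show "i = j" using ij by simp
  qed
  have "h ` {..<d} = {..<d}" by (rule endo_inj_surj) (use inj eq(2) in auto)
  with inj have "bij_betw h {..<d} {..<d}" by (simp add: bij_betw_def)
  moreover have "frac (u i) = (y + of_nat (h i)) / of_nat d" for i
    using eq(1)[of i] d by (simp add: field_simps)
  ultimately show ?thesis using that unfolding u_def y_def by blast
qed

lemma prod_frac_translates:
  fixes z :: rat and F :: "rat \<Rightarrow> 'b::comm_monoid_mult"
  assumes "d > 0" "coprime a d"
  shows "(\<Prod>i<d. F (frac (of_nat i / of_nat d * of_nat a - z))) = (\<Prod>h<d. F ((frac (- (of_nat d * z)) + of_nat h) / of_nat d))"
proof -
  obtain h where h: "bij_betw h {..<d} {..<d}"
    "\<And>i. i < d \<Longrightarrow> frac (of_nat i / of_nat d * of_nat a - z) = (frac (- (of_nat d * z)) + of_nat (h i)) / of_nat d"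
    using frac_translates_bij[OF assms, of z] by blast
  have "(\<Prod>i<d. F (frac (of_nat i / of_nat d * of_nat a - z))) = (\<Prod>i<d. F ((frac (- (of_nat d * z)) + of_nat (h i)) / of_nat d))"
    by (intro prod.cong refl arg_cong[of _ _ F] h(2)) simp
  also have "\<dots> = (\<Prod>h<d. F ((frac (- (of_nat d * z)) + of_nat h) / of_nat d))"
    by (rule prod.reindex_bij_betw[OF h(1)])
  finally show ?thesis .
qed

lemma sum_frac_translates:
  fixes z :: rat
  assumes "d > 0" "coprime a d"
  shows "(\<Sum>i<d. frac (of_nat i / of_nat d * of_nat a - z)) = frac (- (of_nat d * z)) + (\<Sum>h<d. of_nat h / of_nat d)"
proof -
  obtain h where h: "bij_betw h {..<d} {..<d}"
    "\<And>i. i < d \<Longrightarrow> frac (of_nat i / of_nat d * of_nat a - z) = (frac (- (of_nat d * z)) + of_nat (h i)) / of_nat d"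
    using frac_translates_bij[OF assms, of z] by blast
  have "(\<Sum>i<d. frac (of_nat i / of_nat d * of_nat a - z)) = (\<Sum>i<d. (frac (- (of_nat d * z)) + of_nat (h i)) / of_nat d)"
    by (intro sum.cong refl h(2)) simp
  also have "\<dots> = (\<Sum>h<d. (frac (- (of_nat d * z)) + of_nat h) / of_nat d)"
    by (rule sum.reindex_bij_betw[OF h(1)])
  also have "\<dots> = frac (- (of_nat d * z)) + (\<Sum>h<d. of_nat h / of_nat d)"
    using assms(1) by (simp add: add_divide_distrib sum.distrib)
  finally show ?thesis .
qed

text \<open>Hermite's identity; the floors are recovered from the sum of the fractional parts.\<close>

lemma sum_floor_translates:
  fixes z :: rat
  assumes "d > 0" "coprime a d"
  shows "(\<Sum>i<d. \<lfloor>frac (of_nat i / of_nat d * of_nat a) - z\<rfloor>) = \<lfloor>- (of_nat d * z)\<rfloor>"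
proof -
  have "of_int \<lfloor>frac x - z\<rfloor> = (frac x - z) - frac (x - z)" for x :: rat
  proof -
    have e: "frac x - z = (x - z) + of_int (- \<lfloor>x\<rfloor>)" by (simp add: frac_def)
    have "frac (frac x - z) = frac (x - z)" unfolding e by (rule frac_add_of_int)
    then show ?thesis by (simp add: frac_def[of "frac x - z"])
  qed
  then have "(\<Sum>i<d. of_int \<lfloor>frac (of_nat i / of_nat d * of_nat a) - z\<rfloor>) =
     (\<Sum>i<d. frac (of_nat i / of_nat d * of_nat a - 0)) - of_nat d * z - (\<Sum>i<d. frac (of_nat i / of_nat d * of_nat a - z))"
    by (simp add: sum_subtractf)
  also have "\<dots> = - (of_nat d * z) - frac (- (of_nat d * z))"
    unfolding sum_frac_translates[OF assms] by simp
  also have "\<dots> = of_int \<lfloor>- (of_nat d * z)\<rfloor>" by (simp add: frac_def)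
  finally have "(of_int (\<Sum>i<d. \<lfloor>frac (of_nat i / of_nat d * of_nat a) - z\<rfloor>) :: rat) = of_int \<lfloor>- (of_nat d * z)\<rfloor>" by simp
  then show ?thesis unfolding of_int_eq_iff .
qed

context unram begin

text \<open>The lower parameters \<open>b i = 0\<close> are left unsimplified to keep this literally the factor of \<open>mcG\<close>.\<close>

definition mterm :: "nat \<Rightarrow> nat \<Rightarrow> nat \<Rightarrow> nat \<Rightarrow> 'k" where
  "mterm d j i k = (- of_nat p) powi
      (- \<lfloor>frac (of_nat i / of_nat d * of_nat p ^ k) - of_nat j * of_nat p ^ k / (of_nat q - 1) :: rat\<rfloor>
       - \<lfloor>frac (- 0 * of_nat p ^ k) + of_nat j * of_nat p ^ k / (of_nat q - 1) :: rat\<rfloor>) *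
     (Gp (frac ((of_nat i / of_nat d - of_nat j / (of_nat q - 1)) * of_nat p ^ k))
        / Gp (frac (of_nat i / of_nat d * of_nat p ^ k))) *
     (Gp (frac ((- 0 + of_nat j / (of_nat q - 1)) * of_nat p ^ k))
        / Gp (frac (- 0 * of_nat p ^ k)))"

lemma mcG_eq:
  "mcG p r v res (d - 1) (\<lambda>i. of_nat i / of_nat d) (\<lambda>i. 0) t =
   (- 1) / (of_nat q - 1) * (\<Sum>j\<in>{0..q - 2}. (- 1) ^ (j * (d - 1)) * omega_bar_pow v res j t *
     (\<Prod>i\<in>{1..d - 1}. \<Prod>k\<in>{0..r - 1}. mterm d j i k))"
  unfolding mcG_def Let_def mterm_def ..

lemma pint_of_int: "pint (of_int n)" by (simp add: pint_def)

lemma pint_frac: "pint x \<Longrightarrow> pint (frac x)"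
  unfolding frac_def by (intro pint_diff pint_of_int)

lemma pint_mult: "pint x \<Longrightarrow> pint y \<Longrightarrow> pint (x * y)"
  by (simp add: pint_def of_rat_mult pid_mult_int)

lemma pint_power: "pint x \<Longrightarrow> pint (x ^ n)"
  by (simp add: pint_def of_rat_power pid_power)

lemma Gp_nz: "pint x \<Longrightarrow> Gp x \<noteq> 0" using unit_Gp by (simp add: unit_def)

lemma pint_frac_div: "\<not> p dvd d \<Longrightarrow> pint (frac (of_nat i / of_nat d * of_nat p ^ k))"
  by (intro pint_frac pint_mult pint_divide pint_power pint_of_nat)

lemma mterm_0: "\<not> p dvd d \<Longrightarrow> mterm d 0 i k = 1"
  using Gp_nz[OF pint_frac_div] by (simp add: mterm_def)

text \<open>Adding \<open>i = 0\<close> makes the upper parameters a full set of translates, so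
  floors and gamma factors collapse to those of \<open>d z\<close>; the added term is divided out
  again as \<open>Gp (1 - fr j k)\<close>. The lower parameters contribute
  \<open>Gp (fr j k) ^ (d - 1)\<close>, which reflection moves to the denominator, giving the power
  \<open>d\<close> there.\<close>

lemma prod_mterm_k:
  assumes d: "odd d" "coprime p d" "coprime d (q - 1)" and j: "0 < j" "j < q - 1" and k: "k < r"
  defines "\<rho> \<equiv> d * j mod (q - 1)" and "m \<equiv> d * j div (q - 1)"
  shows "(\<Prod>i\<in>{1..d - 1}. mterm d j i k) = (- of_nat p) powi (int (m * p ^ k + fl \<rho> k) - int (d * fl j k)) *
    ((\<Prod>h<d. Gp ((1 - fr \<rho> k + of_nat h) / of_nat d)) / (\<Prod>h<d. Gp (of_nat h / of_nat d))) / Gp (1 - fr j k) ^ d"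
proof -
  have d0: "d > 0" using d(1) by (intro Nat.gr0I) auto
  have pd: "\<not> p dvd d" using d(2) prime_p by (meson coprime_common_divisor dvd_refl not_prime_unit)
  have cop: "coprime (p ^ k) d" using d(2) by simp
  define z :: rat where "z = of_nat j * of_nat p ^ k / (of_nat q - 1)"
  have z: "\<lfloor>z\<rfloor> = int (fl j k)" "frac z = fr j k" unfolding z_def using floor_fr[OF j k] by auto
  have fj: "0 < fr j k" "fr j k < 1" using fr_bounds[OF j k] by auto
  have zz: "z = of_nat (fl j k) + fr j k" using z by (simp add: frac_def)
  \<comment> \<open>\<open>z\<close> is not an integer, hence the extra \<open>-1\<close>.\<close>
  have nz: "\<lfloor>- z\<rfloor> = - int (fl j k) - 1" unfolding zz using fj by (simp add: floor_eq_iff)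
  then have fnz: "frac (- z) = 1 - fr j k" by (simp add: frac_def zz)
  have \<rho>: "0 < \<rho>" "\<rho> < q - 1"
    using mod_q1_mult_ne_0[OF d(3) j] q_ge_3 by (auto simp: \<rho>_def)
  have f\<rho>: "0 < fr \<rho> k" "fr \<rho> k < 1" using fr_bounds[OF \<rho> k] by auto
  have dz: "of_nat d * z = of_nat (m * p ^ k + fl \<rho> k) + fr \<rho> k"
  proof -
    have "d * j = m * (q - 1) + \<rho>" unfolding m_def \<rho>_def by (rule div_mult_mod_eq[symmetric])
    then have "(of_nat (d * j) :: rat) = of_nat (m * (q - 1) + \<rho>)" by simp
    then have e: "of_nat d * of_nat j = of_nat m * (of_nat q - 1) + (of_nat \<rho> :: rat)"
      unfolding of_nat_mult of_nat_add of_nat_q1 .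
    have "of_nat d * z = (of_nat d * of_nat j) * of_nat p ^ k / (of_nat q - 1)" by (simp add: z_def)
    also have "\<dots> = of_nat m * of_nat p ^ k + of_nat \<rho> * of_nat p ^ k / (of_nat q - 1)"
      unfolding e using q_rat_pos by (simp add: field_simps)
    also have "of_nat \<rho> * of_nat p ^ k / (of_nat q - 1) = of_nat (fl \<rho> k) + fr \<rho> k" by (simp add: fr_def)
    finally show ?thesis by simp
  qed
  have ndz: "\<lfloor>- (of_nat d * z)\<rfloor> = - int (m * p ^ k + fl \<rho> k) - 1"
    unfolding dz using f\<rho> by (simp add: floor_eq_iff)
  then have fndz: "frac (- (of_nat d * z)) = 1 - fr \<rho> k" by (simp add: frac_def dz)
  define t where "t i = frac (of_nat i / of_nat d * of_nat p ^ k :: rat)" for i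
  define u where "u i = frac (of_nat i / of_nat d * of_nat p ^ k - z)" for i
  have mt: "mterm d j i k = (- of_nat p) powi (- \<lfloor>t i - z\<rfloor> - int (fl j k)) * (Gp (u i) / Gp (t i)) * Gp (fr j k)" for i
  proof -
    have "(of_nat i / of_nat d - of_nat j / (of_nat q - 1)) * of_nat p ^ k = of_nat i / of_nat d * of_nat p ^ k - z"
      "(- 0 + of_nat j / (of_nat q - 1)) * of_nat p ^ k = z"
      by (simp_all add: z_def left_diff_distrib)
    moreover have frac_0: "frac (0 :: rat) = 0" by (simp add: frac_def)
    ultimately show ?thesis unfolding mterm_def t_def u_def z_def[symmetric]
      by (simp only: z mult_zero_left minus_zero frac_0 add_0 Gp_0 div_by_1 mult_minus_left)
  qed
  have split: "{..<d} = insert 0 {1..d - 1}" using d0 by auto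
  have t0: "t 0 = 0" by (simp add: t_def)
  have u0: "u 0 = 1 - fr j k" by (simp add: u_def fnz)
  have "(\<Sum>i<d. \<lfloor>t i - z\<rfloor>) = \<lfloor>- (of_nat d * z)\<rfloor>"
    using sum_floor_translates[OF d0 cop, of z] by (simp add: t_def)
  then have s1: "(\<Sum>i\<in>{1..d - 1}. \<lfloor>t i - z\<rfloor>) = - int (m * p ^ k + fl \<rho> k) + int (fl j k)"
    unfolding split ndz using nz by (simp add: t0)
  have "(\<Sum>i\<in>{1..d - 1}. - \<lfloor>t i - z\<rfloor> - int (fl j k)) = - (\<Sum>i\<in>{1..d - 1}. \<lfloor>t i - z\<rfloor>) - int (d - 1) * int (fl j k)"
    by (simp add: sum_subtractf sum_negf)
  also have "\<dots> = int (m * p ^ k + fl \<rho> k) - int (d * fl j k)"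
    unfolding s1 using d0 by (simp add: of_nat_diff algebra_simps)
  finally have s2: "(\<Sum>i\<in>{1..d - 1}. - \<lfloor>t i - z\<rfloor> - int (fl j k)) = int (m * p ^ k + fl \<rho> k) - int (d * fl j k)" .
  have pu: "(\<Prod>i\<in>{1..d - 1}. Gp (u i)) = (\<Prod>h<d. Gp ((1 - fr \<rho> k + of_nat h) / of_nat d)) / Gp (1 - fr j k)"
  proof -
    have "(\<Prod>i<d. Gp (u i)) = (\<Prod>h<d. Gp ((1 - fr \<rho> k + of_nat h) / of_nat d))"
      using prod_frac_translates[OF d0 cop, of Gp z] unfolding fndz by (simp add: u_def)
    then have "Gp (1 - fr j k) * (\<Prod>i\<in>{1..d - 1}. Gp (u i)) = (\<Prod>h<d. Gp ((1 - fr \<rho> k + of_nat h) / of_nat d))"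
      unfolding split by (simp add: u0)
    moreover have "Gp (1 - fr j k) \<noteq> 0" by (intro Gp_nz pint_diff pint_fr pint_1)
    ultimately show ?thesis by (simp add: field_simps)
  qed
  have pt: "(\<Prod>i\<in>{1..d - 1}. Gp (t i)) = (\<Prod>h<d. Gp (of_nat h / of_nat d))"
  proof -
    have "(\<Prod>i<d. Gp (t i)) = (\<Prod>h<d. Gp (of_nat h / of_nat d))"
      using prod_frac_translates[OF d0 cop, of Gp 0] by (simp add: t_def)
    then show ?thesis unfolding split by (simp add: t0)
  qed
  have refl: "Gp (fr j k) ^ (d - 1) * Gp (1 - fr j k) ^ (d - 1) = 1"
  proof -
    obtain c where c: "d - 1 = 2 * c" using d(1) by (metis evenE odd_two_times_div_two_nat even_mult_iff even_numeral)
    have "Gp (fr j k) ^ (d - 1) * Gp (1 - fr j k) ^ (d - 1) = ((Gp (fr j k) * Gp (1 - fr j k)) ^ 2) ^ c"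
      unfolding c by (simp add: power_mult power_mult_distrib)
    then show ?thesis by (simp add: Gp_reflection_sq[OF pint_fr])
  qed
  have nz1: "Gp (1 - fr j k) \<noteq> 0" by (intro Gp_nz pint_diff pint_fr pint_1)
  have "Gp (1 - fr j k) ^ d = Gp (1 - fr j k) * Gp (1 - fr j k) ^ (d - 1)"
    using d0 by (metis Suc_pred' power_Suc)
  then have rr: "Gp (fr j k) ^ (d - 1) / Gp (1 - fr j k) = 1 / Gp (1 - fr j k) ^ d"
    using refl nz1 by (simp add: field_simps)
  have "(\<Prod>i\<in>{1..d - 1}. mterm d j i k) = (\<Prod>i\<in>{1..d - 1}. (- of_nat p) powi (- \<lfloor>t i - z\<rfloor> - int (fl j k))) *
     ((\<Prod>i\<in>{1..d - 1}. Gp (u i)) / (\<Prod>i\<in>{1..d - 1}. Gp (t i))) * Gp (fr j k) ^ (d - 1)"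
    unfolding mt by (simp add: prod.distrib prod_dividef)
  also have "(\<Prod>i\<in>{1..d - 1}. (- of_nat p) powi (- \<lfloor>t i - z\<rfloor> - int (fl j k))) = (- of_nat p :: 'k) powi (\<Sum>i\<in>{1..d - 1}. - \<lfloor>t i - z\<rfloor> - int (fl j k))"
    using p_gt_2 by (intro power_int_sum[symmetric]) simp
  also have "\<dots> * ((\<Prod>i\<in>{1..d - 1}. Gp (u i)) / (\<Prod>i\<in>{1..d - 1}. Gp (t i))) * Gp (fr j k) ^ (d - 1) =
    (- of_nat p) powi (int (m * p ^ k + fl \<rho> k) - int (d * fl j k)) *
    ((\<Prod>h<d. Gp ((1 - fr \<rho> k + of_nat h) / of_nat d)) / (\<Prod>h<d. Gp (of_nat h / of_nat d))) * (Gp (fr j k) ^ (d - 1) / Gp (1 - fr j k))"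
    unfolding s2 pu pt by simp
  also have "\<dots> = (- of_nat p) powi (int (m * p ^ k + fl \<rho> k) - int (d * fl j k)) *
    ((\<Prod>h<d. Gp ((1 - fr \<rho> k + of_nat h) / of_nat d)) / (\<Prod>h<d. Gp (of_nat h / of_nat d))) / Gp (1 - fr j k) ^ d"
    unfolding rr by simp
  finally show ?thesis .
qed

text \<open>After the product over \<open>k\<close>, the multiplication formula leaves
  \<open>GP \<rho> / GP j ^ d\<close> and a power of the Teichmueller representative of
  \<open>d\<close>. Gross-Koblitz for \<open>j\<close> and \<open>\<rho>\<close> converts the gamma
  values and powers of \<open>-p\<close> into \<open>gam j ^ d / gam \<rho>\<close>, which together
  with \<open>w ^ m\<close> is a Jacobi sum up to powers of \<open>q - 1\<close>.\<close>

lemma prod_mterm_jacobi: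
  assumes d: "odd d" "coprime p d" "coprime d (q - 1)" and j: "0 < j" "j < q - 1"
  shows "(of_nat q - 1) * (\<Prod>i\<in>{1..d - 1}. \<Prod>k\<in>{0..r - 1}. mterm d j i k) = tau (inverse (of_nat d ^ d)) ^ j * jacobi d j"
proof -
  define \<rho> where "\<rho> = d * j mod (q - 1)"
  define m where "m = d * j div (q - 1)"
  define P :: 'k where "P = - of_nat p"
  define H where "H = (\<Prod>h<d. Gp (of_nat h / of_nat d))"
  have P0: "P \<noteq> 0" using p_gt_2 by (simp add: P_def)
  have d0: "d > 0" using d(1) by (intro Nat.gr0I) auto
  have pd: "\<not> p dvd d" using d(2) prime_p by (meson coprime_common_divisor dvd_refl not_prime_unit)
  have \<rho>: "0 < \<rho>" "\<rho> < q - 1"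
    using mod_q1_mult_ne_0[OF d(3) j] q_ge_3 by (auto simp: \<rho>_def)
  have \<rho>q: "\<rho> < q" using \<rho> by linarith
  have dnz: "(of_nat d :: 'f) \<noteq> 0" using of_nat_F_eq_0 pd by blast
  then have taud: "tau (of_nat d) \<noteq> 0" by simp
  have Hnz: "H \<noteq> 0" unfolding H_def using pd by (auto intro!: Gp_nz pint_divide pint_of_nat)
  have Q: "(of_nat q - 1 :: 'k) \<noteq> 0" using unit_q1 by (simp add: unit_def)
  have GPnz: "GP a \<noteq> 0" for a using unit_GP[of a] by (simp add: unit_def)
  have mult: "(\<Prod>k<r. \<Prod>h<d. Gp ((1 - fr \<rho> k + of_nat h) / of_nat d)) = H ^ r * GP \<rho> / tau (of_nat d) ^ \<rho>"
    using Gp_multiplication[OF d0 pd \<rho>q] taud by (simp add: H_def field_simps)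
  have R: "{0..r - 1} = {..<r}" using r_pos by auto
  have "(\<Prod>i\<in>{1..d - 1}. \<Prod>k\<in>{0..r - 1}. mterm d j i k) = (\<Prod>k<r. \<Prod>i\<in>{1..d - 1}. mterm d j i k)"
    unfolding R by (rule prod.swap)
  also have "(\<Prod>k<r. \<Prod>i\<in>{1..d - 1}. mterm d j i k) = (\<Prod>k<r. P powi (int (m * p ^ k + fl \<rho> k) - int (d * fl j k)) *
    ((\<Prod>h<d. Gp ((1 - fr \<rho> k + of_nat h) / of_nat d)) / H) / Gp (1 - fr j k) ^ d)"
    unfolding P_def H_def \<rho>_def m_def by (intro prod.cong prod_mterm_k d j) auto
  also have "\<dots> = (\<Prod>k<r. P powi (int (m * p ^ k + fl \<rho> k) - int (d * fl j k))) *
    ((\<Prod>k<r. \<Prod>h<d. Gp ((1 - fr \<rho> k + of_nat h) / of_nat d)) / H ^ r) / GP j ^ d"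
    by (simp add: prod.distrib prod_dividef GP_def prod_power_distrib)
  also have "(\<Prod>k<r. P powi (int (m * p ^ k + fl \<rho> k) - int (d * fl j k))) = P powi (int (m * repunit r + Vp \<rho>) - int (d * Vp j))"
  proof -
    have "(\<Prod>k<r. P powi (int (m * p ^ k + fl \<rho> k) - int (d * fl j k))) = P powi (\<Sum>k<r. int (m * p ^ k + fl \<rho> k) - int (d * fl j k))"
      using P0 by (intro power_int_sum[symmetric]) simp
    also have "(\<Sum>k<r. int (m * p ^ k + fl \<rho> k) - int (d * fl j k)) = int (m * repunit r + Vp \<rho>) - int (d * Vp j)"
      by (simp add: sum_subtractf sum.distrib repunit_def Vp_def sum_distrib_left)
    finally show ?thesis .
  qed
  also have "\<dots> = P ^ (m * repunit r) * P ^ Vp \<rho> / P ^ (d * Vp j)"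
    by (simp only: power_int_diff[OF disjI1[OF P0]] power_int_of_nat power_add)
  also have "P ^ (m * repunit r) = w ^ m" by (simp add: w_def P_def power_mult[symmetric] mult.commute)
  finally have M: "(\<Prod>i\<in>{1..d - 1}. \<Prod>k\<in>{0..r - 1}. mterm d j i k) =
     w ^ m * P ^ Vp \<rho> / P ^ (d * Vp j) * (GP \<rho> / tau (of_nat d) ^ \<rho>) / GP j ^ d"
    unfolding mult using Hnz by simp
  define s where "s a = (- 1 :: 'k) ^ (r + a)" for a
  \<comment> \<open>In \<open>d j = m (q-1) + \<rho>\<close> the number \<open>q - 1\<close> is even
    and \<open>d\<close> is odd, so \<open>j\<close> and \<open>\<rho>\<close> have equal parity and
    the Gross-Koblitz signs cancel.\<close>
  have ss: "s j ^ d * s \<rho> = 1"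
  proof -
    have "d * j = m * (q - 1) + \<rho>" unfolding m_def \<rho>_def by (rule div_mult_mod_eq[symmetric])
    moreover have "even (q - 1)" using odd_q by simp
    ultimately have "even j \<longleftrightarrow> even \<rho>" using d(1) by (metis even_add even_mult_iff)
    then have "even ((r + j) * d + (r + \<rho>))" using d(1) by auto
    then show ?thesis by (simp add: s_def power_mult[symmetric] power_add[symmetric])
  qed
  have gk1: "(1 - of_nat q) * gam j * P ^ Vp j * GP j = s j" unfolding P_def s_def by (rule gross_koblitz[OF j])
  have gk2: "(1 - of_nat q) * gam \<rho> * P ^ Vp \<rho> * GP \<rho> = s \<rho>" unfolding P_def s_def by (rule gross_koblitz[OF \<rho>])
  have jac: "(of_nat q - 1) ^ d * gam j ^ d * w ^ m = gam \<rho> * jacobi d j"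
    unfolding \<rho>_def m_def using gam_jacobi[OF j(2)] \<rho> by (simp add: \<rho>_def)
  have s\<rho>: "s \<rho> \<noteq> 0" by (simp add: s_def)
  then have gnz: "gam \<rho> \<noteq> 0" using gk2 by auto
  have "((1 - of_nat q) * gam j * P ^ Vp j * GP j) ^ d * ((1 - of_nat q) * gam \<rho> * P ^ Vp \<rho> * GP \<rho>) = 1"
    unfolding gk1 gk2 by (rule ss)
  then have "(1 - of_nat q) ^ d * gam j ^ d * P ^ (d * Vp j) * GP j ^ d * ((1 - of_nat q) * gam \<rho> * P ^ Vp \<rho> * GP \<rho>) = 1"
    by (simp add: power_mult_distrib power_mult[symmetric] mult.commute[of d])
  then have one: "((1 - of_nat q) ^ d * (1 - of_nat q)) * (gam j ^ d * P ^ (d * Vp j) * GP j ^ d * (gam \<rho> * P ^ Vp \<rho> * GP \<rho>)) = 1"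
    by (simp only: ac_simps)
  have neg: "(1 - of_nat q :: 'k) ^ d * (1 - of_nat q) = (of_nat q - 1) ^ d * (of_nat q - 1)"
  proof -
    have "(1 - of_nat q :: 'k) = - (of_nat q - 1)" by simp
    then have "(1 - of_nat q :: 'k) ^ d = - ((of_nat q - 1) ^ d)" using d(1) by (metis power_minus_odd)
    then show ?thesis by (simp add: algebra_simps)
  qed
  have "((of_nat q - 1) ^ d * gam j ^ d * w ^ m) * P ^ (d * Vp j) * GP j ^ d * ((of_nat q - 1) * gam \<rho> * P ^ Vp \<rho> * GP \<rho>) =
    w ^ m * (((of_nat q - 1) ^ d * (of_nat q - 1)) * (gam j ^ d * P ^ (d * Vp j) * GP j ^ d * (gam \<rho> * P ^ Vp \<rho> * GP \<rho>)))"
    by (simp only: ac_simps)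
  also have "\<dots> = w ^ m" unfolding neg[symmetric] one by simp
  finally have key: "gam \<rho> * jacobi d j * P ^ (d * Vp j) * GP j ^ d * ((of_nat q - 1) * gam \<rho> * P ^ Vp \<rho> * GP \<rho>) = w ^ m"
    unfolding jac .
  \<comment> \<open>Up to sign \<open>X\<close> is the left-hand side of Gross-Koblitz for
    \<open>\<rho>\<close>, so it is its own inverse; this removes \<open>gam \<rho>\<close> from
    \<open>key\<close> without a division.\<close>
  define X where "X = (of_nat q - 1) * gam \<rho> * P ^ Vp \<rho> * GP \<rho>"
  have "X = - s \<rho>" unfolding gk2[symmetric] X_def by (simp add: algebra_simps)
  then have XX: "X * X = 1" by (simp add: s_def flip: power_mult_distrib)
  have "(of_nat q - 1) * P ^ Vp \<rho> * GP \<rho> * (gam \<rho> * jacobi d j * P ^ (d * Vp j) * GP j ^ d * X) = (of_nat q - 1) * P ^ Vp \<rho> * GP \<rho> * w ^ m"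
    unfolding key[folded X_def] ..
  also have "(of_nat q - 1) * P ^ Vp \<rho> * GP \<rho> * (gam \<rho> * jacobi d j * P ^ (d * Vp j) * GP j ^ d * X) = (X * X) * (jacobi d j * P ^ (d * Vp j) * GP j ^ d)"
    by (simp only: X_def ac_simps)
  finally have J: "jacobi d j * (P ^ (d * Vp j) * GP j ^ d) = (of_nat q - 1) * P ^ Vp \<rho> * GP \<rho> * w ^ m"
    unfolding XX by (simp only: mult_1 mult.assoc)
  have "jacobi d j = (of_nat q - 1) * P ^ Vp \<rho> * GP \<rho> * w ^ m / (P ^ (d * Vp j) * GP j ^ d)"
    unfolding J[symmetric] using P0 GPnz by simp
  moreover have "tau (inverse (of_nat d ^ d)) ^ j = 1 / tau (of_nat d) ^ \<rho>"
  proof -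
    have "tau (inverse (of_nat d ^ d)) ^ j = inverse (tau (of_nat d) ^ (d * j))"
      by (simp add: tau_inverse tau_power power_inverse power_mult)
    also have "tau (of_nat d) ^ (d * j) = tau (of_nat d) ^ \<rho>"
      unfolding \<rho>_def by (rule power_mod_eq[OF tau_power_q1[OF dnz], symmetric])
    finally show ?thesis by (simp add: divide_inverse)
  qed
  ultimately show ?thesis unfolding M by (simp add: ac_simps)
qed

end

theorem theorem1p3:
  fixes d p r :: nat and lam :: "'f::{finite,field}"
    and v :: "'k::field_char_0 \<Rightarrow> int" and res :: "'k \<Rightarrow> 'f"
  assumes "prime d" and "odd d" and "prime p" and "odd p" and "p \<noteq> d" and "r > 0"
    and "card (UNIV :: 'f set) = p ^ r" and "(p ^ r) mod d \<noteq> 1"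
    and "unram_ext p v res"
  shows "(of_nat (card (dwork_points d lam)) :: 'k) =
    (of_nat (p ^ r) ^ (d - 1) - 1) / (of_nat (p ^ r) - 1)
    - mcG p r v res (d - 1) (\<lambda>i. of_nat i / of_nat d) (\<lambda>i. 0) (lam ^ d)"
proof -
  interpret unram p r v res
    by standard (use assms in auto)
  have d1: "d > 1" using assms(1) by (rule prime_gt_1_nat)
  have cpd: "coprime p d" using assms by (intro primes_coprime) auto
  have pd: "\<not> p dvd d" using assms by (metis primes_dvd_imp_eq)
  \<comment> \<open>\<open>d\<close> is prime, so without coprimality it would divide
    \<open>q - 1\<close>, which is the excluded congruence.\<close>
  have cdq: "coprime d (p ^ r - 1)"
  proof (rule ccontr)
    assume "\<not> coprime d (p ^ r - 1)"
    then have "d dvd p ^ r - 1" using assms(1) prime_imp_coprime by blast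
    then obtain k where "p ^ r - 1 = d * k" by blast
    then have "p ^ r = 1 + d * k" using q_ge_3 by linarith
    then have "(p ^ r) mod d = 1 mod d" by (simp only: mod_mult_self2)
    then have "(p ^ r) mod d = 1" using d1 by simp
    then show False using assms(8) by simp
  qed
  define Q :: 'k where "Q = of_nat (p ^ r) - 1"
  have Qnz: "Q \<noteq> 0" using unit_q1 by (simp add: unit_def Q_def)
  define M where "M j = (\<Prod>i\<in>{1..d - 1}. \<Prod>k\<in>{0..r - 1}. mterm d j i k)" for j
  have sgn: "(- 1 :: 'k) ^ (j * (d - 1)) = 1" for j using assms(2) by simp
  have G: "mcG p r v res (d - 1) (\<lambda>i. of_nat i / of_nat d) (\<lambda>i. 0) (lam ^ d) =
      (- 1) / Q * (\<Sum>j\<in>{0..p ^ r - 2}. omega_bar_pow v res j (lam ^ d) * M j)"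
    unfolding mcG_eq sgn Q_def M_def by (simp only: mult_1)
  have dnz: "(of_nat d :: 'f) \<noteq> 0" using of_nat_F_eq_0 pd by blast
  show ?thesis
  proof (cases "lam = 0")
    case True
    have "lam ^ d = 0" using True d1 by simp
    \<comment> \<open>Every character, the trivial one included, is extended by zero, so the term
      \<open>j = 0\<close> vanishes too and the count is that of a hyperplane.\<close>
    then have "mcG p r v res (d - 1) (\<lambda>i. of_nat i / of_nat d) (\<lambda>i. 0) (lam ^ d) = 0"
      unfolding G by (simp add: omega_bar_pow_def)
    then show ?thesis using dwork_count[OF assms(2) cdq, of lam] True Qnz
      unfolding Q_def[symmetric] by (simp add: field_simps)
  next
    case False
    then have t0: "lam ^ d \<noteq> 0" by simp
    have summand: "Q * (omega_bar_pow v res j (lam ^ d) * M j) = tau (inverse ((of_nat d * lam) ^ d)) ^ j * jacobi d j"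
      if "j \<in> {1..p ^ r - 2}" for j
    proof -
      have j: "0 < j" "j < p ^ r - 1" using that q_ge_3 by auto
      have "Q * M j = tau (inverse (of_nat d ^ d)) ^ j * jacobi d j"
        unfolding Q_def M_def by (rule prod_mterm_jacobi[OF assms(2) cpd cdq j])
      then have 1: "Q * (omega_bar_pow v res j (lam ^ d) * M j) = omega_bar_pow v res j (lam ^ d) * (tau (inverse (of_nat d ^ d)) ^ j * jacobi d j)"
        by (metis mult.left_commute)
      have 2: "omega_bar_pow v res j (lam ^ d) = tau (inverse (lam ^ d)) ^ j"
        unfolding omega_bar_pow_def tau_inverse using t0 by (simp only: if_False)
      have "inverse ((of_nat d * lam) ^ d) = inverse (lam ^ d) * inverse (of_nat d ^ d)"
        by (simp add: power_mult_distrib)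
      then have 3: "tau (inverse ((of_nat d * lam) ^ d)) ^ j = tau (inverse (lam ^ d)) ^ j * tau (inverse (of_nat d ^ d)) ^ j"
        by (simp only: tau_mult power_mult_distrib)
      show ?thesis using 1 unfolding 2 3 mult.assoc .
    qed
    \<comment> \<open>The term \<open>j = 0\<close> matches the summand 1 in
      \<open>dwork_count\<close>.\<close>
    have "M 0 = 1" using mterm_0[OF pd] by (simp add: M_def)
    then have "(\<Sum>j\<in>{0..p ^ r - 2}. omega_bar_pow v res j (lam ^ d) * M j) = 1 + (\<Sum>j\<in>{1..p ^ r - 2}. omega_bar_pow v res j (lam ^ d) * M j)"
      using t0 by (subst sum.atLeast_Suc_atMost) (auto simp: omega_bar_pow_def)
    also have "(\<Sum>j\<in>{1..p ^ r - 2}. omega_bar_pow v res j (lam ^ d) * M j) =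
      (\<Sum>j\<in>{1..p ^ r - 2}. tau (inverse ((of_nat d * lam) ^ d)) ^ j * jacobi d j) / Q"
      unfolding sum_divide_distrib using summand Qnz by (intro sum.cong refl) (metis nonzero_mult_div_cancel_left)
    also have "1 + \<dots> = Q * of_nat (card (dwork_points d lam)) - (of_nat (p ^ r) ^ (d - 1) - 1)"
      using dwork_count[OF assms(2) cdq, of lam] False dnz unfolding Q_def[symmetric] by simp
    finally have S: "(\<Sum>j\<in>{0..p ^ r - 2}. omega_bar_pow v res j (lam ^ d) * M j) = Q * of_nat (card (dwork_points d lam)) - (of_nat (p ^ r) ^ (d - 1) - 1)" .
    show ?thesis unfolding G S Q_def[symmetric] using Qnz by (simp add: field_simps)
  qed
qed

end
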